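(* Let $J=(J_t)_{t\ge0}$ be a continuous-time Markov chain on $E=\{1,\dots,N\}$ with intensity matrix $Q=(q_{ij})$, and let $(X,J)$ be the Markov modulated risk process \[X_t=x+\int_0^t p_{J_u}\,\mathrm d u-\sum_{k=1}^{N_t}C_k-\sum_{T_k\le t}C_k^{(J_{T_k-},J_{T_k})},\] where: - $p_i>0$ are premium rates; - $N$ is a Markov modulated Poisson process with intensity $\lambda_i$ while $J=i$; - claims arriving while $J=i$ have distribution $F_C^{(i)}$ on $[0,\infty)$; - the $T_k$ are the jump epochs of $J$, and a jump $i\to j$ produces an extra claim with distribution $F_C^{(ij)}$ on $[0,\infty)$. Assume the net profit condition $\mathbb E_{0,i}X_1>0$ for all $i\in E$. Let $\tau_0^-=\inf\{t\ge0:X_t<0\}$ and $\overline\phi_i(x)=\mathbb P_{x,i}(\tau_0^-=\infty)$. Let $W=W^{(0)}$ and $Z=Z^{(0)}$ be the scale matrices at $q=0$, and let \[\mathbf C_{W(\infty)^{-1}Z(\infty)}=\lim_{a\to\infty}W(a)^{-1}Z(a),\] which is finite. Then for $x\ge0$ and $i\in E$, \[\overline\phi_i(x)=\big(W(x)\,\mathbf C_{W(\infty)^{-1}Z(\infty)}\mathbf 1\big)_i,\] where $\mathbf 1$ is the column vector of ones.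
   Context: $\mathbb P_{x,i}$ denotes the law given $X_0=x$, $J_0=i$. Claims are conditionally independent given $J$. The matrix exponent is \[F(\alpha)=\mathrm{diag}\big(p_i\alpha+\lambda_i(\mathbb E e^{-\alpha C^{(i)}}-1)\big)+\big(q_{ij}\mathbb E e^{-\alpha C^{(ij)}}\big)_{i,j},\] with $C^{(ii)}:=0$. For $q\ge0$, $W^{(q)}$ is the continuous matrix function on $[0,\infty)$ with \[\int_0^\infty e^{-\alpha x}W^{(q)}(x)\,\mathrm d x=(F(\alpha)-q\mathbb I)^{-1}\] for large $\alpha$, and \[Z^{(q)}(x)=\mathbb I-\int_0^xW^{(q)}(y)\,\mathrm d y\,(Q-q\mathbb I).\] *)

theory Defs
  imports "HOL-Analysis.Analysis" "HOL-Probability.Probability"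
begin

text \<open>
  The process (X,J) is a piecewise deterministic Markov process: in state i, X drifts upward
  at rate p i; at rate lam i a claim with law FC i arrives (J stays at i); at rate q_ij (j ~= i)
  J jumps to j and a claim with law FCJ i j arrives.  We realise its law canonically with
  competing exponential clocks.  At every step n the sample point provides an independent
  copy of: one Exp(1) clock for the claim event, one Exp(1) clock for every possible switch
  target, a claim C^(i) for every i, and a claim C^(ij) for every pair (convention C^(ii) = 0).
\<close>

type_synonym 'n step = "(real \<times> ('n \<Rightarrow> real)) \<times> (('n \<Rightarrow> real) \<times> ('n \<times> 'n \<Rightarrow> real))"

definition exp1 :: "real measure" where
  "exp1 = density lborel (exponential_density 1)"

definition step_measure ::
  "('n::finite \<Rightarrow> real measure) \<Rightarrow> ('n \<Rightarrow> 'n \<Rightarrow> real measure) \<Rightarrow> 'n step measure" where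
  "step_measure FC FCJ =
     (exp1 \<Otimes>\<^sub>M (\<Pi>\<^sub>M k\<in>UNIV. exp1)) \<Otimes>\<^sub>M
     ((\<Pi>\<^sub>M i\<in>UNIV. FC i) \<Otimes>\<^sub>M
      (\<Pi>\<^sub>M ij\<in>UNIV. (if fst ij = snd ij then return borel 0 else FCJ (fst ij) (snd ij))))"

text \<open>Sample space: i.i.d. sequence of step primitives. P_{x,i} is this measure, with the
  path built from initial values x, i.\<close>
definition Omega ::
  "('n::finite \<Rightarrow> real measure) \<Rightarrow> ('n \<Rightarrow> 'n \<Rightarrow> real measure) \<Rightarrow> (nat \<Rightarrow> 'n step) measure" where
  "Omega FC FCJ = (\<Pi>\<^sub>M n\<in>UNIV. step_measure FC FCJ)"

definition ev_times :: "('n::finite \<Rightarrow> real) \<Rightarrow> real^'n^'n \<Rightarrow> 'n \<Rightarrow> 'n step \<Rightarrow> real set" where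
  "ev_times lam Q j s =
     (if 0 < lam j then {fst (fst s) / lam j} else {}) \<union>
     {snd (fst s) k / Q$j$k | k. k \<noteq> j \<and> 0 < Q$j$k}"

definition mm_step ::
  "('n::finite \<Rightarrow> real) \<Rightarrow> real^'n^'n \<Rightarrow> 'n \<Rightarrow> 'n step \<Rightarrow> (real \<times> 'n \<times> real) option" where
  "mm_step lam Q j s =
     (if ev_times lam Q j s = {} then None else
      (let h = Min (ev_times lam Q j s) in
       if 0 < lam j \<and> fst (fst s) / lam j = h then Some (h, j, fst (snd s) j)
       else (let k = (SOME k. k \<noteq> j \<and> 0 < Q$j$k \<and> snd (fst s) k / Q$j$k = h)
             in Some (h, k, snd (snd s) (j, k)))))"

text \<open>Embedded skeleton: (event time T_n, state J_{T_n}, surplus X_{T_n}, event n occurred).\<close>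
primrec skel ::
  "('n::finite \<Rightarrow> real) \<Rightarrow> ('n \<Rightarrow> real) \<Rightarrow> real^'n^'n \<Rightarrow> real \<Rightarrow> 'n \<Rightarrow> (nat \<Rightarrow> 'n step)
     \<Rightarrow> nat \<Rightarrow> real \<times> 'n \<times> real \<times> bool" where
  "skel p lam Q x i \<omega> 0 = (0, i, x, True)"
| "skel p lam Q x i \<omega> (Suc n) =
     (case skel p lam Q x i \<omega> n of (t, j, y, a) \<Rightarrow>
        if a then (case mm_step lam Q j (\<omega> n) of
                     None \<Rightarrow> (t, j, y, False)
                   | Some (h, k, c) \<Rightarrow> (t + h, k, y + p j * h - c, True))
        else (t, j, y, False))"

definition last_ev :: "('n::finite \<Rightarrow> real) \<Rightarrow> ('n \<Rightarrow> real) \<Rightarrow> real^'n^'n \<Rightarrow> real \<Rightarrow> 'n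
     \<Rightarrow> (nat \<Rightarrow> 'n step) \<Rightarrow> real \<Rightarrow> nat" where
  "last_ev p lam Q x i \<omega> t =
     (GREATEST n. snd (snd (snd (skel p lam Q x i \<omega> n))) \<and> fst (skel p lam Q x i \<omega> n) \<le> t)"

definition Xpath :: "('n::finite \<Rightarrow> real) \<Rightarrow> ('n \<Rightarrow> real) \<Rightarrow> real^'n^'n \<Rightarrow> real \<Rightarrow> 'n
     \<Rightarrow> (nat \<Rightarrow> 'n step) \<Rightarrow> real \<Rightarrow> real" where
  "Xpath p lam Q x i \<omega> t =
     (case skel p lam Q x i \<omega> (last_ev p lam Q x i \<omega> t) of
        (T, j, y, a) \<Rightarrow> y + p j * (t - T))"

definition tau0 :: "('n::finite \<Rightarrow> real) \<Rightarrow> ('n \<Rightarrow> real) \<Rightarrow> real^'n^'n \<Rightarrow> real \<Rightarrow> 'n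
     \<Rightarrow> (nat \<Rightarrow> 'n step) \<Rightarrow> ereal" where
  "tau0 p lam Q x i \<omega> = Inf (ereal ` {t. 0 \<le> t \<and> Xpath p lam Q x i \<omega> t < 0})"

definition phibar :: "('n::finite \<Rightarrow> real) \<Rightarrow> ('n \<Rightarrow> real) \<Rightarrow> real^'n^'n
     \<Rightarrow> ('n \<Rightarrow> real measure) \<Rightarrow> ('n \<Rightarrow> 'n \<Rightarrow> real measure) \<Rightarrow> 'n \<Rightarrow> real \<Rightarrow> real" where
  "phibar p lam Q FC FCJ i x =
     measure (Omega FC FCJ) {\<omega> \<in> space (Omega FC FCJ). tau0 p lam Q x i \<omega> = \<infinity>}"

definition LT :: "real measure \<Rightarrow> real \<Rightarrow> real" where
  "LT M \<alpha> = (\<integral>c. exp (- \<alpha> * c) \<partial>M)"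

definition Fmat :: "('n::finite \<Rightarrow> real) \<Rightarrow> ('n \<Rightarrow> real) \<Rightarrow> real^'n^'n
     \<Rightarrow> ('n \<Rightarrow> real measure) \<Rightarrow> ('n \<Rightarrow> 'n \<Rightarrow> real measure) \<Rightarrow> real \<Rightarrow> real^'n^'n" where
  "Fmat p lam Q FC FCJ \<alpha> =
     (\<chi> i j. if i = j then p i * \<alpha> + lam i * (LT (FC i) \<alpha> - 1) + Q$i$i
             else Q$i$j * LT (FCJ i j) \<alpha>)"

definition is_scale_W :: "('n::finite \<Rightarrow> real) \<Rightarrow> ('n \<Rightarrow> real) \<Rightarrow> real^'n^'n
     \<Rightarrow> ('n \<Rightarrow> real measure) \<Rightarrow> ('n \<Rightarrow> 'n \<Rightarrow> real measure) \<Rightarrow> (real \<Rightarrow> real^'n^'n) \<Rightarrow> bool" where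
  "is_scale_W p lam Q FC FCJ W \<longleftrightarrow>
     continuous_on {0..} W \<and>
     (\<exists>\<alpha>0. \<forall>\<alpha>>\<alpha>0. invertible (Fmat p lam Q FC FCJ \<alpha>) \<and>
        ((\<lambda>x. exp (- \<alpha> * x) *\<^sub>R W x) has_integral matrix_inv (Fmat p lam Q FC FCJ \<alpha>)) {0..})"

definition Zmat :: "(real \<Rightarrow> real^'n::finite^'n) \<Rightarrow> real^'n^'n \<Rightarrow> real \<Rightarrow> real^'n^'n" where
  "Zmat W Q x = mat 1 - integral {0..x} W ** Q"

end

theory Submission
  imports Defs
begin

text \<open>
  Inverting the Laplace transform turns the definition of \<open>W\<close> into the integrated equation
  \<open>p W = I + \<eta> G - \<nu> * G\<close> with \<open>G = \<integral> W\<close>, where \<open>\<nu>\<close> collects the claim measures weighted by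
  their rates and \<open>\<eta>\<close> is the total event rate. Hence the columns of \<open>W\<close> solve the equation that
  conditions on the next event or on reaching a higher level, and the columns of \<open>Z\<close> solve it with
  a nonnegative source, the rate of claims causing ruin. Reaching level \<open>a\<close> without any event has
  probability bounded away from zero, so the equation on \<open>[0, a]\<close> obeys a minimum principle. It gives
  that \<open>W a\<close> is invertible, that \<open>W x W(a)\<^sup>-\<^sup>1 \<ge> 0\<close> and that \<open>Z x - W x W(a)\<^sup>-\<^sup>1 Z a \<ge> 0\<close>;
  at \<open>x = 0\<close> these make \<open>W(a)\<^sup>-\<^sup>1 Z a\<close> entrywise decreasing in \<open>a\<close> and bounded, so the limit exists.
  The survival probability and \<open>x \<mapsto> W x C 1\<close> are both the largest solution bounded by \<open>1\<close>.
\<close>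

section \<open>Laplace transforms\<close>

text \<open>The transform of \<open>W\<close> is only an improper integral and may converge
  conditionally, so Fubini cannot be applied to \<open>W\<close> itself. One integration repairs
  this: an antiderivative grows at most like exp (\<alpha>1 * x), so its transform converges
  absolutely for \<alpha> > \<alpha>1. Hence the equation for \<open>W\<close> is found in
  integrated form. It is not simply differentiated afterwards: \<open>W 0\<close> is not zero, so
  atoms of the claim laws make the convolution jump. All solutions are therefore handled in the mild
  form that variation of constants gives.

  The comparison has to be made on bounded intervals. There the chance
  \<open>survive_bound a\<close> of drifting up by \<open>a\<close> without an event is the
  contraction gap; it may shrink to 0 as \<open>a\<close> grows. The probability of surviving
  \<open>N\<close> events is thus bounded above by the probability of reaching \<open>a\<close>
  before ruin plus a geometric error in \<open>N\<close>; \<open>N\<close> tends to infinity for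
  fixed \<open>a\<close>, and \<open>a\<close> only afterwards. The lower bound by
  \<open>psi\<close> is an induction on \<open>N\<close> that starts from \<open>psi\<close> \<le>
  1.\<close>

lemma has_integral_atLeast_imp_tendsto:
  fixes f :: "real \<Rightarrow> real"
  assumes "(f has_integral I) {a..}"
  shows "((\<lambda>R. integral {a..R} f) \<longlongrightarrow> I) at_top"
proof (rule tendstoI)
  fix e :: real assume "0 < e"
  then obtain B where B: "B > 0" and B2:
    "\<And>l u. ball 0 B \<subseteq> cbox l u \<Longrightarrow>
       norm (integral (cbox l u) (\<lambda>x. if x \<in> {a..} then f x else 0) - I) < e"
    using assms unfolding has_integral_alt'[of f] by blast
  then have *: "norm (integral ({a..} \<inter> {l..u}) f - I) < e" if "ball 0 B \<subseteq> {l..u}" for l u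
    by (subst integral_restrict_Int[of "{l..u}" "{a..}", symmetric]) (use B2[of l u] that in simp)
  show "\<forall>\<^sub>F R in at_top. dist (integral {a..R} f) I < e"
  proof (rule eventually_at_top_linorderI)
    fix R assume "R \<ge> B"
    have "{a..} \<inter> {-(B + \<bar>a\<bar>)..R} = {a..R}" using B by auto
    moreover have "ball 0 B \<subseteq> {-(B + \<bar>a\<bar>)..R}"
      using \<open>R \<ge> B\<close> B by (auto simp: dist_real_def)
    ultimately show "dist (integral {a..R} f) I < e"
      using *[of "-(B + \<bar>a\<bar>)" R] by (simp only: dist_norm)
  qed
qed

lemma bounded_of_continuous_tendsto_at_top:
  fixes g :: "real \<Rightarrow> real"
  assumes "continuous_on {a..} g" "(g \<longlongrightarrow> l) at_top"
  obtains M where "0 \<le> M" "\<And>x. a \<le> x \<Longrightarrow> \<bar>g x\<bar> \<le> M"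
proof -
  have "\<forall>\<^sub>F x in at_top. dist (g x) l < 1" using assms(2) by (rule tendstoD) simp
  then obtain R where R: "\<And>x. x \<ge> R \<Longrightarrow> dist (g x) l < 1"
    by (auto simp: eventually_at_top_linorder)
  have "compact (g ` {a..R})"
    by (intro compact_continuous_image continuous_on_subset[OF assms(1)]) auto
  then obtain K where K: "\<And>x. x \<in> {a..R} \<Longrightarrow> \<bar>g x\<bar> \<le> K"
    by (force dest!: compact_imp_bounded simp: bounded_iff)
  show ?thesis
  proof
    fix x assume "a \<le> x"
    then show "\<bar>g x\<bar> \<le> \<bar>K\<bar> + \<bar>l\<bar> + 1"
      using K[of x] R[of x] by (cases "x \<le> R") (auto simp: dist_real_def)
  qed simp
qed

lemma antiderivative_has_vector_derivative:
  fixes w :: "real \<Rightarrow> real"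
  assumes "continuous_on {0..} w" "x \<in> {0..R}"
  shows "((\<lambda>x. integral {0..x} w) has_vector_derivative w x) (at x within {0..R})"
  using assms by (intro integral_has_vector_derivative) (auto elim: continuous_on_subset)

lemma antiderivative_continuous:
  fixes w :: "real \<Rightarrow> real"
  assumes "continuous_on {0..} w"
  shows "continuous_on {0..} (\<lambda>x. integral {0..x} w)"
proof -
  have "continuous_on {0..R} (\<lambda>x. integral {0..x} w)" for R
    by (rule continuous_on_vector_derivative[OF antiderivative_has_vector_derivative[OF assms]])
  show ?thesis
    unfolding continuous_on_eq_continuous_within
  proof
    fix x :: real assume x: "x \<in> {0..}"
    have "continuous (at x within {0..x+1}) (\<lambda>x. integral {0..x} w)"
      using \<open>continuous_on {0..x+1} _\<close> x by (auto simp: continuous_on_eq_continuous_within)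
    moreover have "at x within {0..x+1} = at x within {0..}"
      by (rule at_within_nhd[where S="{x-1<..<x+1}"]) (use x in auto)
    ultimately show "continuous (at x within {0..}) (\<lambda>x. integral {0..x} w)" by simp
  qed
qed

text \<open>Integration by parts. With negative \<open>c\<close> it passes from the transform of
  \<open>w\<close> to that of its antiderivative; with positive \<open>c\<close> it undoes a damping
  factor.\<close>

lemma integral_exp_mult_antiderivative:
  fixes w :: "real \<Rightarrow> real"
  assumes w: "continuous_on {0..} w" and R: "0 \<le> R"
  defines "G \<equiv> \<lambda>x. integral {0..x} w"
  shows "c * integral {0..R} (\<lambda>x. exp (c * x) * G x) =
         exp (c * R) * G R - integral {0..R} (\<lambda>x. exp (c * x) * w x)"
proof -
  have Gc: "continuous_on {0..R} G"
    unfolding G_def by (rule continuous_on_subset[OF antiderivative_continuous[OF w]]) auto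
  have wc: "continuous_on {0..R} w" by (rule continuous_on_subset[OF w]) auto
  have "((\<lambda>x. c * (exp (c * x) * G x) + exp (c * x) * w x) has_integral
          (exp (c * R) * G R - exp (c * 0) * G 0)) {0..R}"
  proof (rule fundamental_theorem_of_calculus[OF R])
    fix x assume x: "x \<in> {0..R}"
    have "(G has_field_derivative w x) (at x within {0..R})"
      using antiderivative_has_vector_derivative[OF w x]
      by (simp add: G_def has_real_derivative_iff_has_vector_derivative)
    then have "((\<lambda>x. exp (c * x) * G x) has_field_derivative (c * (exp (c * x) * G x) + exp (c * x) * w x))
           (at x within {0..R})"
      by (auto intro!: derivative_eq_intros simp: algebra_simps)
    then show "((\<lambda>x. exp (c * x) * G x) has_vector_derivative (c * (exp (c * x) * G x) + exp (c * x) * w x))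
           (at x within {0..R})"
      by (simp add: has_real_derivative_iff_has_vector_derivative)
  qed
  then have "integral {0..R} (\<lambda>x. c * (exp (c * x) * G x) + exp (c * x) * w x) = exp (c * R) * G R"
    by (simp add: integral_unique G_def)
  moreover have "integral {0..R} (\<lambda>x. c * (exp (c * x) * G x) + exp (c * x) * w x) =
     c * integral {0..R} (\<lambda>x. exp (c * x) * G x) + integral {0..R} (\<lambda>x. exp (c * x) * w x)"
    by (subst integral_add) (auto intro!: integrable_continuous_real continuous_intros Gc wc)
  ultimately show ?thesis by linarith
qed

text \<open>Lerch's theorem. In the variable v = exp (- x) the transforms at integer points become
  moments on [0,1], so a function all of whose moments vanish is orthogonal to its own polynomial
  approximations. The argument is run on a damped antiderivative, because the integrals of
  \<open>f\<close> may converge only conditionally.\<close>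

lemma laplace_transform_unique:
  fixes f :: "real \<Rightarrow> real"
  assumes f: "continuous_on {0..} f"
    and lap: "\<And>\<alpha>. \<alpha> > \<alpha>0 \<Longrightarrow> ((\<lambda>x. exp (- \<alpha> * x) * f x) has_integral 0) {0..}"
    and x: "0 \<le> x"
  shows "f x = 0"
proof -
  \<comment> \<open>Damping at \<alpha>0 + 1, where the transform is known to vanish, gives the
    antiderivative \<open>g\<close> the limit 0 at infinity and hence a bound
    \<open>M\<close>.\<close>
  define u where "u = (\<lambda>y. exp (- (\<alpha>0 + 1) * y) * f y)"
  define g where "g = (\<lambda>x. integral {0..x} u)"
  have u: "continuous_on {0..} u" unfolding u_def by (intro continuous_intros f)
  have g: "continuous_on {0..} g" unfolding g_def by (rule antiderivative_continuous[OF u])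
  have g_lim: "(g \<longlongrightarrow> 0) at_top"
    unfolding g_def u_def by (rule has_integral_atLeast_imp_tendsto[OF lap]) simp
  obtain M where M: "0 \<le> M" "\<And>x. 0 \<le> x \<Longrightarrow> \<bar>g x\<bar> \<le> M"
    using bounded_of_continuous_tendsto_at_top[OF g g_lim] by blast
  have gR: "continuous_on {0..R} g" for R
    by (rule continuous_on_subset[OF g]) auto
  \<comment> \<open>Parts moves the weight from \<open>u\<close> to \<open>g\<close>. The transform
    of \<open>u\<close> at n + 1 is that of \<open>f\<close> at \<alpha>0 + n + 2, and the boundary
    term dies because \<open>g\<close> does.\<close>
  have moment: "((\<lambda>R. integral {0..R} (\<lambda>x. exp (- (real n + 1) * x) * g x)) \<longlongrightarrow> 0) at_top" for n
  proof -
    let ?c = "- (real n + 1)"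
    have 1: "((\<lambda>R. integral {0..R} (\<lambda>x. exp (?c * x) * u x)) \<longlongrightarrow> 0) at_top"
    proof -
      have "(\<lambda>x. exp (?c * x) * u x) = (\<lambda>x. exp (- (\<alpha>0 + 1 + (real n + 1)) * x) * f x)"
        by (auto simp: u_def exp_add[symmetric] algebra_simps)
      then show ?thesis
        using has_integral_atLeast_imp_tendsto[OF lap[of "\<alpha>0 + 1 + (real n + 1)"]] by simp
    qed
    have 2: "((\<lambda>R. exp (?c * R) * g R) \<longlongrightarrow> 0) at_top"
    proof (rule Lim_null_comparison[OF _ g_lim[THEN tendsto_norm_zero]])
      show "\<forall>\<^sub>F R in at_top. norm (exp (?c * R) * g R) \<le> norm (g R)"
        using eventually_ge_at_top[of 0]
        by eventually_elim (auto simp: abs_mult intro!: mult_left_le_one_le mult_nonpos_nonneg)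
    qed
    have "((\<lambda>R. (exp (?c * R) * g R - integral {0..R} (\<lambda>x. exp (?c * x) * u x)) / ?c) \<longlongrightarrow> (0 - 0) / ?c) at_top"
      by (intro tendsto_intros 1 2) linarith
    then have "((\<lambda>R. (exp (?c * R) * g R - integral {0..R} (\<lambda>x. exp (?c * x) * u x)) / ?c) \<longlongrightarrow> 0) at_top"
      by simp
    moreover have "\<forall>\<^sub>F R in at_top. (exp (?c * R) * g R - integral {0..R} (\<lambda>x. exp (?c * x) * u x)) / ?c
        = integral {0..R} (\<lambda>x. exp (?c * x) * g x)"
      using eventually_ge_at_top[of 0]
    proof eventually_elim
      case (elim R)
      show ?case
        using integral_exp_mult_antiderivative[OF u elim, of ?c]
        by (simp add: divide_eq_eq g_def) (simp add: algebra_simps)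
    qed
    ultimately show ?thesis by (rule Lim_transform_eventually)
  qed
  have zero: "integral {0..S} (\<lambda>x. exp (- x) * (g x)\<^sup>2) = 0" if S: "0 \<le> S" for S
  proof -
    have nonneg: "0 \<le> integral {0..S} (\<lambda>x. exp (- x) * (g x)\<^sup>2)"
      by (rule integral_nonneg) (auto intro!: integrable_continuous_real continuous_intros gR)
    have "integral {0..S} (\<lambda>x. exp (- x) * (g x)\<^sup>2) \<le> 0 + e * M" if e: "0 < e" for e
    proof -
      \<comment> \<open>This is \<open>g\<close> in the variable exp (- x). Its value at 0 is the
        limit of \<open>g\<close> at infinity, which makes it continuous on the compact interval
        that Weierstrass needs.\<close>
      define h where "h = (\<lambda>u. if u = 0 then 0 else g (- ln u))"
      have h: "continuous_on {0..1} h"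
        unfolding continuous_on_eq_continuous_within
      proof
        fix v :: real assume v: "v \<in> {0..1}"
        show "continuous (at v within {0..1}) h"
        proof (cases "v = 0")
          case True
          have "((\<lambda>u. g (- ln u)) \<longlongrightarrow> 0) (at_right 0)"
            by (rule filterlim_compose[OF g_lim])
               (auto intro!: filterlim_compose[OF filterlim_uminus_at_top_at_bot ln_at_0])
          moreover have "\<forall>\<^sub>F u in at_right 0. g (- ln u) = h u"
            unfolding eventually_at_filter by (auto simp: h_def)
          ultimately have "(h \<longlongrightarrow> 0) (at_right 0)" by (rule Lim_transform_eventually)
          moreover have "at (0::real) within {0..1} = at_right 0"
            by (rule at_within_nhd[where S="{-1<..<1}"]) auto
          ultimately show ?thesis using True by (simp add: continuous_within h_def)
        next
          case False
          have "continuous_on {0<..1} (\<lambda>u. g (- ln u))"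
            by (rule continuous_on_compose2[OF g]) (auto intro!: continuous_intros)
          then have "continuous_on {0<..1} h"
            by (rule continuous_on_eq) (auto simp: h_def)
          then have "continuous (at v within {0<..1}) h"
            using v False by (auto simp: continuous_on_eq_continuous_within)
          moreover have "at v within {0<..1} = at v within {0..1}"
            by (rule at_within_nhd[where S="{0<..}"]) (use v False in auto)
          ultimately show ?thesis by simp
        qed
      qed
      obtain P where P: "real_polynomial_function P" "\<And>v. v \<in> {0..1} \<Longrightarrow> \<bar>h v - P v\<bar> < e"
        using Stone_Weierstrass_real_polynomial_function[OF _ h e] by auto
      then obtain a n where Pa: "P = (\<lambda>x. \<Sum>i\<le>n. a i * x ^ i)"
        using real_polynomial_function_iff_sum by blast
      have close: "\<bar>g x - P (exp (- x))\<bar> \<le> e" if "0 \<le> x" for x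
        using P(2)[of "exp (-x)"] that by (auto simp: h_def)
      have Pc: "continuous_on A P" for A
        unfolding Pa by (intro continuous_intros)
      have Plim: "((\<lambda>R. integral {0..R} (\<lambda>x. exp (- x) * P (exp (- x)) * g x)) \<longlongrightarrow> 0) at_top"
      proof -
        have "integral {0..R} (\<lambda>x. exp (- x) * P (exp (- x)) * g x) =
           (\<Sum>i\<le>n. a i * integral {0..R} (\<lambda>x. exp (- (real i + 1) * x) * g x))" for R
        proof -
          have "exp (- x) * P (exp (- x)) * g x = (\<Sum>i\<le>n. a i * (exp (- (real i + 1) * x) * g x))" for x
            by (simp add: Pa sum_distrib_left sum_distrib_right exp_of_nat_mult[symmetric] exp_add[symmetric] algebra_simps)
          then show ?thesis
            by (simp only:) (subst integral_sum, auto intro!: integrable_continuous_real continuous_intros gR)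
        qed
        moreover have "((\<lambda>R. \<Sum>i\<le>n. a i * integral {0..R} (\<lambda>x. exp (- (real i + 1) * x) * g x)) \<longlongrightarrow> (\<Sum>i\<le>n. a i * 0)) at_top"
          by (intro tendsto_intros moment)
        ultimately show ?thesis by simp
      qed
      have ev: "integral {0..S} (\<lambda>x. exp (- x) * (g x)\<^sup>2) \<le>
           integral {0..R} (\<lambda>x. exp (- x) * P (exp (- x)) * g x) + e * M" if R: "R \<ge> S" for R
      proof -
        have "integral {0..S} (\<lambda>x. exp (- x) * (g x)\<^sup>2) \<le> integral {0..R} (\<lambda>x. exp (- x) * (g x)\<^sup>2)"
          by (rule integral_subset_le) (use R in \<open>auto intro!: integrable_continuous_real continuous_intros gR\<close>)
        also have "\<dots> \<le> integral {0..R} (\<lambda>x. exp (- x) * P (exp (- x)) * g x + e * M * exp (- x))"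
        proof (rule integral_le)
          fix x assume "x \<in> {0..R}"
          then have x: "0 \<le> x" by simp
          \<comment> \<open>Split g^2 = P g + (g - P) g. The second term is at most e * M, and the
            weight exp (- x) has mass at most 1.\<close>
          have "(g x - P (exp (- x))) * g x \<le> \<bar>g x - P (exp (- x))\<bar> * \<bar>g x\<bar>"
            by (metis abs_ge_self abs_mult)
          also have "\<dots> \<le> e * M" using close[OF x] M(2)[OF x] e by (intro mult_mono) auto
          finally have "exp (- x) * ((g x - P (exp (- x))) * g x) \<le> exp (-x) * (e * M)"
            by (intro mult_left_mono) auto
          then show "exp (- x) * (g x)\<^sup>2 \<le> exp (- x) * P (exp (- x)) * g x + e * M * exp (- x)"
            by (simp add: algebra_simps power2_eq_square)
        qed (auto intro!: integrable_continuous_real continuous_intros gR continuous_on_compose2[OF Pc[of UNIV]])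
        also have "\<dots> = integral {0..R} (\<lambda>x. exp (- x) * P (exp (- x)) * g x) + e * M * integral {0..R} (\<lambda>x. exp (- x))"
          by (subst integral_add) (auto intro!: integrable_continuous_real continuous_intros gR continuous_on_compose2[OF Pc[of UNIV]])
        finally have "integral {0..S} (\<lambda>x. exp (- x) * (g x)\<^sup>2) \<le> integral {0..R} (\<lambda>x. exp (- x) * P (exp (- x)) * g x) + e * M * integral {0..R} (\<lambda>x. exp (- x))" .
        moreover have "integral {0..R} (\<lambda>x. exp (- x)) \<le> (1::real)"
        proof -
          have "((\<lambda>x. exp (- x)) has_integral (- exp (- R)) - (- exp (- 0))) {0..R}"
            by (rule fundamental_theorem_of_calculus)
               (use S R in \<open>auto intro!: derivative_eq_intros simp: has_real_derivative_iff_has_vector_derivative[symmetric]\<close>)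
          then show ?thesis by (simp add: integral_unique)
        qed
        then have "e * M * integral {0..R} (\<lambda>x. exp (- x)) \<le> e * M * 1"
          by (rule mult_left_mono) (use e M(1) in simp)
        ultimately show ?thesis by linarith
      qed
      show ?thesis
      proof (rule tendsto_lowerbound[of "\<lambda>R. integral {0..R} (\<lambda>x. exp (- x) * P (exp (- x)) * g x) + e * M" _ at_top])
        show "((\<lambda>R. integral {0..R} (\<lambda>x. exp (- x) * P (exp (- x)) * g x) + e * M) \<longlongrightarrow> 0 + e * M) at_top"
          by (intro tendsto_intros Plim)
        show "\<forall>\<^sub>F R in at_top. integral {0..S} (\<lambda>x. exp (- x) * (g x)\<^sup>2) \<le>
           integral {0..R} (\<lambda>x. exp (- x) * P (exp (- x)) * g x) + e * M"
          using eventually_ge_at_top[of S] by eventually_elim (rule ev)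
      qed simp
    qed
    then have eM: "integral {0..S} (\<lambda>x. exp (- x) * (g x)\<^sup>2) \<le> 0 + e * M" if "0 < e" for e
      using that .
    have "integral {0..S} (\<lambda>x. exp (- x) * (g x)\<^sup>2) \<le> 0 + d" if "0 < d" for d
    proof -
      \<comment> \<open>Dividing by M + 1 instead of M covers M = 0.\<close>
      have "d / (M + 1) * M \<le> d" using M(1) that by (simp add: field_simps)
      then show ?thesis using eM[of "d / (M + 1)"] M(1) that by simp
    qed
    then have "integral {0..S} (\<lambda>x. exp (- x) * (g x)\<^sup>2) \<le> 0" by (rule field_le_epsilon)
    with nonneg show ?thesis by simp
  qed
  have g0: "g y = 0" if y: "0 \<le> y" for y
  proof -
    have "\<forall>x\<in>{0..y+1}. exp (- x) * (g x)\<^sup>2 = 0"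
      by (rule iffD1[OF integral_eq_0_iff zero]) (use y in \<open>auto intro!: continuous_intros gR\<close>)
    then show ?thesis using y by simp
  qed
  \<comment> \<open>\<open>g\<close> vanishes, so its derivative \<open>u\<close> does. The
    derivative within {0..x+1} is meaningful at x = 0 as well.\<close>
  have "(g has_vector_derivative u x) (at x within {0..x+1})"
    unfolding g_def by (rule antiderivative_has_vector_derivative[OF u]) (use x in auto)
  moreover have "(g has_vector_derivative 0) (at x within {0..x+1})"
    by (rule has_vector_derivative_transform[of _ _ _ "\<lambda>_. 0"]) (use x g0 in auto)
  ultimately have "u x = 0"
    using x by (intro vector_derivative_unique_within_closed_interval[of 0 "x+1" x g "u x" 0]) auto
  then show ?thesis by (simp add: u_def)
qed


section \<open>Exponential bounds, and transforms of antiderivatives and convolutions\<close>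

lemma antiderivative_exp_bound:
  fixes w :: "real \<Rightarrow> real"
  assumes w: "continuous_on {0..} w" and \<alpha>: "0 < \<alpha>"
    and I: "((\<lambda>x. exp (- \<alpha> * x) * w x) has_integral I) {0..}"
  obtains M where "0 \<le> M" "\<And>x. 0 \<le> x \<Longrightarrow> \<bar>integral {0..x} w\<bar> \<le> M * exp (\<alpha> * x)"
proof -
  \<comment> \<open>\<open>w\<close> may be unbounded, but the damped antiderivative
    \<open>g\<close> converges and so has a bound \<open>M\<close>. Integrating w = exp (\<alpha> *
    y) * u by parts gives a boundary term and an integral, each at most M * exp (\<alpha> * x);
    hence the factor 2 below.\<close>
  define u where "u = (\<lambda>x. exp (- \<alpha> * x) * w x)"
  define g where "g = (\<lambda>x. integral {0..x} u)"
  have u: "continuous_on {0..} u" unfolding u_def by (intro continuous_intros w)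
  have g: "continuous_on {0..} g" unfolding g_def by (rule antiderivative_continuous[OF u])
  obtain M where M: "0 \<le> M" "\<And>x. 0 \<le> x \<Longrightarrow> \<bar>g x\<bar> \<le> M"
    using bounded_of_continuous_tendsto_at_top[OF g, of I] has_integral_atLeast_imp_tendsto[OF I]
    by (auto simp: g_def u_def)
  show ?thesis
  proof
    show "0 \<le> 2 * M" using M by simp
    fix x :: real assume x: "0 \<le> x"
    have gc: "continuous_on {0..x} g" by (rule continuous_on_subset[OF g]) auto
    have "integral {0..x} w = integral {0..x} (\<lambda>y. exp (\<alpha> * y) * u y)"
      by (rule integral_cong) (simp add: u_def exp_minus field_simps)
    also have "\<dots> = exp (\<alpha> * x) * g x - \<alpha> * integral {0..x} (\<lambda>y. exp (\<alpha> * y) * g y)"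
      using integral_exp_mult_antiderivative[OF u x, of \<alpha>] by (simp add: g_def)
    finally have "\<bar>integral {0..x} w\<bar> \<le>
        \<bar>exp (\<alpha> * x) * g x\<bar> + \<bar>\<alpha> * integral {0..x} (\<lambda>y. exp (\<alpha> * y) * g y)\<bar>"
      by linarith
    also have "\<bar>\<alpha> * integral {0..x} (\<lambda>y. exp (\<alpha> * y) * g y)\<bar> \<le> M * exp (\<alpha> * x)"
    proof -
      have E: "((\<lambda>y. M * exp (\<alpha> * y)) has_integral (M * exp (\<alpha> * x) / \<alpha> - M * exp (\<alpha> * 0) / \<alpha>)) {0..x}"
        by (rule fundamental_theorem_of_calculus[OF x])
           (use \<alpha> in \<open>auto intro!: derivative_eq_intros simp: has_real_derivative_iff_has_vector_derivative[symmetric]\<close>)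
      have "norm (integral {0..x} (\<lambda>y. exp (\<alpha> * y) * g y)) \<le> integral {0..x} (\<lambda>y. M * exp (\<alpha> * y))"
      proof (rule integral_norm_bound_integral)
        fix y assume "y \<in> {0..x}"
        then show "norm (exp (\<alpha> * y) * g y) \<le> M * exp (\<alpha> * y)"
          using M(2)[of y] by (auto simp: abs_mult)
      qed (use E in \<open>auto intro!: integrable_continuous_real continuous_intros gc\<close>)
      also have "\<dots> \<le> M * exp (\<alpha> * x) / \<alpha>"
        using integral_unique[OF E] M(1) \<alpha> by simp
      finally show ?thesis using \<alpha> by (simp add: abs_mult field_simps)
    qed
    also have "\<bar>exp (\<alpha> * x) * g x\<bar> \<le> M * exp (\<alpha> * x)"
      using M(2)[OF x] by (auto simp: abs_mult)
    finally show "\<bar>integral {0..x} w\<bar> \<le> 2 * M * exp (\<alpha> * x)" by simp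
  qed
qed

text \<open>A growth rate strictly below \<alpha> leaves an integrable exponential as majorant. Here
  conditional convergence is traded for the absolute convergence that Fubini requires.\<close>

lemma integrable_exp_mult_exp_bounded:
  fixes g :: "real \<Rightarrow> real"
  assumes g[measurable]: "g \<in> borel_measurable borel"
    and neg: "\<And>x. x < 0 \<Longrightarrow> g x = 0"
    and bound: "\<And>x. 0 \<le> x \<Longrightarrow> \<bar>g x\<bar> \<le> M * exp (\<alpha>1 * x)" and \<alpha>: "\<alpha>1 < \<alpha>"
  shows "integrable lborel (\<lambda>x. exp (- \<alpha> * x) * g x)"
proof (rule Bochner_Integration.integrable_bound)
  have "((\<lambda>x. exp (- (\<alpha> - \<alpha>1) * x)) has_integral exp (- (\<alpha> - \<alpha>1) * 0) / (\<alpha> - \<alpha>1)) {0..}"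
    by (rule has_integral_exp_minus_to_infinity) (use \<alpha> in simp)
  then have "(\<lambda>x. exp (- (\<alpha> - \<alpha>1) * x)) absolutely_integrable_on {0..}"
    by (intro nonnegative_absolutely_integrable_1) (auto simp: integrable_on_def)
  then have "set_integrable lborel {0..} (\<lambda>x. exp (- (\<alpha> - \<alpha>1) * x))"
    unfolding set_integrable_def by (subst (asm) integrable_completion) auto
  then show "integrable lborel (\<lambda>x. M * (indicator {0..} x * exp (- (\<alpha> - \<alpha>1) * x)))"
    unfolding set_integrable_def by simp
  show "AE x in lborel. norm (exp (- \<alpha> * x) * g x) \<le> norm (M * (indicator {0..} x * exp (- (\<alpha> - \<alpha>1) * x)))"
  proof (rule AE_I2)
    fix x :: real
    show "norm (exp (- \<alpha> * x) * g x) \<le> norm (M * (indicator {0..} x * exp (- (\<alpha> - \<alpha>1) * x)))"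
    proof (cases "x < 0")
      case False
      have "exp (- \<alpha> * x) * \<bar>g x\<bar> \<le> exp (- \<alpha> * x) * (\<bar>M\<bar> * exp (\<alpha>1 * x))"
        using bound[of x] False abs_ge_self[of M]
        by (intro mult_left_mono) (auto intro: order_trans mult_right_mono)
      also have "\<dots> = \<bar>M\<bar> * exp (- (\<alpha> - \<alpha>1) * x)"
        by (simp add: exp_add[symmetric] algebra_simps)
      finally show ?thesis using False by (simp add: abs_mult)
    qed (simp add: neg)
  qed
qed measurable

text \<open>Integration by parts; growth at the smaller rate \<alpha>1 kills the boundary term at
  infinity.\<close>

lemma laplace_antiderivative:
  fixes w :: "real \<Rightarrow> real"
  assumes w: "continuous_on {0..} w" and \<alpha>: "0 < \<alpha>1" "\<alpha>1 < \<alpha>"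
    and bound: "\<And>x. 0 \<le> x \<Longrightarrow> \<bar>integral {0..x} w\<bar> \<le> M * exp (\<alpha>1 * x)"
    and I: "((\<lambda>x. exp (- \<alpha> * x) * w x) has_integral I) {0..}"
    and int: "((\<lambda>x. exp (- \<alpha> * x) * integral {0..x} w) has_integral L) {0..}"
  shows "L = I / \<alpha>"
proof -
  have lim0: "((\<lambda>R. exp (- \<alpha> * R) * integral {0..R} w) \<longlongrightarrow> 0) at_top"
  proof (rule Lim_null_comparison)
    show "\<forall>\<^sub>F R in at_top. norm (exp (- \<alpha> * R) * integral {0..R} w) \<le> M * exp (- (\<alpha> - \<alpha>1) * R)"
      using eventually_ge_at_top[of 0]
    proof eventually_elim
      case (elim R)
      have "exp (- \<alpha> * R) * \<bar>integral {0..R} w\<bar> \<le> exp (- \<alpha> * R) * (M * exp (\<alpha>1 * R))"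
        by (intro mult_left_mono bound elim) simp
      also have "\<dots> = M * exp (- (\<alpha> - \<alpha>1) * R)"
        by (simp add: exp_add[symmetric] algebra_simps)
      finally show ?case by (simp add: abs_mult)
    qed
    have "((\<lambda>R. M * exp (- (\<alpha> - \<alpha>1) * R)) \<longlongrightarrow> M * 0) at_top"
      using \<alpha> by (intro tendsto_mult_left) (auto intro!: filterlim_compose[OF exp_at_bot] filterlim_tendsto_neg_mult_at_bot[OF tendsto_const] filterlim_ident)
    then show "((\<lambda>R. M * exp (- (\<alpha> - \<alpha>1) * R)) \<longlongrightarrow> 0) at_top" by simp
  qed
  have "((\<lambda>R. (exp (- \<alpha> * R) * integral {0..R} w - integral {0..R} (\<lambda>x. exp (- \<alpha> * x) * w x)) / (- \<alpha>)) \<longlongrightarrow> (0 - I) / (- \<alpha>)) at_top"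
    by (intro tendsto_intros lim0 has_integral_atLeast_imp_tendsto[OF I]) (use \<alpha> in auto)
  moreover have "\<forall>\<^sub>F R in at_top. (exp (- \<alpha> * R) * integral {0..R} w - integral {0..R} (\<lambda>x. exp (- \<alpha> * x) * w x)) / (- \<alpha>)
        = integral {0..R} (\<lambda>x. exp (- \<alpha> * x) * integral {0..x} w)"
    using eventually_ge_at_top[of 0]
  proof eventually_elim
    case (elim R)
    show ?case
      using integral_exp_mult_antiderivative[OF w elim, of "-\<alpha>"] \<alpha> by (simp add: field_simps)
  qed
  ultimately have "((\<lambda>R. integral {0..R} (\<lambda>x. exp (- \<alpha> * x) * integral {0..x} w)) \<longlongrightarrow> (0 - I) / (- \<alpha>)) at_top"
    by (rule Lim_transform_eventually)
  from tendsto_unique[OF _ this has_integral_atLeast_imp_tendsto[OF int]] show ?thesis by simp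
qed

lemma has_integral_of_integrable_lborel:
  fixes f :: "real \<Rightarrow> real"
  assumes "integrable lborel f" "\<And>x. x < 0 \<Longrightarrow> f x = 0"
  shows "(f has_integral (\<integral>x. f x \<partial>lborel)) {0..}"
proof -
  have "(f has_integral (\<integral>x. f x \<partial>lborel)) UNIV"
    using assms(1) by (rule has_integral_integral_lborel)
  moreover have "f = (\<lambda>x. if x \<in> {0..} then f x else 0)" using assms(2) by auto
  ultimately show ?thesis by (metis has_integral_restrict_UNIV)
qed

text \<open>Fubini and translation invariance of Lebesgue measure. Nonnegative claims and 0 \<le>
  \<alpha> keep exp (- \<alpha> * c) at most 1, which gives integrability in
  \<open>c\<close>.\<close>

lemma laplace_convolution:
  fixes g :: "real \<Rightarrow> real" and D :: "real measure"
  assumes D: "prob_space D" "sets D = sets borel" "AE c in D. 0 \<le> c"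
    and g[measurable]: "g \<in> borel_measurable borel"
    and int: "integrable lborel (\<lambda>x. exp (- \<alpha> * x) * g x)" and \<alpha>: "0 \<le> \<alpha>"
  shows "integrable lborel (\<lambda>x. exp (- \<alpha> * x) * (\<integral>c. g (x - c) \<partial>D))"
    and "(\<integral>x. exp (- \<alpha> * x) * (\<integral>c. g (x - c) \<partial>D) \<partial>lborel) =
           LT D \<alpha> * (\<integral>x. exp (- \<alpha> * x) * g x \<partial>lborel)"
proof -
  interpret D: prob_space D by fact
  interpret pair_sigma_finite D lborel ..
  note [measurable_cong] = D(2)
  define h where "h = (\<lambda>x. exp (- \<alpha> * x) * g x)"
  have h[measurable]: "h \<in> borel_measurable borel" unfolding h_def by measurable
  have split: "exp (- \<alpha> * x) * g (x - c) = exp (- \<alpha> * c) * h (x - c)" for x c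
    by (simp add: h_def exp_add[symmetric] algebra_simps)
  have hint: "integrable lborel (\<lambda>x. h (x - c))" "(\<integral>x. h (x - c) \<partial>lborel) = (\<integral>x. h x \<partial>lborel)"
    "(\<integral>x. \<bar>h (x - c)\<bar> \<partial>lborel) = (\<integral>x. \<bar>h x\<bar> \<partial>lborel)" for c
    using lborel_integrable_real_affine[of h 1 "-c"] lborel_integral_real_affine[of 1 h "-c"]
      lborel_integral_real_affine[of 1 "\<lambda>x. \<bar>h x\<bar>" "-c"] int
    by (simp_all add: h_def)
  have expint: "integrable D (\<lambda>c. exp (- \<alpha> * c) * K)" for K :: real
  proof (rule D.integrable_const_bound[of _ "\<bar>K\<bar>"])
    show "AE c in D. norm (exp (- \<alpha> * c) * K) \<le> \<bar>K\<bar>"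
      using D(3) by eventually_elim (use \<alpha> in \<open>auto simp: abs_mult intro!: mult_left_le_one_le\<close>)
  qed simp
  have pair: "integrable (D \<Otimes>\<^sub>M lborel) (\<lambda>(c, x). exp (- \<alpha> * x) * g (x - c))"
  proof (rule Fubini_integrable)
    show "integrable D (\<lambda>c. \<integral>x. norm (case (c, x) of (c, x) \<Rightarrow> exp (- \<alpha> * x) * g (x - c)) \<partial>lborel)"
      unfolding prod.case real_norm_def split abs_mult abs_exp_cancel
      using expint[of 1] by (simp add: hint del: mult_minus_left)
    show "AE c in D. integrable lborel (\<lambda>x. case (c, x) of (c, x) \<Rightarrow> exp (- \<alpha> * x) * g (x - c))"
      unfolding prod.case split by (simp add: hint del: mult_minus_left)
  qed measurable
  from integrable_snd[OF pair]
  show "integrable lborel (\<lambda>x. exp (- \<alpha> * x) * (\<integral>c. g (x - c) \<partial>D))" by simp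
  have "(\<integral>x. exp (- \<alpha> * x) * (\<integral>c. g (x - c) \<partial>D) \<partial>lborel) =
      (\<integral>c. \<integral>x. exp (- \<alpha> * x) * g (x - c) \<partial>lborel \<partial>D)"
    using Fubini_integral[OF pair] by simp
  also have "\<dots> = LT D \<alpha> * (\<integral>x. h x \<partial>lborel)"
    unfolding split by (simp add: hint LT_def)
  finally show "(\<integral>x. exp (- \<alpha> * x) * (\<integral>c. g (x - c) \<partial>D) \<partial>lborel) =
           LT D \<alpha> * (\<integral>x. exp (- \<alpha> * x) * g x \<partial>lborel)"
    by (simp add: h_def)
qed

section \<open>Causal functions and variation of constants\<close>

text \<open>Vanishing below 0 encodes stopping at ruin: convolving with a claim law loses exactly
  the paths that fall below 0, and no integral has to be cut off at c = x. Continuity is not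
  demanded because survival probabilities and ruin rates may jump.\<close>

definition causal :: "(real \<Rightarrow> real) \<Rightarrow> bool" where
  "causal g \<longleftrightarrow> g \<in> borel_measurable borel \<and> (\<forall>x<0. g x = 0) \<and> (\<forall>a. \<exists>B. \<forall>x\<le>a. \<bar>g x\<bar> \<le> B)"

lemma causal_measurable[measurable_dest]: "causal g \<Longrightarrow> g \<in> borel_measurable borel"
  and causal_neg: "causal g \<Longrightarrow> x < 0 \<Longrightarrow> g x = 0"
  by (auto simp: causal_def)

lemma causal_bound:
  assumes "causal g"
  obtains B where "0 \<le> B" "\<And>x. x \<le> a \<Longrightarrow> \<bar>g x\<bar> \<le> B"
proof -
  obtain B where "\<forall>x\<le>a. \<bar>g x\<bar> \<le> B" using assms unfolding causal_def by blast
  then show ?thesis using that[of "\<bar>B\<bar>"] by (meson abs_ge_self abs_ge_zero order_trans)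
qed

lemma causal_zero: "causal (\<lambda>x. 0)"
  by (auto simp: causal_def)

lemma causal_lincomb:
  assumes "causal f" "causal g"
  shows "causal (\<lambda>x. u * f x + v * g x)"
  unfolding causal_def
proof (intro conjI allI impI)
  show "(\<lambda>x. u * f x + v * g x) \<in> borel_measurable borel"
    using assms[THEN causal_measurable] by measurable
  show "u * f x + v * g x = 0" if "x < 0" for x
    using that assms by (simp add: causal_neg)
  fix a
  obtain B where B: "\<And>x. x \<le> a \<Longrightarrow> \<bar>f x\<bar> \<le> B" using causal_bound[OF assms(1), of a] by blast
  obtain B' where "\<And>x. x \<le> a \<Longrightarrow> \<bar>g x\<bar> \<le> B'" using causal_bound[OF assms(2), of a] by blast
  with B have "\<bar>u * f x + v * g x\<bar> \<le> \<bar>u\<bar> * B + \<bar>v\<bar> * B'" if "x \<le> a" for x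
    using that by (intro order_trans[OF abs_triangle_ineq] add_mono) (auto simp: abs_mult intro!: mult_left_mono)
  then show "\<exists>B. \<forall>x\<le>a. \<bar>u * f x + v * g x\<bar> \<le> B" by blast
qed

lemma causal_cmult: "causal f \<Longrightarrow> causal (\<lambda>x. u * f x)"
  using causal_lincomb[OF _ causal_zero, of f u 0] by simp

lemma causal_sum:
  assumes "\<And>k. k \<in> A \<Longrightarrow> causal (f k)"
  shows "causal (\<lambda>x. \<Sum>k\<in>A. f k x)"
  using assms
proof (induction A rule: infinite_finite_induct)
  case (insert k A)
  then show ?case using causal_lincomb[of "f k" "\<lambda>x. \<Sum>k\<in>A. f k x" 1 1] by simp
qed (auto simp: causal_zero)

lemma causal_continuous:
  fixes g :: "real \<Rightarrow> real"
  assumes "continuous_on {0..} g"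
  shows "causal (\<lambda>x. if x < 0 then 0 else g x)"
  unfolding causal_def
proof (intro conjI allI impI)
  have "(\<lambda>x. if x \<in> {0..} then g x else 0) \<in> borel_measurable borel"
    by (rule borel_measurable_continuous_on_if) (auto intro: assms)
  moreover have "(\<lambda>x. if x \<in> {0..} then g x else 0) = (\<lambda>x. if x < 0 then 0 else g x)" by auto
  ultimately show "(\<lambda>x. if x < 0 then 0 else g x) \<in> borel_measurable borel" by simp
  fix a
  have "compact (g ` {0..a})"
    by (intro compact_continuous_image continuous_on_subset[OF assms]) auto
  then obtain K where "\<forall>x\<in>{0..a}. \<bar>g x\<bar> \<le> K"
    by (force dest!: compact_imp_bounded simp: bounded_iff)
  then have "\<forall>x\<le>a. \<bar>if x < 0 then 0 else g x\<bar> \<le> \<bar>K\<bar>"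
    by (auto intro: order_trans[OF _ abs_ge_self])
  then show "\<exists>B. \<forall>x\<le>a. \<bar>if x < 0 then 0 else g x\<bar> \<le> B" by blast
qed auto

lemma causal_set_integrable:
  assumes g: "causal g" and k: "continuous_on UNIV (k :: real \<Rightarrow> real)"
  shows "set_integrable lborel {x..y} (\<lambda>s. k s * g s)"
proof -
  obtain B where B: "0 \<le> B" "\<And>s. s \<le> y \<Longrightarrow> \<bar>g s\<bar> \<le> B" using causal_bound[OF g, of y] by blast
  have "compact (k ` {x..y})"
    by (intro compact_continuous_image continuous_on_subset[OF k]) auto
  then obtain K where K: "\<forall>s\<in>{x..y}. \<bar>k s\<bar> \<le> K"
    by (force dest!: compact_imp_bounded simp: bounded_iff)
  have [measurable]: "k \<in> borel_measurable borel" "g \<in> borel_measurable borel"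
    using k g by (auto simp: causal_def borel_measurable_continuous_onI)
  show ?thesis
    unfolding set_integrable_def
  proof (rule integrableI_bounded_set_indicator[where B="K * B"])
    show "AE s in lborel. s \<in> {x..y} \<longrightarrow> norm (k s * g s) \<le> K * B"
    proof (rule AE_I2, rule impI)
      fix s assume "s \<in> {x..y}"
      then have "\<bar>k s\<bar> \<le> K" "\<bar>g s\<bar> \<le> B" using K B by auto
      then show "norm (k s * g s) \<le> K * B"
        by (simp add: abs_mult mult_mono')
    qed
  qed (auto simp: emeasure_lborel_Icc_eq)
qed

lemma causal_integrable_on:
  assumes g: "causal g" and k: "continuous_on UNIV (k :: real \<Rightarrow> real)"
  shows "(\<lambda>s. k s * g s) integrable_on {x..y}"
  using causal_set_integrable[OF assms] by (rule set_borel_integral_eq_integral)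

lemma causal_integrable_on': "causal g \<Longrightarrow> g integrable_on {x..y}"
  using causal_integrable_on[of g "\<lambda>_. 1"] by simp

lemma antiderivative_causal_continuous:
  assumes "causal g"
  shows "continuous_on UNIV (\<lambda>x. integral {0..x} g)"
  unfolding continuous_on_eq_continuous_within
proof
  fix x :: real
  define a b where "a = min 0 x - 1" and "b = max 0 x + 1"
  \<comment> \<open>For y < 0 both sides are 0. The new base point \<open>a\<close> puts x in the
    interior of {a..b}, also when x is negative or 0.\<close>
  have "integral {0..y} g = integral {a..y} g" for y
  proof -
    have "integral {0..y} g = integral ({0..} \<inter> {a..y}) g"
      by (rule arg_cong2[where f=integral]) (auto simp: a_def)
    also have "\<dots> = integral {a..y} (\<lambda>s. if s \<in> {0..} then g s else 0)"
      by (rule integral_restrict_Int[symmetric])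
    also have "\<dots> = integral {a..y} g"
      by (rule integral_cong) (auto simp: causal_neg[OF assms])
    finally show ?thesis .
  qed
  then have "(\<lambda>x. integral {0..x} g) = (\<lambda>x. integral {a..x} g)" by auto
  moreover have "continuous_on {a..b} (\<lambda>x. integral {a..x} g)"
    by (rule indefinite_integral_continuous_1) (rule causal_integrable_on'[OF assms])
  moreover have "x \<in> interior {a..b}" by (auto simp: a_def b_def)
  ultimately show "continuous (at x within UNIV) (\<lambda>x. integral {0..x} g)"
    by (simp add: continuous_on_interior)
qed

lemma causal_antiderivative:
  assumes "causal g"
  shows "causal (\<lambda>x. integral {0..x} g)"
proof -
  have "continuous_on {0..} (\<lambda>x. integral {0..x} g)"
    using antiderivative_causal_continuous[OF assms] by (rule continuous_on_subset) auto
  from causal_continuous[OF this] show ?thesis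
    by (rule back_subst[of causal]) auto
qed

lemma integral_exp_antiderivative_swap:
  assumes u: "causal u" and x: "0 \<le> x"
  shows "integral {0..x} (\<lambda>y. b * exp (- b * y) * integral {0..y} u) =
         integral {0..x} (\<lambda>s. (exp (- b * s) - exp (- b * x)) * u s)"
proof -
  note [measurable] = u[THEN causal_measurable]
  define F where "F = (\<lambda>(s, y). indicator ({0..x} \<times> {0..x}) (s, y) *\<^sub>R (if s \<le> y then b * exp (- b * y) * u s else 0))"
  obtain B where B: "0 \<le> B" "\<And>s. s \<le> x \<Longrightarrow> \<bar>u s\<bar> \<le> B" using causal_bound[OF u, of x] by blast
  have "compact ((\<lambda>y. b * exp (- b * y)) ` {0..x})"
    by (intro compact_continuous_image continuous_intros) auto
  then obtain K where K: "\<forall>s\<in>{0..x}. \<bar>b * exp (- b * s)\<bar> \<le> K"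
    by (force dest!: compact_imp_bounded simp: bounded_iff)
  have int: "integrable (lborel \<Otimes>\<^sub>M lborel) F"
    unfolding F_def case_prod_beta prod.collapse
  proof (rule integrableI_bounded_set_indicator[where B="K * B"])
    show "emeasure (lborel \<Otimes>\<^sub>M lborel) ({0..x} \<times> {0..x}) < \<infinity>"
      by (subst lborel.emeasure_pair_measure_Times) (auto simp: emeasure_lborel_Icc_eq ennreal_mult_less_top)
    show "AE z in lborel \<Otimes>\<^sub>M lborel. z \<in> {0..x} \<times> {0..x} \<longrightarrow>
        norm (if fst z \<le> snd z then b * exp (- b * snd z) * u (fst z) else 0) \<le> K * B"
    proof (rule AE_I2, rule impI)
      fix z assume z: "z \<in> {0..x} \<times> {0..x}"
      then have "\<bar>b * exp (- b * snd z)\<bar> * \<bar>u (fst z)\<bar> \<le> K * B"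
        using B(2)[of "fst z"] K[rule_format, of "snd z"] by (intro mult_mono) (auto simp: mem_Times_iff)
      moreover have "0 \<le> K * B" using B(1) K[rule_format, of 0] x by auto
      ultimately show "norm (if fst z \<le> snd z then b * exp (- b * snd z) * u (fst z) else 0) \<le> K * B"
        by (simp add: abs_mult)
    qed
  qed measurable
  have 1: "(\<integral>s. F (s, y) \<partial>lborel) = indicator {0..x} y *\<^sub>R (b * exp (- b * y) * integral {0..y} u)" for y
  proof -
    have "(\<integral>s. F (s, y) \<partial>lborel) = (\<integral>s. (indicator {0..x} y * (b * exp (- b * y))) * (indicator {0..y} s *\<^sub>R u s) \<partial>lborel)"
      by (rule Bochner_Integration.integral_cong) (auto simp: F_def indicator_def)
    also have "\<dots> = (indicator {0..x} y * (b * exp (- b * y))) * (LBINT s:{0..y}. u s)"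
      unfolding set_lebesgue_integral_def by simp
    also have "(LBINT s:{0..y}. u s) = integral {0..y} u"
      using set_borel_integral_eq_integral(2)[OF causal_set_integrable[OF u, of "\<lambda>_. 1" 0 y]] by simp
    finally show ?thesis by simp
  qed
  have 2: "(\<integral>y. F (s, y) \<partial>lborel) = indicator {0..x} s *\<^sub>R ((exp (- b * s) - exp (- b * x)) * u s)" for s
  proof (cases "s \<in> {0..x}")
    case True
    have "((\<lambda>y. b * exp (- b * y)) has_integral (- exp (- b * x)) - (- exp (- b * s))) {s..x}"
      by (rule fundamental_theorem_of_calculus)
         (use True in \<open>auto intro!: derivative_eq_intros simp: has_real_derivative_iff_has_vector_derivative[symmetric]\<close>)
    then have "integral {s..x} (\<lambda>y. b * exp (- b * y)) = exp (- b * s) - exp (- b * x)"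
      by (subst integral_unique) simp_all
    moreover have "set_integrable lborel {s..x} (\<lambda>y. b * exp (- b * y))"
      by (rule borel_integrable_atLeastAtMost') (intro continuous_intros)
    ultimately have "(LBINT y:{s..x}. b * exp (- b * y)) = exp (- b * s) - exp (- b * x)"
      by (simp only: set_borel_integral_eq_integral(2))
    moreover have "(\<integral>y. F (s, y) \<partial>lborel) = (\<integral>y. u s * (indicator {s..x} y *\<^sub>R (b * exp (- b * y))) \<partial>lborel)"
      by (rule Bochner_Integration.integral_cong) (use True in \<open>simp_all add: F_def indicator_def split: if_split\<close>)
    ultimately show ?thesis using True
      by (simp only: set_lebesgue_integral_def Bochner_Integration.integral_mult_right_zero) simp
  next
    case False
    then have "F (s, y) = 0" for y by (auto simp: F_def indicator_def)
    then show ?thesis using False by simp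
  qed
  have "integral {0..x} (\<lambda>y. b * exp (- b * y) * integral {0..y} u) =
      (LBINT y:{0..x}. b * exp (- b * y) * integral {0..y} u)"
    by (rule set_borel_integral_eq_integral(2)[symmetric], rule causal_set_integrable[OF causal_antiderivative[OF u]])
       (intro continuous_intros)
  also have "\<dots> = (LBINT y. \<integral>s. F (s, y) \<partial>lborel)"
    by (simp only: 1 set_lebesgue_integral_def)
  also have "\<dots> = (LBINT s. \<integral>y. F (s, y) \<partial>lborel)"
    by (rule lborel_pair.Fubini_integral) (simp add: int)
  also have "\<dots> = (LBINT s:{0..x}. (exp (- b * s) - exp (- b * x)) * u s)"
    by (simp only: 2 set_lebesgue_integral_def)
  also have "\<dots> = integral {0..x} (\<lambda>s. (exp (- b * s) - exp (- b * x)) * u s)"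
    by (rule set_borel_integral_eq_integral(2), rule causal_set_integrable[OF u]) (intro continuous_intros)
  finally show ?thesis .
qed

text \<open>Formally, multiply f' = b f - m by exp (- b * s) and integrate from x to y. As
  \<open>f\<close> need not be differentiable everywhere, \<open>main\<close> carries this out from
  0 on the level of integrals; the general case is the difference of two instances, multiplied by
  exp (b * x).\<close>

lemma variation_of_constants:
  assumes f: "causal f" and m: "causal m"
    and eq: "\<And>x. 0 \<le> x \<Longrightarrow> f x = f 0 + integral {0..x} (\<lambda>s. b * f s - m s)"
    and xy: "0 \<le> x" "x \<le> y"
  shows "f x = exp (- b * (y - x)) * f y + integral {x..y} (\<lambda>s. exp (- b * (s - x)) * m s)"
proof -
  define u where "u = (\<lambda>s. b * f s + (-1) * m s)"
  have u: "causal u" unfolding u_def by (rule causal_lincomb[OF f m])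
  have E: "continuous_on UNIV (\<lambda>s. exp (- b * s))" "continuous_on UNIV (\<lambda>s. b * exp (- b * s))"
    by (intro continuous_intros)+
  have fu: "f z = f 0 + integral {0..z} u" if "0 \<le> z" for z
    using eq[OF that] by (simp add: u_def)
  have main: "exp (- b * z) * f z = f 0 - integral {0..z} (\<lambda>s. exp (- b * s) * m s)" if z: "0 \<le> z" for z
  proof -
    have i1: "integral {0..z} (\<lambda>s. b * exp (- b * s)) = 1 - exp (- b * z)"
    proof (rule integral_unique)
      have "((\<lambda>y. b * exp (- b * y)) has_integral (- exp (- b * z)) - (- exp (- b * 0))) {0..z}"
        by (rule fundamental_theorem_of_calculus)
           (use z in \<open>auto intro!: derivative_eq_intros simp: has_real_derivative_iff_has_vector_derivative[symmetric]\<close>)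
      then show "((\<lambda>y. b * exp (- b * y)) has_integral 1 - exp (- b * z)) {0..z}" by simp
    qed
    have "integral {0..z} (\<lambda>s. b * exp (- b * s) * f s) =
        integral {0..z} (\<lambda>s. f 0 * (b * exp (- b * s)) + b * exp (- b * s) * integral {0..s} u)"
      by (rule integral_cong) (subst fu, auto simp: algebra_simps)
    also have "\<dots> = integral {0..z} (\<lambda>s. f 0 * (b * exp (- b * s))) + integral {0..z} (\<lambda>s. b * exp (- b * s) * integral {0..s} u)"
      by (intro integral_add causal_integrable_on[OF causal_antiderivative[OF u] E(2)]
            integrable_continuous_real continuous_intros)
    also have "integral {0..z} (\<lambda>s. f 0 * (b * exp (- b * s))) = f 0 * (1 - exp (- b * z))"
      by (subst Henstock_Kurzweil_Integration.integral_mult_right) (simp only: i1)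
    also have "integral {0..z} (\<lambda>s. b * exp (- b * s) * integral {0..s} u) =
         integral {0..z} (\<lambda>s. exp (- b * s) * u s - exp (- b * z) * u s)"
      by (subst integral_exp_antiderivative_swap[OF u z]) (simp add: algebra_simps)
    also have "\<dots> = integral {0..z} (\<lambda>s. exp (- b * s) * u s) - exp (- b * z) * integral {0..z} u"
      by (simp only: integral_diff[OF causal_integrable_on[OF u E(1)] causal_integrable_on[OF u continuous_on_const]]
          Henstock_Kurzweil_Integration.integral_mult_right)
    also have "integral {0..z} (\<lambda>s. exp (- b * s) * u s) =
        integral {0..z} (\<lambda>s. b * exp (- b * s) * f s - exp (- b * s) * m s)"
      by (rule integral_cong) (simp add: u_def algebra_simps)
    also have "\<dots> = integral {0..z} (\<lambda>s. b * exp (- b * s) * f s) - integral {0..z} (\<lambda>s. exp (- b * s) * m s)"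
      by (rule integral_diff) (intro causal_integrable_on f m E)+
    also have "integral {0..z} u = f z - f 0" using fu[OF z] by simp
    finally show ?thesis by (simp add: algebra_simps)
  qed
  have "integral {0..x} (\<lambda>s. exp (- b * s) * m s) + integral {x..y} (\<lambda>s. exp (- b * s) * m s) =
      integral {0..y} (\<lambda>s. exp (- b * s) * m s)"
    using xy by (intro Henstock_Kurzweil_Integration.integral_combine causal_integrable_on m E)
  then have "exp (- b * x) * f x = exp (- b * y) * f y + integral {x..y} (\<lambda>s. exp (- b * s) * m s)"
    using main[of x] main[of y] xy by simp
  then have "exp (b * x) * (exp (- b * x) * f x) =
      exp (b * x) * (exp (- b * y) * f y) + exp (b * x) * integral {x..y} (\<lambda>s. exp (- b * s) * m s)"
    by (simp only: distrib_left)
  moreover have ee: "exp (b * x) * (exp (- b * s) * r) = exp (- b * (s - x)) * r" for s r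
    by (simp add: mult.assoc[symmetric] exp_add[symmetric]) (simp add: algebra_simps)
  moreover have "exp (b * x) * integral {x..y} (\<lambda>s. exp (- b * s) * m s) =
      integral {x..y} (\<lambda>s. exp (- b * (s - x)) * m s)"
    by (simp only: Henstock_Kurzweil_Integration.integral_mult_right[symmetric] ee)
  ultimately have "exp (- b * (x - x)) * f x =
      exp (- b * (y - x)) * f y + integral {x..y} (\<lambda>s. exp (- b * (s - x)) * m s)"
    by (simp only:)
  then show ?thesis by simp
qed

section \<open>The one-event equation and its minimum principle\<close>

locale claim_law = prob_space D for D :: "real measure" +
  assumes sets_D[measurable_cong]: "sets D = sets borel" and nonneg: "AE c in D. 0 \<le> c"
begin

lemma integrable_causal:
  assumes "causal g"
  shows "integrable D (\<lambda>c. g (s - c))"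
proof -
  note [measurable] = assms[THEN causal_measurable]
  obtain B where B: "\<And>x. x \<le> s \<Longrightarrow> \<bar>g x\<bar> \<le> B" using causal_bound[OF assms, of s] by blast
  show ?thesis
  proof (rule integrable_const_bound[where B=B])
    show "AE c in D. norm (g (s - c)) \<le> B" using nonneg by eventually_elim (auto intro: B)
  qed measurable
qed

lemma abs_integral_causal_le:
  assumes "causal g" "\<And>x. x \<le> s \<Longrightarrow> \<bar>g x\<bar> \<le> B"
  shows "\<bar>\<integral>c. g (s - c) \<partial>D\<bar> \<le> B"
proof -
  have "\<bar>\<integral>c. g (s - c) \<partial>D\<bar> \<le> (\<integral>c. \<bar>g (s - c)\<bar> \<partial>D)" by (rule integral_abs_bound)
  also have "\<dots> \<le> (\<integral>c. B \<partial>D)"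
  proof (rule integral_mono_AE)
    show "AE c in D. \<bar>g (s - c)\<bar> \<le> B" using nonneg by eventually_elim (auto intro: assms)
  qed (use integrable_causal[OF assms(1)] in auto)
  finally show ?thesis by (simp add: prob_space)
qed

lemma causal_convolution:
  assumes "causal g"
  shows "causal (\<lambda>s. \<integral>c. g (s - c) \<partial>D)"
  unfolding causal_def
proof (intro conjI allI impI)
  note [measurable] = assms[THEN causal_measurable]
  show "(\<lambda>s. \<integral>c. g (s - c) \<partial>D) \<in> borel_measurable borel" by measurable
  show "(\<integral>c. g (s - c) \<partial>D) = 0" if "s < 0" for s
  proof -
    have "\<bar>\<integral>c. g (s - c) \<partial>D\<bar> \<le> 0"
      by (rule abs_integral_causal_le[OF assms]) (use that causal_neg[OF assms] in auto)
    then show ?thesis by simp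
  qed
  fix a
  obtain B where B: "\<And>x. x \<le> a \<Longrightarrow> \<bar>g x\<bar> \<le> B" using causal_bound[OF assms, of a] by blast
  then have "\<forall>s\<le>a. \<bar>\<integral>c. g (s - c) \<partial>D\<bar> \<le> B"
    by (intro allI impI abs_integral_causal_le[OF assms]) auto
  then show "\<exists>B. \<forall>s\<le>a. \<bar>\<integral>c. g (s - c) \<partial>D\<bar> \<le> B" by blast
qed

text \<open>Fubini, then the shift t = s - c. Since \<open>g\<close> vanishes below 0, the shifted
  interval from - c to x - c may be started at 0.\<close>

lemma convolution_antiderivative:
  assumes g: "causal g" and x: "0 \<le> x"
  shows "(\<integral>c. integral {0..x - c} g \<partial>D) = integral {0..x} (\<lambda>s. \<integral>c. g (s - c) \<partial>D)"
proof -
  interpret pair_sigma_finite D lborel ..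
  note [measurable] = g[THEN causal_measurable]
  define F where "F = (\<lambda>(c, s). indicator {0..x} s * g (s - c))"
  have F[measurable]: "F \<in> borel_measurable (D \<Otimes>\<^sub>M lborel)" unfolding F_def by measurable
  have int: "integrable lborel (\<lambda>s. F (c, s))" for c
  proof -
    obtain B where B: "\<And>y. y \<le> x - c \<Longrightarrow> \<bar>g y\<bar> \<le> B" using causal_bound[OF g, of "x - c"] by blast
    have "integrable lborel (\<lambda>s. indicator {0..x} s *\<^sub>R g (s - c))"
      by (rule integrableI_bounded_set_indicator[where B=B]) (auto intro!: B simp: emeasure_lborel_Icc_eq)
    then show ?thesis by (simp add: F_def)
  qed
  have shift: "(\<integral>s. F (c, s) \<partial>lborel) = integral {0..x - c} g" if "0 \<le> c" for c
  proof -
    have "(\<integral>s. F (c, s) \<partial>lborel) = (\<integral>t. F (c, t + c) \<partial>lborel)"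
      using lborel_integral_real_affine[of 1 "\<lambda>s. F (c, s)" c] by (simp add: add.commute)
    also have "\<dots> = (\<integral>t. indicator {0..x - c} t *\<^sub>R g t \<partial>lborel)"
      by (rule Bochner_Integration.integral_cong)
         (use that causal_neg[OF g] in \<open>auto simp: F_def indicator_def not_le\<close>)
    also have "\<dots> = integral {0..x - c} g"
      using set_borel_integral_eq_integral(2)[OF causal_set_integrable[OF g, of "\<lambda>_. 1" 0 "x - c"]]
      by (simp add: set_lebesgue_integral_def)
    finally show ?thesis .
  qed
  have pair: "integrable (D \<Otimes>\<^sub>M lborel) F"
  proof (rule Fubini_integrable[OF F])
    obtain B where B: "0 \<le> B" "\<And>y. y \<le> x \<Longrightarrow> \<bar>g y\<bar> \<le> B" using causal_bound[OF g, of x] by blast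
    show "integrable D (\<lambda>c. \<integral>s. norm (F (c, s)) \<partial>lborel)"
    proof (rule integrable_const_bound[where B="B * x"])
      show "AE c in D. norm (\<integral>s. norm (F (c, s)) \<partial>lborel) \<le> B * x"
        using nonneg
      proof eventually_elim
        case (elim c)
        have "(\<integral>s. norm (F (c, s)) \<partial>lborel) \<le> (\<integral>s. B * indicator {0..x} s \<partial>lborel)"
        proof (rule integral_mono)
          show "integrable lborel (\<lambda>s. norm (F (c, s)))" using int by (rule integrable_norm)
          show "integrable lborel (\<lambda>s. B * indicator {0..x} s)"
            by (auto simp: emeasure_lborel_Icc_eq)
          show "norm (F (c, s)) \<le> B * indicator {0..x} s" for s
            using B(2)[of "s - c"] B(1) elim by (auto simp: F_def indicator_def)
        qed
        then show ?case using x by (simp add: mult.commute)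
      qed
    qed measurable
  qed (simp add: int)
  have "(\<integral>c. integral {0..x - c} g \<partial>D) = (\<integral>c. (\<integral>s. F (c, s) \<partial>lborel) \<partial>D)"
  proof (rule integral_cong_AE)
    show "AE c in D. integral {0..x - c} g = (\<integral>s. F (c, s) \<partial>lborel)"
      using nonneg by eventually_elim (simp add: shift)
    show "(\<lambda>c. integral {0..x - c} g) \<in> borel_measurable D"
      by (rule measurable_compose[OF _ causal_measurable[OF causal_antiderivative[OF g]], of "\<lambda>c. x - c"]) measurable
  qed measurable
  also have "\<dots> = (\<integral>s. (\<integral>c. F (c, s) \<partial>D) \<partial>lborel)"
    by (rule Fubini_integral[symmetric]) (simp add: pair)
  also have "\<dots> = (LBINT s:{0..x}. \<integral>c. g (s - c) \<partial>D)"
    by (simp add: F_def set_lebesgue_integral_def)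
  also have "\<dots> = integral {0..x} (\<lambda>s. \<integral>c. g (s - c) \<partial>D)"
    using set_borel_integral_eq_integral(2)[OF causal_set_integrable[OF causal_convolution[OF g], of "\<lambda>_. 1" 0 x]]
    by simp
  finally show ?thesis .
qed

end

section \<open>The model and the operator of one event\<close>

locale risk_model =
  fixes p lam :: "'n::finite \<Rightarrow> real"
    and Q :: "real^'n^'n"
    and FC :: "'n \<Rightarrow> real measure"
    and FCJ :: "'n \<Rightarrow> 'n \<Rightarrow> real measure"
  assumes Q_offdiag: "i \<noteq> j \<Longrightarrow> 0 \<le> Q$i$j"
    and Q_rows: "(\<Sum>j\<in>UNIV. Q$i$j) = 0"
    and p_pos: "0 < p i"
    and lam_nonneg: "0 \<le> lam i"
    and FC_law: "claim_law (FC i)"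
    and FCJ_law: "i \<noteq> j \<Longrightarrow> claim_law (FCJ i j)"
begin

text \<open>Claim arrivals in state \<open>i\<close> are treated as transitions from \<open>i\<close> to itself.\<close>

definition rate :: "'n \<Rightarrow> 'n \<Rightarrow> real" where
  "rate i k = (if i = k then lam i else Q$i$k)"

definition law :: "'n \<Rightarrow> 'n \<Rightarrow> real measure" where
  "law i k = (if i = k then FC i else FCJ i k)"

definition eta :: "'n \<Rightarrow> real" where
  "eta i = (\<Sum>k\<in>UNIV. rate i k)"

text \<open>The jump part of the generator of the process killed at ruin: for causal
  \<open>f\<close> a claim exceeding \<open>s\<close> contributes 0.\<close>

definition conv :: "('n \<Rightarrow> real \<Rightarrow> real) \<Rightarrow> 'n \<Rightarrow> real \<Rightarrow> real" where
  "conv f i s = (\<Sum>k\<in>UNIV. rate i k * (\<integral>c. f k (s - c) \<partial>law i k))"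

lemma rate_nonneg: "0 \<le> rate i k"
  by (simp add: rate_def lam_nonneg Q_offdiag)

lemma eta_nonneg: "0 \<le> eta i"
  by (simp add: eta_def rate_nonneg sum_nonneg)

lemma law: "claim_law (law i k)"
  by (simp add: law_def FC_law FCJ_law)

lemma eta_eq: "eta i = lam i - Q$i$i"
proof -
  have "eta i = lam i + (\<Sum>k\<in>UNIV - {i}. Q$i$k)"
    unfolding eta_def by (subst sum.remove[of _ i]) (auto simp: rate_def intro!: sum.cong)
  moreover have "0 = Q$i$i + (\<Sum>k\<in>UNIV - {i}. Q$i$k)"
    using Q_rows[of i] by (subst (asm) sum.remove[of _ i]) auto
  ultimately show ?thesis by simp
qed

lemma causal_conv: "(\<And>k. causal (f k)) \<Longrightarrow> causal (conv f i)"
  unfolding conv_def[abs_def]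
  by (intro causal_sum causal_cmult claim_law.causal_convolution law)

lemma conv_lincomb:
  assumes "\<And>k. causal (f k)" "\<And>k. causal (g k)"
  shows "conv (\<lambda>k x. u * f k x + v * g k x) i s = u * conv f i s + v * conv g i s"
  unfolding conv_def
  by (simp add: sum_distrib_left sum.distrib[symmetric] algebra_simps
      claim_law.integrable_causal[OF law assms(1)] claim_law.integrable_causal[OF law assms(2)])

lemma conv_mono:
  assumes f: "\<And>k. causal (f k)" and g: "\<And>k. causal (g k)"
    and le: "\<And>k x. 0 \<le> x \<Longrightarrow> x \<le> s \<Longrightarrow> f k x \<le> g k x"
  shows "conv f i s \<le> conv g i s"
  unfolding conv_def
proof (intro sum_mono mult_left_mono rate_nonneg)
  fix k
  interpret claim_law "law i k" by (rule law)
  show "(\<integral>c. f k (s - c) \<partial>law i k) \<le> (\<integral>c. g k (s - c) \<partial>law i k)"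
  proof (rule integral_mono_AE)
    show "AE c in law i k. f k (s - c) \<le> g k (s - c)"
      using nonneg
    proof eventually_elim
      case (elim c)
      then show ?case using le[of "s - c" k] causal_neg[OF f] causal_neg[OF g] by (cases "c \<le> s") auto
    qed
  qed (rule integrable_causal f g)+
qed

text \<open>The sign of \<open>m\<close> matters: claims that cause ruin contribute 0, which is at
  least \<open>m\<close> only for m \<le> 0. The total mass of all transitions is
  \<open>eta i\<close>.\<close>

lemma conv_ge:
  assumes f: "\<And>k. causal (f k)" and m: "m \<le> 0"
    and le: "\<And>k x. 0 \<le> x \<Longrightarrow> x \<le> s \<Longrightarrow> m \<le> f k x"
  shows "eta i * m \<le> conv f i s"
  unfolding conv_def eta_def sum_distrib_right
proof (intro sum_mono mult_left_mono rate_nonneg)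
  fix k
  interpret claim_law "law i k" by (rule law)
  have "(\<integral>c. m \<partial>law i k) \<le> (\<integral>c. f k (s - c) \<partial>law i k)"
  proof (rule integral_mono_AE)
    show "AE c in law i k. m \<le> f k (s - c)"
      using nonneg
    proof eventually_elim
      case (elim c)
      then show ?case using le[of "s - c" k] causal_neg[OF f] m by (cases "c \<le> s") auto
    qed
  qed (auto intro: integrable_causal f)
  then show "m \<le> (\<integral>c. f k (s - c) \<partial>law i k)" by (simp add: prob_space)
qed

text \<open>\<open>sol f \<beta>\<close> is the mild form of \<open>p f' = \<eta> f - conv f - \<beta>\<close>: condition on the first of
  ``an event occurs'' and ``the surplus has drifted from \<open>x\<close> up to \<open>y\<close>''; \<open>\<beta>\<close> is a source
  charged at ruin.\<close>

definition sol :: "('n \<Rightarrow> real \<Rightarrow> real) \<Rightarrow> ('n \<Rightarrow> real \<Rightarrow> real) \<Rightarrow> bool" where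
  "sol f \<beta> \<longleftrightarrow> (\<forall>k. causal (f k)) \<and> (\<forall>k. causal (\<beta> k)) \<and>
     (\<forall>i x y. 0 \<le> x \<longrightarrow> x \<le> y \<longrightarrow>
        f i x = exp (- (eta i / p i) * (y - x)) * f i y +
                integral {x..y} (\<lambda>s. exp (- (eta i / p i) * (s - x)) * ((conv f i s + \<beta> i s) / p i)))"

lemma solD:
  assumes "sol f \<beta>"
  shows sol_causal: "causal (f k)" and sol_causal_source: "causal (\<beta> k)"
    and sol_eq: "0 \<le> x \<Longrightarrow> x \<le> y \<Longrightarrow> f i x = exp (- (eta i / p i) * (y - x)) * f i y +
                integral {x..y} (\<lambda>s. exp (- (eta i / p i) * (s - x)) * ((conv f i s + \<beta> i s) / p i))"
  using assms unfolding sol_def by blast+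

lemma causal_drift: "(\<And>k. causal (f k)) \<Longrightarrow> (\<And>k. causal (\<beta> k)) \<Longrightarrow> causal (\<lambda>s. (conv f i s + \<beta> i s) / p i)"
  using causal_lincomb[OF causal_conv[of f i], of "\<beta> i" "1 / p i" "1 / p i"]
  by (simp add: add_divide_distrib)

lemma drift_integrable:
  assumes "\<And>k. causal (f k)" "\<And>k. causal (\<beta> k)"
  shows "(\<lambda>s. exp (- (eta i / p i) * (s - x)) * ((conv f i s + \<beta> i s) / p i)) integrable_on {x..y}"
  by (rule causal_integrable_on[OF causal_drift[OF assms]]) (intro continuous_intros)

text \<open>Division by \<open>p i\<close> brings the equation into the form required by
  \<open>variation_of_constants\<close>, with b = eta i / p i, the event rate per unit of surplus
  instead of time.\<close>

lemma volterra_imp_sol: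
  assumes f: "\<And>k. causal (f k)" and \<beta>: "\<And>k. causal (\<beta> k)"
    and eq: "\<And>i x. 0 \<le> x \<Longrightarrow>
      p i * f i x = p i * f i 0 + integral {0..x} (\<lambda>s. eta i * f i s - conv f i s - \<beta> i s)"
  shows "sol f \<beta>"
  unfolding sol_def
proof (intro conjI allI impI f \<beta>)
  fix i x y assume xy: "(0::real) \<le> x" "x \<le> y"
  show "f i x = exp (- (eta i / p i) * (y - x)) * f i y +
          integral {x..y} (\<lambda>s. exp (- (eta i / p i) * (s - x)) * ((conv f i s + \<beta> i s) / p i))"
  proof (rule variation_of_constants[OF f causal_drift[OF f \<beta>] _ xy])
    fix x :: real assume "0 \<le> x"
    have "integral {0..x} (\<lambda>s. eta i / p i * f i s - (conv f i s + \<beta> i s) / p i) =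
        integral {0..x} (\<lambda>s. (1 / p i) * (eta i * f i s - conv f i s - \<beta> i s))"
      by (rule integral_cong) (use p_pos[of i] in \<open>simp add: field_simps\<close>)
    also have "\<dots> = (p i * f i x - p i * f i 0) / p i"
      by (subst Henstock_Kurzweil_Integration.integral_mult_right) (simp add: eq[OF \<open>0 \<le> x\<close>, of i])
    finally show "f i x = f i 0 + integral {0..x} (\<lambda>s. eta i / p i * f i s - (conv f i s + \<beta> i s) / p i)"
      using p_pos[of i] by (simp add: field_simps)
  qed
qed

lemma sol_zero: "sol (\<lambda>k x. 0) (\<lambda>k x. 0)"
  by (simp add: sol_def causal_zero conv_def)

lemma sol_lincomb:
  assumes f: "sol f \<beta>" and g: "sol g \<gamma>"
  shows "sol (\<lambda>k x. u * f k x + v * g k x) (\<lambda>k x. u * \<beta> k x + v * \<gamma> k x)"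
  unfolding sol_def
proof (intro conjI allI impI causal_lincomb sol_causal[OF f] sol_causal[OF g] sol_causal_source[OF f] sol_causal_source[OF g])
  fix i x y assume xy: "(0::real) \<le> x" "x \<le> y"
  let ?e = "\<lambda>s. exp (- (eta i / p i) * (s - x))"
  note c = sol_causal[OF f] sol_causal[OF g] sol_causal_source[OF f] sol_causal_source[OF g]
  have "integral {x..y} (\<lambda>s. ?e s * ((conv (\<lambda>k x. u * f k x + v * g k x) i s + (u * \<beta> i s + v * \<gamma> i s)) / p i)) =
      integral {x..y} (\<lambda>s. u * (?e s * ((conv f i s + \<beta> i s) / p i)) + v * (?e s * ((conv g i s + \<gamma> i s) / p i)))"
    by (rule integral_cong) (simp add: conv_lincomb[OF c(1) c(2)] add_divide_distrib algebra_simps)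
  also have "\<dots> = integral {x..y} (\<lambda>s. u * (?e s * ((conv f i s + \<beta> i s) / p i))) +
       integral {x..y} (\<lambda>s. v * (?e s * ((conv g i s + \<gamma> i s) / p i)))"
    by (intro integral_add integrable_on_mult_right drift_integrable c)
  also have "\<dots> = u * integral {x..y} (\<lambda>s. ?e s * ((conv f i s + \<beta> i s) / p i)) +
       v * integral {x..y} (\<lambda>s. ?e s * ((conv g i s + \<gamma> i s) / p i))"
    by (simp only: Henstock_Kurzweil_Integration.integral_mult_right)
  finally show "u * f i x + v * g i x = ?e y * (u * f i y + v * g i y) +
      integral {x..y} (\<lambda>s. ?e s * ((conv (\<lambda>k x. u * f k x + v * g k x) i s + (u * \<beta> i s + v * \<gamma> i s)) / p i))"
    using sol_eq[OF f xy, of i] sol_eq[OF g xy, of i] by (simp add: algebra_simps)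
qed

lemma sol_sum:
  assumes "\<And>j. j \<in> A \<Longrightarrow> sol (f j) (\<beta> j)"
  shows "sol (\<lambda>k x. \<Sum>j\<in>A. f j k x * v j) (\<lambda>k x. \<Sum>j\<in>A. \<beta> j k x * v j)"
  using assms
proof (induction A rule: infinite_finite_induct)
  case (insert j A)
  then show ?case
    using sol_lincomb[of "f j" "\<beta> j" "\<lambda>k x. \<Sum>j\<in>A. f j k x * v j" "\<lambda>k x. \<Sum>j\<in>A. \<beta> j k x * v j" "v j" 1]
    by (simp add: mult.commute)
qed (auto simp: sol_zero)

lemma integral_exp_drift:
  assumes "x \<le> y"
  shows "integral {x..y} (\<lambda>s. exp (- (eta i / p i) * (s - x)) * (eta i / p i * m)) =
      m * (1 - exp (- (eta i / p i) * (y - x)))"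
proof (rule integral_unique)
  have "((\<lambda>s. exp (- (eta i / p i) * (s - x)) * (eta i / p i * m)) has_integral
      (- m * exp (- (eta i / p i) * (y - x))) - (- m * exp (- (eta i / p i) * (x - x)))) {x..y}"
    by (rule fundamental_theorem_of_calculus[OF assms])
       (use p_pos[of i] in \<open>auto intro!: derivative_eq_intros simp: has_real_derivative_iff_has_vector_derivative[symmetric]\<close>)
  then show "((\<lambda>s. exp (- (eta i / p i) * (s - x)) * (eta i / p i * m)) has_integral
      m * (1 - exp (- (eta i / p i) * (y - x)))) {x..y}"
    by (simp add: algebra_simps)
qed

text \<open>The worst case is that every event leads to the value \<open>m\<close>. The factor next
  to \<open>m\<close> is the probability of an event before the surplus has drifted from
  \<open>x\<close> to \<open>y\<close>.\<close>

lemma integral_drift_ge: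
  assumes f: "\<And>k. causal (f k)" and \<beta>: "\<And>k. causal (\<beta> k)" and m: "m \<le> 0"
    and le: "\<And>k z. 0 \<le> z \<Longrightarrow> z \<le> y \<Longrightarrow> m \<le> f k z" and \<beta>0: "\<And>k z. 0 \<le> \<beta> k z"
    and xy: "x \<le> y"
  shows "m * (1 - exp (- (eta i / p i) * (y - x))) \<le>
     integral {x..y} (\<lambda>s. exp (- (eta i / p i) * (s - x)) * ((conv f i s + \<beta> i s) / p i))"
  unfolding integral_exp_drift[OF xy, symmetric]
proof (rule integral_le)
  fix s assume s: "s \<in> {x..y}"
  have "eta i * m \<le> conv f i s"
    by (rule conv_ge[OF f m]) (use le s in auto)
  then have "eta i * m \<le> conv f i s + \<beta> i s" using \<beta>0[of i s] by linarith
  then have "eta i / p i * m \<le> (conv f i s + \<beta> i s) / p i"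
    using p_pos[of i] by (simp add: divide_right_mono)
  then show "exp (- (eta i / p i) * (s - x)) * (eta i / p i * m) \<le>
      exp (- (eta i / p i) * (s - x)) * ((conv f i s + \<beta> i s) / p i)"
    by (intro mult_left_mono) auto
qed (intro drift_integrable f \<beta> integrable_continuous_real continuous_intros)+

text \<open>Bounds from below, uniformly in the state, the probability of drifting up by
  \<open>a\<close> without an event. It is positive because there are finitely many states.\<close>

definition survive_bound :: "real \<Rightarrow> real" where
  "survive_bound a = Min (range (\<lambda>i. exp (- (eta i / p i) * a)))"

lemma survive_bound: "0 < survive_bound a" "survive_bound a \<le> exp (- (eta i / p i) * a)"
  by (auto simp: survive_bound_def)

lemma survive_bound_le:
  assumes "x \<ge> 0" "x \<le> a"
  shows "survive_bound a \<le> exp (- (eta i / p i) * (a - x))"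
proof -
  have "(eta i / p i) * (a - x) \<le> (eta i / p i) * a"
    using assms eta_nonneg[of i] p_pos[of i] by (intro mult_left_mono) auto
  then show ?thesis using survive_bound(2)[of a i] by (simp add: order_trans)
qed

text \<open>Suppose the infimum \<open>m\<close> over all states and levels in [0, a] is negative.
  Following the path up to level \<open>a\<close> charges \<open>m\<close> with at most the
  probability of an event, so every value is at least m * (1 - survive_bound a), which exceeds
  \<open>m\<close>. The infimum need not be attained.\<close>

lemma minimum_principle:
  assumes f: "sol f \<beta>" and \<beta>: "\<And>k z. 0 \<le> \<beta> k z" and end_nonneg: "\<And>k. 0 \<le> f k a"
    and x: "0 \<le> x" "x \<le> a"
  shows "0 \<le> f i x"
proof (rule ccontr)
  assume neg: "\<not> 0 \<le> f i x"
  define S where "S = (\<lambda>(k, z). f k z) ` (UNIV \<times> {0..a})"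
  define m where "m = Inf S"
  have "bdd_below S"
  proof -
    have "\<exists>B. \<forall>z\<le>a. \<bar>f k z\<bar> \<le> B" for k
      using sol_causal[OF f, of k] unfolding causal_def by blast
    then have "\<exists>B. \<forall>k. \<forall>z\<le>a. \<bar>f k z\<bar> \<le> B k" by (intro choice allI)
    then obtain B where B: "\<And>k z. z \<le> a \<Longrightarrow> \<bar>f k z\<bar> \<le> B k" by blast
    have "- (\<Sum>k\<in>UNIV. \<bar>B k\<bar>) \<le> f k z" if "z \<le> a" for k z
    proof -
      have "\<bar>B k\<bar> \<le> (\<Sum>k\<in>UNIV. \<bar>B k\<bar>)" by (rule member_le_sum) auto
      then show ?thesis using B[OF that, of k] by linarith
    qed
    then show ?thesis by (intro bdd_belowI[of _ "- (\<Sum>k\<in>UNIV. \<bar>B k\<bar>)"]) (auto simp: S_def)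
  qed
  then have m_le: "m \<le> f k z" if "0 \<le> z" "z \<le> a" for k z
    unfolding m_def using that by (intro cInf_lower) (auto simp: S_def)
  have m0: "m < 0" using m_le[of x i] x neg by simp
  have step: "m * (1 - survive_bound a) \<le> f k z" if z: "0 \<le> z" "z \<le> a" for k z
  proof -
    have "m * (1 - exp (- (eta k / p k) * (a - z))) \<le>
        integral {z..a} (\<lambda>s. exp (- (eta k / p k) * (s - z)) * ((conv f k s + \<beta> k s) / p k))"
      by (rule integral_drift_ge[OF sol_causal[OF f] sol_causal_source[OF f]]) (use m0 m_le \<beta> z in auto)
    then have "m * (1 - exp (- (eta k / p k) * (a - z))) \<le> f k z"
      using sol_eq[OF f z, of k] mult_nonneg_nonneg[OF exp_ge_zero end_nonneg, of "- (eta k / p k) * (a - z)" k]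
      by linarith
    moreover have "m * (1 - survive_bound a) \<le> m * (1 - exp (- (eta k / p k) * (a - z)))"
      using m0 survive_bound_le[OF z, of k] by (intro mult_left_mono_neg) auto
    ultimately show ?thesis by linarith
  qed
  have "m * (1 - survive_bound a) \<le> m"
  proof -
    have "m * (1 - survive_bound a) \<le> Inf S"
      by (rule cInf_greatest) (use step x in \<open>auto simp: S_def\<close>)
    then show ?thesis by (simp only: m_def)
  qed
  then have "0 \<le> m * survive_bound a" by (simp add: algebra_simps)
  then show False using m0 survive_bound(1)[of a] by (simp add: zero_le_mult_iff)
qed

end

section \<open>The scale matrix\<close>

lemma antimono_bounded_tendsto_at_top:
  fixes f :: "real \<Rightarrow> real"
  assumes anti: "\<And>x y. a \<le> x \<Longrightarrow> x \<le> y \<Longrightarrow> f y \<le> f x" and bound: "\<And>x. a \<le> x \<Longrightarrow> B \<le> f x"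
  shows "(f \<longlongrightarrow> Inf (f ` {a..})) at_top"
proof (rule decreasing_tendsto)
  have bdd: "bdd_below (f ` {a..})" using bound by (auto intro!: bdd_belowI)
  show "\<forall>\<^sub>F x in at_top. Inf (f ` {a..}) \<le> f x"
    using eventually_ge_at_top[of a] by eventually_elim (intro cInf_lower bdd, simp)
  fix c assume "Inf (f ` {a..}) < c"
  then obtain x where "a \<le> x" "f x < c"
    using bdd by (subst (asm) cInf_less_iff) auto
  then show "\<forall>\<^sub>F x in at_top. f x < c"
    using anti by (intro eventually_at_top_linorderI[of x]) (meson order_le_less_trans)
qed

lemma matrix_inv_cancel:
  fixes A :: "real^'n::finite^'n"
  assumes "invertible A"
  shows "A ** matrix_inv A = mat 1" "matrix_inv A ** A = mat 1"
  using someI_ex[OF assms[unfolded invertible_def]] by (auto simp: matrix_inv_def)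

lemma matrix_sub_ldistrib:
  fixes A B D :: "real^'n::finite^'n"
  shows "A ** (B - D) = A ** B - A ** D"
  by (simp add: matrix_matrix_mult_def vec_eq_iff right_diff_distrib sum_subtractf)

locale scale_matrix = risk_model p lam Q FC FCJ
  for p lam :: "'n::finite \<Rightarrow> real"
    and Q :: "real^'n^'n"
    and FC :: "'n \<Rightarrow> real measure"
    and FCJ :: "'n \<Rightarrow> 'n \<Rightarrow> real measure" +
  fixes W :: "real \<Rightarrow> real^'n^'n"
  assumes W_scale: "is_scale_W p lam Q FC FCJ W"
begin

text \<open>Entries are extended by 0 below 0 to become causal. For fixed \<open>j\<close> the
  family over \<open>k\<close> is a column of \<open>W\<close>, the kind of object on which
  \<open>conv\<close> and \<open>sol\<close> act.\<close>

definition w :: "'n \<Rightarrow> 'n \<Rightarrow> real \<Rightarrow> real" where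
  "w k j x = (if x < 0 then 0 else W x $ k $ j)"

definition G :: "'n \<Rightarrow> 'n \<Rightarrow> real \<Rightarrow> real" where
  "G k j x = integral {0..x} (w k j)"

lemma W_continuous: "continuous_on {0..} (\<lambda>x. W x $ k $ j)"
  using W_scale unfolding is_scale_W_def by (auto intro!: continuous_on_component)

lemma w_continuous: "continuous_on {0..} (w k j)"
  using W_continuous[of k j] by (rule continuous_on_eq) (simp add: w_def)

lemma causal_w: "causal (w k j)"
  unfolding w_def[abs_def] by (rule causal_continuous[OF W_continuous])

lemma causal_G: "causal (G k j)"
  unfolding G_def[abs_def] by (rule causal_antiderivative[OF causal_w])

lemma conv_G:
  assumes "0 \<le> x"
  shows "conv (\<lambda>k. G k j) i x = integral {0..x} (conv (\<lambda>k. w k j) i)"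
proof -
  have "conv (\<lambda>k. G k j) i x = (\<Sum>k\<in>UNIV. rate i k * integral {0..x} (\<lambda>s. \<integral>c. w k j (s - c) \<partial>law i k))"
    unfolding conv_def G_def by (simp add: claim_law.convolution_antiderivative[OF law causal_w assms])
  also have "\<dots> = integral {0..x} (conv (\<lambda>k. w k j) i)"
    unfolding conv_def[abs_def]
    by (subst integral_sum)
       (auto intro!: causal_integrable_on' causal_cmult claim_law.causal_convolution law causal_w)
  finally show ?thesis .
qed

lemma laplace_w:
  assumes "((\<lambda>x. exp (- \<alpha> * x) *\<^sub>R W x) has_integral M) {0..}"
  shows "((\<lambda>x. exp (- \<alpha> * x) * w k j x) has_integral M $ k $ j) {0..}"
proof -
  have "bounded_linear (\<lambda>A :: real^'n^'n. A $ k $ j)"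
    by (intro bounded_linear_compose[OF bounded_linear_vec_nth bounded_linear_vec_nth])
  from has_integral_linear[OF assms this]
  have "((\<lambda>x. exp (- \<alpha> * x) * W x $ k $ j) has_integral M $ k $ j) {0..}"
    by (simp add: o_def)
  then show ?thesis
    by (rule has_integral_eq[rotated]) (simp add: w_def)
qed

text \<open>The residual \<open>r\<close> is continuous, and its transform is entry (i, j) of F ** M
  = mat 1 divided by \<alpha>, hence 0; uniqueness of Laplace transforms finishes. The convolution
  is applied to \<open>G\<close>, whose transform converges absolutely.\<close>

lemma renewal_equation:
  assumes x: "0 \<le> x"
  shows "p i * w i j x = (if i = j then 1 else 0) + eta i * G i j x - conv (\<lambda>k. G k j) i x"
proof -
  obtain \<alpha>0 where inv: "\<And>\<alpha>. \<alpha> > \<alpha>0 \<Longrightarrow> invertible (Fmat p lam Q FC FCJ \<alpha>)"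
    and lapW: "\<And>\<alpha>. \<alpha> > \<alpha>0 \<Longrightarrow> ((\<lambda>x. exp (- \<alpha> * x) *\<^sub>R W x) has_integral matrix_inv (Fmat p lam Q FC FCJ \<alpha>)) {0..}"
    using W_scale unfolding is_scale_W_def by blast
  \<comment> \<open>A positive point inside the domain of the transform. The growth of
    \<open>G\<close> is controlled there, and the comparison uses only \<alpha> > \<alpha>1, so a
    gap remains for absolute convergence.\<close>
  define \<alpha>1 where "\<alpha>1 = max \<alpha>0 0 + 1"
  have \<alpha>1: "\<alpha>0 < \<alpha>1" "0 < \<alpha>1" by (auto simp: \<alpha>1_def)
  define \<delta> :: real where "\<delta> = (if i = j then 1 else 0)"
  define r where "r = (\<lambda>x. p i * w i j x - \<delta> - eta i * G i j x + conv (\<lambda>k. G k j) i x)"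
  have "r x = 0"
  proof (rule laplace_transform_unique[OF _ _ x])
    have "continuous_on {0..} (\<lambda>x. integral {0..x} (conv (\<lambda>k. w k j) i))"
      using antiderivative_causal_continuous[OF causal_conv[of "\<lambda>k. w k j" i], OF causal_w]
      by (rule continuous_on_subset) auto
    then have "continuous_on {0..} (conv (\<lambda>k. G k j) i)"
      by (rule continuous_on_eq) (simp add: conv_G)
    moreover have "continuous_on {0..} (G i j)"
      unfolding G_def[abs_def] by (rule antiderivative_continuous[OF w_continuous])
    ultimately show "continuous_on {0..} r"
      unfolding r_def by (intro continuous_intros w_continuous)
  next
    fix \<alpha> assume \<alpha>: "\<alpha>1 < \<alpha>"
    define F M where "F = Fmat p lam Q FC FCJ \<alpha>" and "M = matrix_inv F"
    have FM: "F ** M = mat 1" using inv[of \<alpha>] \<alpha> \<alpha>1 by (simp add: F_def M_def matrix_inv_cancel)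
    have lw: "((\<lambda>x. exp (- \<alpha> * x) * w k j x) has_integral M $ k $ j) {0..}" for k
      unfolding M_def F_def by (rule laplace_w[OF lapW]) (use \<alpha> \<alpha>1 in simp)
    have G: "integrable lborel (\<lambda>x. exp (- \<alpha> * x) * G k j x)"
        "(\<integral>x. exp (- \<alpha> * x) * G k j x \<partial>lborel) = M $ k $ j / \<alpha>" for k
    proof -
      obtain B where B: "\<And>x. 0 \<le> x \<Longrightarrow> \<bar>G k j x\<bar> \<le> B * exp (\<alpha>1 * x)"
        using antiderivative_exp_bound[OF w_continuous \<alpha>1(2) laplace_w[OF lapW[OF \<alpha>1(1)]], of k j]
        unfolding G_def by blast
      show int: "integrable lborel (\<lambda>x. exp (- \<alpha> * x) * G k j x)"
        by (rule integrable_exp_mult_exp_bounded[OF causal_measurable[OF causal_G] causal_neg[OF causal_G] B \<alpha>])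
      have h: "((\<lambda>x. exp (- \<alpha> * x) * G k j x) has_integral (\<integral>x. exp (- \<alpha> * x) * G k j x \<partial>lborel)) {0..}"
        by (rule has_integral_of_integrable_lborel[OF int]) (simp add: causal_neg[OF causal_G])
      show "(\<integral>x. exp (- \<alpha> * x) * G k j x \<partial>lborel) = M $ k $ j / \<alpha>"
        by (rule laplace_antiderivative[OF w_continuous \<alpha>1(2) \<alpha> B[unfolded G_def] lw h[unfolded G_def], folded G_def])
    qed
    have lG: "((\<lambda>x. exp (- \<alpha> * x) * G k j x) has_integral M $ k $ j / \<alpha>) {0..}" for k
      using has_integral_of_integrable_lborel[OF G(1)[of k]] unfolding G(2)
      by (simp add: causal_neg[OF causal_G])
    have lconv: "((\<lambda>x. exp (- \<alpha> * x) * conv (\<lambda>k. G k j) i x) has_integral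
        (\<Sum>k\<in>UNIV. rate i k * (LT (law i k) \<alpha> * (M $ k $ j / \<alpha>)))) {0..}"
    proof -
      have "((\<lambda>x. exp (- \<alpha> * x) * (\<integral>c. G k j (x - c) \<partial>law i k)) has_integral LT (law i k) \<alpha> * (M $ k $ j / \<alpha>)) {0..}" for k
      proof -
        interpret claim_law "law i k" by (rule law)
        note lc = laplace_convolution[OF prob_space_axioms sets_D nonneg causal_measurable[OF causal_G] G(1)]
        have "0 \<le> \<alpha>" using \<alpha> \<alpha>1 by simp
        have "((\<lambda>x. exp (- \<alpha> * x) * (\<integral>c. G k j (x - c) \<partial>law i k)) has_integral
            (\<integral>x. exp (- \<alpha> * x) * (\<integral>c. G k j (x - c) \<partial>law i k) \<partial>lborel)) {0..}"
          by (rule has_integral_of_integrable_lborel[OF lc(1)[OF \<open>0 \<le> \<alpha>\<close>]])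
             (simp add: causal_neg[OF causal_convolution[OF causal_G]])
        then show ?thesis by (simp only: lc(2)[OF \<open>0 \<le> \<alpha>\<close>] G(2))
      qed
      then have "((\<lambda>x. \<Sum>k\<in>UNIV. rate i k * (exp (- \<alpha> * x) * (\<integral>c. G k j (x - c) \<partial>law i k))) has_integral
          (\<Sum>k\<in>UNIV. rate i k * (LT (law i k) \<alpha> * (M $ k $ j / \<alpha>)))) {0..}"
        by (intro has_integral_sum has_integral_mult_right) auto
      then show ?thesis
        by (simp add: conv_def sum_distrib_left mult_ac)
    qed
    have l1: "((\<lambda>x. exp (- \<alpha> * x)) has_integral 1 / \<alpha>) {0..}"
      using has_integral_exp_minus_to_infinity[of \<alpha> 0] \<alpha> \<alpha>1 by simp
    have "((\<lambda>x. p i * (exp (- \<alpha> * x) * w i j x) - \<delta> * exp (- \<alpha> * x) - eta i * (exp (- \<alpha> * x) * G i j x)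
          + exp (- \<alpha> * x) * conv (\<lambda>k. G k j) i x) has_integral
        (p i * M $ i $ j - \<delta> * (1 / \<alpha>) - eta i * (M $ i $ j / \<alpha>) +
         (\<Sum>k\<in>UNIV. rate i k * (LT (law i k) \<alpha> * (M $ k $ j / \<alpha>))))) {0..}"
      by (intro has_integral_add has_integral_diff has_integral_mult_right lw l1 lG lconv)
    moreover have "p i * M $ i $ j - \<delta> * (1 / \<alpha>) - eta i * (M $ i $ j / \<alpha>) +
         (\<Sum>k\<in>UNIV. rate i k * (LT (law i k) \<alpha> * (M $ k $ j / \<alpha>))) = 0"
    proof -
      \<comment> \<open>By \<open>eta_eq\<close> the diagonal terms lam i and Q_ii combine to - eta
        i, and the Laplace transforms of the claims appear with weights \<open>rate\<close>, as in
        \<open>conv\<close>.\<close>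
      have F: "F $ i $ k = (if i = k then p i * \<alpha> - eta i else 0) + rate i k * LT (law i k) \<alpha>" for k
        by (simp add: F_def Fmat_def eta_eq rate_def law_def algebra_simps)
      have "\<delta> = (\<Sum>k\<in>UNIV. F $ i $ k * M $ k $ j)"
        using arg_cong[OF FM, of "\<lambda>A. A $ i $ j"] by (simp add: matrix_matrix_mult_def mat_def \<delta>_def)
      also have "\<dots> = (\<Sum>k\<in>UNIV. (if i = k then (p i * \<alpha> - eta i) * M $ i $ j else 0) + rate i k * LT (law i k) \<alpha> * M $ k $ j)"
        by (rule sum.cong) (auto simp: F algebra_simps)
      also have "\<dots> = (p i * \<alpha> - eta i) * M $ i $ j + (\<Sum>k\<in>UNIV. rate i k * LT (law i k) \<alpha> * M $ k $ j)"
        by (simp add: sum.distrib)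
      finally have "\<delta> = (p i * \<alpha> - eta i) * M $ i $ j + (\<Sum>k\<in>UNIV. rate i k * LT (law i k) \<alpha> * M $ k $ j)" .
      moreover have "(\<Sum>k\<in>UNIV. rate i k * (LT (law i k) \<alpha> * (M $ k $ j / \<alpha>))) =
          (\<Sum>k\<in>UNIV. rate i k * LT (law i k) \<alpha> * M $ k $ j) / \<alpha>"
        by (simp add: sum_divide_distrib mult_ac)
      ultimately show ?thesis using \<alpha> \<alpha>1 by (simp only:) (simp add: add_divide_distrib diff_divide_distrib left_diff_distrib)
    qed
    ultimately show "((\<lambda>x. exp (- \<alpha> * x) * r x) has_integral 0) {0..}"
      by (simp add: r_def algebra_simps)
  qed
  then show ?thesis by (simp add: r_def \<delta>_def)
qed

lemma G_0: "G k j 0 = 0"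
  by (simp add: G_def)

text \<open>Both integral terms of the renewal equation vanish at 0. Since \<open>W 0\<close> is
  thus diagonal with entries 1 / p i > 0, inequalities at level 0 can be read off entrywise.\<close>

lemma w_0: "w i j 0 = (if i = j then 1 / p i else 0)"
proof -
  have "conv (\<lambda>k. G k j) i 0 = 0" by (simp add: conv_G)
  then show ?thesis
    using renewal_equation[of 0 i j] p_pos[of i] by (auto simp: G_0 field_simps)
qed

lemma sol_w: "sol (\<lambda>k. w k j) (\<lambda>k x. 0)"
proof (rule volterra_imp_sol[OF causal_w causal_zero])
  fix i and x :: real assume x: "0 \<le> x"
  have "integral {0..x} (\<lambda>s. eta i * w i j s - conv (\<lambda>k. w k j) i s - 0) =
      integral {0..x} (\<lambda>s. eta i * w i j s) - integral {0..x} (conv (\<lambda>k. w k j) i)"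
    by (simp only: diff_0_right) (intro integral_diff causal_integrable_on' causal_cmult causal_conv causal_w)
  also have "integral {0..x} (\<lambda>s. eta i * w i j s) = eta i * G i j x"
    by (simp only: Henstock_Kurzweil_Integration.integral_mult_right G_def)
  finally show "p i * w i j x = p i * w i j 0 + integral {0..x} (\<lambda>s. eta i * w i j s - conv (\<lambda>k. w k j) i s - 0)"
    using renewal_equation[OF x, of i j] p_pos[of i] by (auto simp: conv_G[OF x] w_0)
qed

lemma Zmat_eq:
  "0 \<le> x \<Longrightarrow> Zmat W Q x $ k $ j = (if k = j then 1 else 0) - (\<Sum>l\<in>UNIV. G k l x * Q $ l $ j)"
proof -
  assume x: "0 \<le> x"
  have "W integrable_on {0..x}"
    using W_scale unfolding is_scale_W_def
    by (intro integrable_continuous_real) (auto elim: continuous_on_subset)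
  then have I: "(W has_integral integral {0..x} W) {0..x}" by (rule integrable_integral)
  have "integral {0..x} W $ k $ l = G k l x" for l
  proof -
    have "bounded_linear (\<lambda>A :: real^'n^'n. A $ k $ l)"
      by (intro bounded_linear_compose[OF bounded_linear_vec_nth bounded_linear_vec_nth])
    from has_integral_linear[OF I this]
    have "((\<lambda>s. W s $ k $ l) has_integral integral {0..x} W $ k $ l) {0..x}" by (simp add: o_def)
    then have "(w k l has_integral integral {0..x} W $ k $ l) {0..x}"
      by (rule has_integral_eq[rotated]) (simp add: w_def)
    then show ?thesis by (simp add: G_def integral_unique)
  qed
  then show ?thesis by (simp add: Zmat_def matrix_matrix_mult_def mat_def)
qed

section \<open>The matrix \<open>Zmat\<close> as a solution with a source\<close>

definition z :: "'n \<Rightarrow> 'n \<Rightarrow> real \<Rightarrow> real" where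
  "z k j x = (if x < 0 then 0 else Zmat W Q x $ k $ j)"

text \<open>The rate of transitions from \<open>i\<close> to \<open>j\<close> whose claim causes
  ruin at surplus \<open>x\<close>. The set is open at \<open>x\<close> because a surplus of exactly
  0 is not ruin.\<close>

definition ruin_source :: "'n \<Rightarrow> 'n \<Rightarrow> real \<Rightarrow> real" where
  "ruin_source i j x = (if x < 0 then 0 else rate i j * measure (law i j) {x<..})"

lemma ruin_source_nonneg: "0 \<le> ruin_source i j x"
  by (simp add: ruin_source_def rate_nonneg)

lemma conv_sum:
  assumes "\<And>l k. l \<in> A \<Longrightarrow> causal (f l k)"
  shows "conv (\<lambda>k x. \<Sum>l\<in>A. f l k x * v l) i s = (\<Sum>l\<in>A. conv (f l) i s * v l)"
  using assms
proof (induction A rule: infinite_finite_induct)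
  case (insert l A)
  have "causal (\<lambda>x. \<Sum>l\<in>A. f l k x * v l)" for k
    using insert by (intro causal_sum) (auto simp: mult.commute intro!: causal_cmult)
  with insert show ?case
    using conv_lincomb[of "f l" "\<lambda>k x. \<Sum>l\<in>A. f l k x * v l" "v l" 1 i s]
    by (simp add: mult.commute)
qed (auto simp: conv_def)

definition unit_step :: "'n \<Rightarrow> 'n \<Rightarrow> real \<Rightarrow> real" where
  "unit_step j k x = (if k = j \<and> 0 \<le> x then 1 else 0)"

lemma causal_unit_step: "causal (unit_step j k)"
proof -
  have "causal (\<lambda>x. if x < 0 then 0 else (if k = j then 1 else 0))"
    by (rule causal_continuous) (intro continuous_intros)
  then show ?thesis by (rule back_subst[of causal]) (auto simp: unit_step_def)
qed

text \<open>A transition to \<open>j\<close> keeps the value 1 only if its claim is at most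
  \<open>x\<close>; the lost mass is the ruin source. This is where the source for
  \<open>Zmat\<close> originates.\<close>

lemma conv_unit_step:
  assumes "0 \<le> x"
  shows "conv (unit_step j) i x = rate i j - ruin_source i j x"
proof -
  have "(\<integral>c. unit_step j k (x - c) \<partial>law i k) = (if k = j then measure (law i j) {..x} else 0)" for k
  proof -
    interpret claim_law "law i k" by (rule law)
    have "(\<integral>c. unit_step j k (x - c) \<partial>law i k) = (\<integral>c. (if k = j then 1 else 0) * indicator {..x} c \<partial>law i k)"
      by (rule Bochner_Integration.integral_cong) (auto simp: unit_step_def indicator_def)
    then show ?thesis by simp
  qed
  then have "conv (unit_step j) i x = rate i j * measure (law i j) {..x}"
    by (simp add: conv_def if_distrib[of "\<lambda>t. _ * t"] cong: if_cong)
  moreover have "measure (law i j) {x<..} = 1 - measure (law i j) {..x}"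
  proof -
    interpret claim_law "law i j" by (rule law)
    have "space (law i j) - {..x} = {x<..}"
      using sets_eq_imp_space_eq[OF sets_D] by auto
    then show ?thesis using prob_compl[of "{..x}"] by simp
  qed
  ultimately show ?thesis using assms by (simp add: ruin_source_def right_diff_distrib)
qed

lemma causal_ruin_source: "causal (ruin_source i j)"
proof -
  have "causal (\<lambda>x. rate i j * unit_step j j x + (-1) * conv (unit_step j) i x)"
    by (intro causal_lincomb causal_unit_step causal_conv)
  then show ?thesis
    by (rule back_subst[of causal])
       (auto simp: fun_eq_iff conv_unit_step unit_step_def ruin_source_def causal_neg[OF causal_conv[OF causal_unit_step]])
qed

lemma z_eq: "z k j = (\<lambda>x. 1 * unit_step j k x + (-1) * (\<Sum>l\<in>UNIV. G k l x * Q $ l $ j))"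
  by (auto simp: fun_eq_iff z_def Zmat_eq unit_step_def causal_neg[OF causal_G])

lemma causal_GQ: "causal (\<lambda>x. \<Sum>l\<in>UNIV. G k l x * Q $ l $ j)"
  by (intro causal_sum) (auto simp: mult.commute intro!: causal_cmult causal_G)

lemma causal_z: "causal (z k j)"
  unfolding z_eq by (intro causal_lincomb causal_unit_step causal_GQ)

text \<open>The matrix of \<open>rate\<close> is Q plus the diagonal of \<open>eta\<close>, so in
  the integrand everything cancels except - p i times row i of W ** Q, by the renewal equation. Its
  integral is p i times the increment of - G Q, that is, of \<open>z\<close>.\<close>

lemma sol_z: "sol (\<lambda>k. z k j) (\<lambda>i. ruin_source i j)"
proof (rule volterra_imp_sol[OF causal_z causal_ruin_source])
  fix i and x :: real assume x: "0 \<le> x"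
  have "integral {0..x} (\<lambda>s. eta i * z i j s - conv (\<lambda>k. z k j) i s - ruin_source i j s) =
      integral {0..x} (\<lambda>s. \<Sum>l\<in>UNIV. - (p i * Q $ l $ j) * w i l s)"
  proof (rule integral_cong)
    fix s assume "s \<in> {0..x}"
    then have s: "0 \<le> s" by simp
    have 1: "conv (\<lambda>k. z k j) i s = rate i j - ruin_source i j s - (\<Sum>l\<in>UNIV. conv (\<lambda>k. G k l) i s * Q $ l $ j)"
      unfolding z_eq conv_lincomb[OF causal_unit_step causal_GQ] conv_sum[OF causal_G] conv_unit_step[OF s] by simp
    have 2: "z i j s = (if i = j then 1 else 0) - (\<Sum>l\<in>UNIV. G i l s * Q $ l $ j)"
      using s by (simp add: z_eq unit_step_def)
    have "(\<Sum>l\<in>UNIV. - (p i * Q $ l $ j) * w i l s) =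
        (\<Sum>l\<in>UNIV. (if i = l then - Q $ l $ j else 0) - eta i * (G i l s * Q $ l $ j) + conv (\<lambda>k. G k l) i s * Q $ l $ j)"
    proof (rule sum.cong)
      fix l
      have "- (p i * Q $ l $ j) * w i l s = - Q $ l $ j * (p i * w i l s)" by simp
      also have "\<dots> = (if i = l then - Q $ l $ j else 0) - eta i * (G i l s * Q $ l $ j) + conv (\<lambda>k. G k l) i s * Q $ l $ j"
        by (simp only: renewal_equation[OF s]) (simp add: algebra_simps)
      finally show "- (p i * Q $ l $ j) * w i l s = (if i = l then - Q $ l $ j else 0) - eta i * (G i l s * Q $ l $ j) + conv (\<lambda>k. G k l) i s * Q $ l $ j" .
    qed simp
    also have "\<dots> = - Q $ i $ j - eta i * (\<Sum>l\<in>UNIV. G i l s * Q $ l $ j) + (\<Sum>l\<in>UNIV. conv (\<lambda>k. G k l) i s * Q $ l $ j)"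
      by (simp add: sum.distrib sum_subtractf sum_distrib_left)
    finally have 3: "(\<Sum>l\<in>UNIV. - (p i * Q $ l $ j) * w i l s) = - Q $ i $ j - eta i * (\<Sum>l\<in>UNIV. G i l s * Q $ l $ j) + (\<Sum>l\<in>UNIV. conv (\<lambda>k. G k l) i s * Q $ l $ j)" .
    have 4: "rate i j = Q $ i $ j + (if i = j then eta i else 0)"
      by (simp add: rate_def eta_eq)
    show "eta i * z i j s - conv (\<lambda>k. z k j) i s - ruin_source i j s = (\<Sum>l\<in>UNIV. - (p i * Q $ l $ j) * w i l s)"
      unfolding 1 2 3 4 by (simp add: right_diff_distrib)
  qed
  also have "\<dots> = (\<Sum>l\<in>UNIV. integral {0..x} (\<lambda>s. - (p i * Q $ l $ j) * w i l s))"
    by (intro integral_sum causal_integrable_on' causal_cmult causal_w) simp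
  also have "\<dots> = (\<Sum>l\<in>UNIV. - (p i * Q $ l $ j) * G i l x)"
    by (simp only: Henstock_Kurzweil_Integration.integral_mult_right G_def)
  also have "\<dots> = p i * z i j x - p i * z i j 0"
    using x by (simp add: z_eq unit_step_def G_0 sum_distrib_left mult_ac sum_negf algebra_simps)
  finally show "p i * z i j x = p i * z i j 0 + integral {0..x} (\<lambda>s. eta i * z i j s - conv (\<lambda>k. z k j) i s - ruin_source i j s)"
    by simp
qed

lemma sol_w_vec: "sol (\<lambda>k x. \<Sum>l\<in>UNIV. w k l x * v l) (\<lambda>k x. 0)"
  using sol_sum[of UNIV "\<lambda>l k. w k l" "\<lambda>l k x. 0" v] by (simp add: sol_w)

text \<open>If W a *v v = 0, the minimum principle applies to the solution W x *v v and to its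
  negative, so both are nonnegative at 0. There the solution equals v $ k / p k, whence v =
  0.\<close>

lemma invertible_W:
  assumes a: "0 \<le> a"
  shows "invertible (W a)"
proof -
  have "v = 0" if v: "W a *v v = 0" for v
  proof -
    let ?f = "\<lambda>k x. \<Sum>l\<in>UNIV. w k l x * v $ l"
    have fa: "?f k a = 0" for k
      using v a by (simp add: w_def matrix_vector_mult_def vec_eq_iff)
    have "0 \<le> ?f k 0" for k
      by (rule minimum_principle[OF sol_w_vec, of a]) (use fa a in auto)
    moreover have "0 \<le> (\<lambda>k x. (-1) * ?f k x + 0 * ?f k x) k 0" for k
      by (rule minimum_principle[OF sol_lincomb[OF sol_w_vec[of "\<lambda>l. v $ l"] sol_w_vec[of "\<lambda>l. v $ l"], of "-1" 0], of a])
         (use fa a in auto)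
    ultimately have "?f k 0 = 0" for k by (simp add: order_antisym)
    moreover have "?f k 0 = v $ k / p k" for k
      by (simp add: w_0 if_distrib[of "\<lambda>t. t * _"] cong: if_cong)
    ultimately show "v = 0"
      using p_pos by (simp add: vec_eq_iff) (metis less_irrefl)
  qed
  then show ?thesis
    unfolding invertible_left_inverse matrix_left_invertible_ker by blast
qed

section \<open>Exit and ruin matrices, and the limit of \<open>C\<close>\<close>

abbreviation V :: "real \<Rightarrow> real^'n^'n" where "V a \<equiv> matrix_inv (W a)"

abbreviation C :: "real \<Rightarrow> real^'n^'n" where "C a \<equiv> V a ** Zmat W Q a"

lemma W_V: "0 \<le> a \<Longrightarrow> W a ** V a = mat 1"
  and V_W: "0 \<le> a \<Longrightarrow> V a ** W a = mat 1"
  using invertible_W by (auto simp: matrix_inv_cancel)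

lemma W_mult: "0 \<le> x \<Longrightarrow> (W x ** M) $ i $ j = (\<Sum>l\<in>UNIV. w i l x * M $ l $ j)"
  by (simp add: w_def matrix_matrix_mult_def)

lemma W_0: "(W 0 ** M) $ i $ j = M $ i $ j / p i"
  by (simp add: W_mult w_0 if_distrib[of "\<lambda>t. t * _"] cong: if_cong)

text \<open>Probabilistically, the entry is the chance of reaching level \<open>a\<close> before
  ruin and in state \<open>j\<close>. The columns solve the equation without source, and their
  boundary value at \<open>a\<close> is the identity.\<close>

lemma exit_matrix_nonneg:
  assumes "0 \<le> x" "x \<le> a"
  shows "0 \<le> (W x ** V a) $ i $ j"
proof -
  have a: "0 \<le> a" using assms by simp
  have "0 \<le> (\<lambda>k x. \<Sum>l\<in>UNIV. w k l x * V a $ l $ j) i x"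
  proof (rule minimum_principle[OF sol_w_vec _ _ assms])
    show "0 \<le> (\<Sum>l\<in>UNIV. w k l a * V a $ l $ j)" for k
      unfolding W_mult[OF a, symmetric] W_V[OF a] by (simp add: mat_def)
  qed simp
  then show ?thesis using assms by (simp add: W_mult)
qed

text \<open>Probabilistically, the chance of ruin before level \<open>a\<close> with the chain in
  state \<open>j\<close> at ruin. The boundary value at \<open>a\<close> is 0, and the source is the
  rate of ruin.\<close>

lemma ruin_matrix_nonneg:
  assumes "0 \<le> x" "x \<le> a"
  shows "0 \<le> Zmat W Q x $ i $ j - (W x ** C a) $ i $ j"
proof -
  have a: "0 \<le> a" using assms by simp
  have "0 \<le> (\<lambda>k x. 1 * z k j x + (-1) * (\<Sum>l\<in>UNIV. w k l x * C a $ l $ j)) i x"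
  proof (rule minimum_principle[OF sol_lincomb[OF sol_z sol_w_vec] _ _ assms])
    show "0 \<le> 1 * z k j a + (-1) * (\<Sum>l\<in>UNIV. w k l a * C a $ l $ j)" for k
      using W_mult[OF a, of "C a" k j] a by (simp add: z_def matrix_mul_assoc W_V)
  qed (simp add: ruin_source_nonneg)
  then show ?thesis using assms by (simp add: W_mult z_def)
qed

text \<open>The product W 0 ** V a ** ?D describes paths from 0 that reach \<open>a\<close> first
  and are then ruined before \<open>b\<close>; both factors are nonnegative. It equals W 0 ** (C a -
  C b), and \<open>W 0\<close> is diagonal and positive.\<close>

lemma C_antimono:
  assumes "0 \<le> a" "a \<le> b"
  shows "C b $ i $ j \<le> C a $ i $ j"
proof -
  have b: "0 \<le> b" using assms by simp
  let ?D = "Zmat W Q a - W a ** C b"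
  have "W 0 ** V a ** ?D = W 0 ** (C a - C b)"
  proof -
    have "V a ** ?D = C a - V a ** W a ** C b"
      by (simp only: matrix_sub_ldistrib matrix_mul_assoc)
    also have "\<dots> = C a - C b" by (simp add: V_W assms(1))
    finally show ?thesis by (simp only: matrix_mul_assoc[symmetric])
  qed
  moreover have "0 \<le> (W 0 ** V a ** ?D) $ i $ j"
    unfolding matrix_matrix_mult_def[of "W 0 ** V a"]
    using exit_matrix_nonneg[of 0 a] ruin_matrix_nonneg[OF assms] assms(1)
    by (auto intro!: sum_nonneg mult_nonneg_nonneg)
  ultimately show ?thesis using p_pos[of i] by (simp add: W_0 zero_le_divide_iff)
qed

lemma Zmat_ones:
  assumes "0 \<le> x"
  shows "(\<Sum>j\<in>UNIV. Zmat W Q x $ i $ j) = 1"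
proof -
  have "(\<Sum>j\<in>UNIV. \<Sum>l\<in>UNIV. G i l x * Q $ l $ j) = (\<Sum>l\<in>UNIV. G i l x * (\<Sum>j\<in>UNIV. Q $ l $ j))"
    by (subst sum.swap) (simp add: sum_distrib_left)
  then show ?thesis using assms by (simp add: Zmat_eq sum_subtractf Q_rows)
qed

text \<open>\<open>Zmat\<close> maps the vector of ones to itself because the rows of
  \<open>Q\<close> sum to 0. This ties the limit of \<open>C\<close> to the exit
  probabilities.\<close>

lemma C_ones:
  assumes "0 \<le> a"
  shows "(\<Sum>j\<in>UNIV. C a $ i $ j) = (\<Sum>j\<in>UNIV. V a $ i $ j)"
proof -
  have "(\<Sum>j\<in>UNIV. C a $ i $ j) = (\<Sum>k\<in>UNIV. V a $ i $ k * (\<Sum>j\<in>UNIV. Zmat W Q a $ k $ j))"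
    unfolding matrix_matrix_mult_def by (simp add: sum_distrib_left) (subst sum.swap, simp)
  then show ?thesis by (simp add: Zmat_ones assms)
qed

lemma C_le:
  assumes "0 \<le> a"
  shows "C a $ i $ j \<le> (if i = j then p i else 0)"
proof -
  have "0 \<le> (if i = j then 1 else 0) - C a $ i $ j / p i"
    using ruin_matrix_nonneg[of 0 a i j] assms by (simp add: W_0 Zmat_eq G_0)
  then show ?thesis using p_pos[of i] by (auto simp: field_simps split: if_splits)
qed

text \<open>The row sum is nonnegative, being a multiple of an exit probability from level 0, while
  the other entries of row \<open>i\<close> add up to at most \<open>p i\<close> by
  \<open>C_le\<close>.\<close>

lemma C_ge:
  assumes a: "0 \<le> a"
  shows "- p i \<le> C a $ i $ j"
proof -
  have "0 \<le> (\<Sum>k\<in>UNIV. (W 0 ** V a) $ i $ k)"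
    using exit_matrix_nonneg[of 0 a] a by (intro sum_nonneg) auto
  then have "0 \<le> (\<Sum>k\<in>UNIV. V a $ i $ k) / p i" by (simp only: W_0 sum_divide_distrib)
  then have "0 \<le> (\<Sum>k\<in>UNIV. C a $ i $ k)"
    using p_pos[of i] by (simp add: C_ones a zero_le_divide_iff)
  also have "\<dots> = C a $ i $ j + (\<Sum>k\<in>UNIV - {j}. C a $ i $ k)" by (subst sum.remove[of _ j]) auto
  also have "(\<Sum>k\<in>UNIV - {j}. C a $ i $ k) \<le> (\<Sum>k\<in>UNIV - {j}. if i = k then p i else 0)"
    by (intro sum_mono C_le a)
  also have "\<dots> \<le> p i" using p_pos[of i] by (simp add: sum.delta' p_pos less_imp_le)
  finally show ?thesis by simp
qed

definition C_infinity :: "real^'n^'n" where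
  "C_infinity = (\<chi> i j. Inf ((\<lambda>a. C a $ i $ j) ` {0..}))"

lemma C_tendsto: "(C \<longlongrightarrow> C_infinity) at_top"
proof (intro vec_tendstoI)
  fix i j
  show "((\<lambda>a. C a $ i $ j) \<longlongrightarrow> C_infinity $ i $ j) at_top"
    unfolding C_infinity_def
    by (simp, rule antimono_bounded_tendsto_at_top[where B="- p i"]) (auto intro: C_antimono C_ge)
qed

text \<open>The probability of reaching level \<open>a\<close> before ruin.\<close>

definition exit_prob :: "real \<Rightarrow> 'n \<Rightarrow> real \<Rightarrow> real" where
  "exit_prob a k x = (\<Sum>l\<in>UNIV. w k l x * (\<Sum>j\<in>UNIV. V a $ l $ j))"

lemma sol_exit_prob: "sol (exit_prob a) (\<lambda>k x. 0)"
  unfolding exit_prob_def[abs_def] by (rule sol_w_vec)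

lemma exit_prob_eq: "0 \<le> x \<Longrightarrow> exit_prob a k x = (\<Sum>j\<in>UNIV. (W x ** V a) $ k $ j)"
  by (simp add: exit_prob_def W_mult sum_distrib_left) (rule sum.swap)

lemma exit_prob_end: "0 \<le> a \<Longrightarrow> exit_prob a k a = 1"
  by (simp add: exit_prob_eq W_V mat_def)

lemma exit_prob_nonneg: "0 \<le> x \<Longrightarrow> x \<le> a \<Longrightarrow> 0 \<le> exit_prob a k x"
  by (simp add: exit_prob_eq sum_nonneg exit_matrix_nonneg)

text \<open>The row sums of the ruin matrix are 1 minus the exit probability, by
  \<open>Zmat_ones\<close> and \<open>C_ones\<close>.\<close>

lemma exit_prob_le_1:
  assumes "0 \<le> x" "x \<le> a"
  shows "exit_prob a k x \<le> 1"
proof -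
  have "0 \<le> (\<Sum>j\<in>UNIV. Zmat W Q x $ k $ j - (W x ** C a) $ k $ j)"
    by (intro sum_nonneg ruin_matrix_nonneg assms)
  also have "\<dots> = 1 - (\<Sum>l\<in>UNIV. w k l x * (\<Sum>j\<in>UNIV. C a $ l $ j))"
    using assms by (simp add: sum_subtractf Zmat_ones W_mult sum_distrib_left) (rule sum.swap)
  finally show ?thesis using assms by (simp add: C_ones exit_prob_def)
qed

text \<open>The claimed survival probability, extended by 0 below 0; it arises as the limit of
  \<open>exit_prob a\<close> when the upper barrier \<open>a\<close> is removed.\<close>

definition psi :: "'n \<Rightarrow> real \<Rightarrow> real" where
  "psi k x = (\<Sum>l\<in>UNIV. w k l x * (\<Sum>j\<in>UNIV. C_infinity $ l $ j))"

lemma sol_psi: "sol psi (\<lambda>k x. 0)"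
  unfolding psi_def[abs_def] by (rule sol_w_vec)

lemma psi_eq: "0 \<le> x \<Longrightarrow> psi k x = ((W x ** C_infinity) *v (\<chi> k. 1)) $ k"
  by (simp add: psi_def matrix_vector_mult_def W_mult sum_distrib_left) (rule sum.swap)

lemma exit_prob_tendsto: "((\<lambda>a. exit_prob a k x) \<longlongrightarrow> psi k x) at_top"
proof -
  have "((\<lambda>a. \<Sum>l\<in>UNIV. w k l x * (\<Sum>j\<in>UNIV. C a $ l $ j)) \<longlongrightarrow> psi k x) at_top"
    unfolding psi_def by (intro tendsto_intros C_tendsto)
  moreover have "\<forall>\<^sub>F a in at_top. (\<Sum>l\<in>UNIV. w k l x * (\<Sum>j\<in>UNIV. C a $ l $ j)) = exit_prob a k x"
    using eventually_ge_at_top[of 0] by eventually_elim (simp add: C_ones exit_prob_def)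
  ultimately show ?thesis by (rule Lim_transform_eventually)
qed

lemma psi_le_1: "0 \<le> x \<Longrightarrow> psi k x \<le> 1"
  by (rule tendsto_upperbound[OF exit_prob_tendsto])
     (auto intro: eventually_mono[OF eventually_ge_at_top[of x]] exit_prob_le_1)

text \<open>\<open>\<phi> N i x\<close> stands for the probability of surviving the first \<open>N\<close> events. Survival and
  \<open>psi\<close> agree because both are the largest fixed point bounded by \<open>1\<close> of the one-event operator.\<close>

lemma survival_limit:
  assumes causal: "\<And>N k. causal (\<phi> N k)"
    and \<phi>0: "\<And>k x. 0 \<le> x \<Longrightarrow> \<phi> 0 k x = 1"
    and absorbing: "\<And>N i x. eta i = 0 \<Longrightarrow> 0 \<le> x \<Longrightarrow> \<phi> (Suc N) i x = 1"
    and upper: "\<And>N i x y. 0 \<le> x \<Longrightarrow> x \<le> y \<Longrightarrow> \<phi> (Suc N) i x \<le> exp (- (eta i / p i) * (y - x)) +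
        integral {x..y} (\<lambda>s. exp (- (eta i / p i) * (s - x)) * ((conv (\<phi> N) i s + 0) / p i))"
    and lower: "\<And>N i x y. 0 \<le> x \<Longrightarrow> x \<le> y \<Longrightarrow>
        integral {x..y} (\<lambda>s. exp (- (eta i / p i) * (s - x)) * ((conv (\<phi> N) i s + 0) / p i)) \<le> \<phi> (Suc N) i x"
    and lim: "(\<lambda>N. \<phi> N i x) \<longlonglongrightarrow> l" and x: "0 \<le> x"
  shows "l = psi i x"
proof (rule antisym)
  have "psi i x \<le> \<phi> N i x" if "0 \<le> x" for N i x
    using that
  proof (induction N arbitrary: i x)
    case 0
    then show ?case by (simp add: \<phi>0 psi_le_1)
  next
    case (Suc N)
    show ?case
    proof (cases "eta i = 0")
      \<comment> \<open>In a state without events the boundary term used below would not decay, but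
        survival is certain there.\<close>
      case True
      then show ?thesis using Suc.prems by (simp add: absorbing psi_le_1)
    next
      case False
      then have b: "0 < eta i / p i" using eta_nonneg[of i] p_pos[of i] by simp
      let ?e = "\<lambda>y. exp (- (eta i / p i) * (y - x))"
      \<comment> \<open>Compare up to an arbitrary level \<open>y\<close>; the boundary term is at
        most exp (- (eta i / p i) * (y - x)) because \<open>psi\<close> \<le> 1, and it vanishes as
        \<open>y\<close> grows.\<close>
      have le: "psi i x \<le> ?e y + \<phi> (Suc N) i x" if "x \<le> y" for y
      proof -
        have "integral {x..y} (\<lambda>s. ?e s * ((conv psi i s + 0) / p i)) \<le>
            integral {x..y} (\<lambda>s. ?e s * ((conv (\<phi> N) i s + 0) / p i))"
        proof (rule integral_le)
          fix s assume "s \<in> {x..y}"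
          have "conv psi i s \<le> conv (\<phi> N) i s"
            by (rule conv_mono[OF sol_causal[OF sol_psi] causal]) (rule Suc.IH)
          then show "?e s * ((conv psi i s + 0) / p i) \<le> ?e s * ((conv (\<phi> N) i s + 0) / p i)"
            using p_pos[of i] by (intro mult_left_mono divide_right_mono) auto
        qed (intro drift_integrable sol_causal[OF sol_psi] causal causal_zero)+
        also have "\<dots> \<le> \<phi> (Suc N) i x" by (rule lower[OF Suc.prems that])
        finally have "psi i x \<le> ?e y * psi i y + \<phi> (Suc N) i x"
          using sol_eq[OF sol_psi Suc.prems that, of i] by linarith
        also have "?e y * psi i y \<le> ?e y * 1"
          using psi_le_1[of y i] Suc.prems that by (intro mult_left_mono) auto
        finally show ?thesis by simp
      qed
      have "((\<lambda>y. exp (- (eta i / p i) * (y - x)) + \<phi> (Suc N) i x) \<longlongrightarrow> 0 + \<phi> (Suc N) i x) at_top"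
        using b by (intro tendsto_intros filterlim_compose[OF exp_at_bot]
            filterlim_tendsto_neg_mult_at_bot[OF tendsto_const]) (auto intro!: filterlim_at_top_mono[OF filterlim_tendsto_add_at_top[OF tendsto_const[of "-x"] filterlim_ident]])
      moreover have "\<forall>\<^sub>F y in at_top. psi i x \<le> exp (- (eta i / p i) * (y - x)) + \<phi> (Suc N) i x"
        using eventually_ge_at_top[of x] by eventually_elim (rule le)
      ultimately have "psi i x \<le> 0 + \<phi> (Suc N) i x"
        by (rule tendsto_lowerbound) simp
      then show ?thesis by simp
    qed
  qed
  then show "psi i x \<le> l" using lim x by (intro LIMSEQ_le_const) auto
  have "l \<le> exit_prob a i x" if a: "x \<le> a" for a
  proof -
    define \<delta> where "\<delta> = survive_bound a"
    have a0: "0 \<le> a" using a x by simp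
    have \<delta>: "0 < \<delta>" "\<delta> \<le> 1"
      using survive_bound(1)[of a] survive_bound_le[of a a i] a0 by (auto simp: \<delta>_def)
    \<comment> \<open>At level \<open>a\<close> the exit probability is 1, so the boundary terms
      cancel and the error is inherited only through an event. An event occurs before
      \<open>a\<close> with probability at most 1 - \<delta>, so each step contracts the error by
      this factor.\<close>
    have "\<phi> N i x \<le> exit_prob a i x + (1 - \<delta>) ^ N" if "0 \<le> x" "x \<le> a" for N i x
      using that
    proof (induction N arbitrary: i x)
      case 0
      then show ?case by (simp add: \<phi>0 exit_prob_nonneg)
    next
      case (Suc N)
      let ?e = "\<lambda>y. exp (- (eta i / p i) * (y - x))"
      let ?d = "\<lambda>k x. 1 * exit_prob a k x + (-1) * \<phi> N k x"
      note ca = sol_causal[OF sol_exit_prob]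
      have "- ((1 - \<delta>) ^ N) * (1 - ?e a) \<le> integral {x..a} (\<lambda>s. ?e s * ((conv ?d i s + 0) / p i))"
      proof (rule integral_drift_ge)
        show "- ((1 - \<delta>) ^ N) \<le> 1 * exit_prob a k z + (-1) * \<phi> N k z" if "0 \<le> z" "z \<le> a" for k z
          using Suc.IH[OF that, of k] by simp
        show "causal (\<lambda>x. 1 * exit_prob a k x + (-1) * \<phi> N k x)" for k
          by (intro causal_lincomb ca causal)
      qed (use \<delta> Suc.prems in \<open>auto intro: causal_zero\<close>)
      moreover have "- ((1 - \<delta>) ^ N) * (1 - \<delta>) \<le> - ((1 - \<delta>) ^ N) * (1 - ?e a)"
        using \<delta> survive_bound_le[OF Suc.prems, of i] by (intro mult_left_mono_neg) (auto simp: \<delta>_def)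
      moreover have "integral {x..a} (\<lambda>s. ?e s * ((conv ?d i s + 0) / p i)) =
          integral {x..a} (\<lambda>s. ?e s * ((conv (exit_prob a) i s + 0) / p i) - ?e s * ((conv (\<phi> N) i s + 0) / p i))"
        by (rule integral_cong) (simp only: conv_lincomb[OF ca causal], simp add: right_diff_distrib diff_divide_distrib)
      moreover have "\<dots> = integral {x..a} (\<lambda>s. ?e s * ((conv (exit_prob a) i s + 0) / p i)) -
          integral {x..a} (\<lambda>s. ?e s * ((conv (\<phi> N) i s + 0) / p i))"
        by (intro integral_diff drift_integrable ca causal causal_zero)
      moreover have "exit_prob a i x = ?e a + integral {x..a} (\<lambda>s. ?e s * ((conv (exit_prob a) i s + 0) / p i))"
        using sol_eq[OF sol_exit_prob Suc.prems, where i=i] exit_prob_end[OF a0] by simp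
      moreover have "\<phi> (Suc N) i x \<le> ?e a + integral {x..a} (\<lambda>s. ?e s * ((conv (\<phi> N) i s + 0) / p i))"
        by (rule upper[OF Suc.prems])
      ultimately show ?case by (simp add: mult.commute)
    qed
    then have "\<phi> N i x \<le> exit_prob a i x + (1 - \<delta>) ^ N" for N using x a by blast
    moreover have "(\<lambda>N. exit_prob a i x + (1 - \<delta>) ^ N) \<longlonglongrightarrow> exit_prob a i x + 0"
      using \<delta> by (intro tendsto_intros LIMSEQ_power_zero) auto
    ultimately show ?thesis using lim by (auto intro: LIMSEQ_le)
  qed
  \<comment> \<open>The barrier is removed only now, since \<delta> depends on
    \<open>a\<close>.\<close>
  then show "l \<le> psi i x"
    by (intro tendsto_lowerbound[OF exit_prob_tendsto]) (auto intro: eventually_mono[OF eventually_ge_at_top[of x]])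
qed

end

section \<open>Competing exponential clocks\<close>

lemma prob_space_exp1: "prob_space exp1"
  unfolding exp1_def by (rule prob_space_exponential_density) simp

lemma sets_exp1[measurable_cong, simp]: "sets exp1 = sets borel"
  by (simp add: exp1_def)

lemma space_exp1[simp]: "space exp1 = UNIV"
  by (simp add: exp1_def)

lemma nn_integral_exp1:
  assumes [measurable]: "f \<in> borel_measurable borel"
  shows "(\<integral>\<^sup>+x. f x \<partial>exp1) = (\<integral>\<^sup>+x. ennreal (exp (- x)) * indicator {0..} x * f x \<partial>lborel)"
  unfolding exp1_def
  by (subst nn_integral_density) (auto intro!: nn_integral_cong simp: exponential_density_def indicator_def)

lemma nn_integral_exp_atLeast:
  fixes b c :: real
  assumes "0 < b"
  shows "(\<integral>\<^sup>+x. ennreal (b * exp (- b * (x - c))) * indicator {a..} x \<partial>lborel) = ennreal (exp (- b * (a - c)))"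
proof -
  have "((\<lambda>x. - exp (- b * (x - c))) \<longlongrightarrow> - 0) at_top"
    using assms
    by (intro tendsto_intros filterlim_compose[OF exp_at_bot] filterlim_tendsto_neg_mult_at_bot[OF tendsto_const])
       (auto intro!: filterlim_at_top_mono[OF filterlim_tendsto_add_at_top[OF tendsto_const[of "-c"] filterlim_ident]])
  then show ?thesis
    using assms
    by (subst nn_integral_FTC_atLeast[where F="\<lambda>x. - exp (- b * (x - c))" and T=0])
       (auto intro!: derivative_eq_intros)
qed

lemma exp1_tail: "0 \<le> t \<Longrightarrow> emeasure exp1 {t<..} = ennreal (exp (- t))"
proof -
  assume t: "0 \<le> t"
  have "emeasure exp1 {t<..} = (\<integral>\<^sup>+x. indicator {t<..} x \<partial>exp1)" by simp
  also have "\<dots> = (\<integral>\<^sup>+x. ennreal (1 * exp (- 1 * (x - 0))) * indicator {t..} x \<partial>lborel)"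
    using t AE_lborel_singleton[of t]
    by (subst nn_integral_exp1) (auto intro!: nn_integral_cong_AE simp: indicator_def)
  finally show ?thesis by (simp only: nn_integral_exp_atLeast[OF zero_less_one]) simp
qed

text \<open>The choice depends only on the set {k. P k s}, which ranges over a finite type. This
  includes the points where the set is empty and the choice is arbitrary.\<close>

lemma measurable_finite_SOME:
  fixes P :: "'k::finite \<Rightarrow> 'a \<Rightarrow> bool"
  assumes [measurable]: "\<And>k. Measurable.pred M (P k)"
  shows "(\<lambda>s. SOME k. P k s) \<in> measurable M (count_space UNIV)"
proof -
  have "(\<lambda>s. {k. P k s}) \<in> measurable M (count_space UNIV)"
  proof (subst measurable_count_space_eq2)
    have "(\<lambda>s. {k. P k s}) -` {B} \<inter> space M = {s \<in> space M. \<forall>k. P k s \<longleftrightarrow> k \<in> B}" for B by auto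
    then show "(\<lambda>s. {k. P k s}) \<in> space M \<rightarrow> UNIV \<and> (\<forall>B\<in>UNIV. (\<lambda>s. {k. P k s}) -` {B} \<inter> space M \<in> sets M)"
      by simp
  qed simp
  from measurable_compose[OF this, of "\<lambda>B. SOME k. k \<in> B" "count_space UNIV"]
  show ?thesis by simp
qed

context risk_model
begin

section \<open>The step distribution as a product of clocks and claims\<close>

abbreviation stepM :: "'n step measure" where
  "stepM \<equiv> step_measure FC FCJ"

definition pair_law :: "'n \<times> 'n \<Rightarrow> real measure" where
  "pair_law ij = (if fst ij = snd ij then return borel 0 else FCJ (fst ij) (snd ij))"

abbreviation clocksM :: "(real \<times> ('n \<Rightarrow> real)) measure" where
  "clocksM \<equiv> exp1 \<Otimes>\<^sub>M (\<Pi>\<^sub>M k\<in>UNIV. exp1)"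

abbreviation claimsM :: "(('n \<Rightarrow> real) \<times> ('n \<times> 'n \<Rightarrow> real)) measure" where
  "claimsM \<equiv> (\<Pi>\<^sub>M i\<in>UNIV. FC i) \<Otimes>\<^sub>M (\<Pi>\<^sub>M ij\<in>UNIV. pair_law ij)"

lemma stepM_eq: "stepM = clocksM \<Otimes>\<^sub>M claimsM"
  by (simp add: step_measure_def pair_law_def)

lemma FC_props: "prob_space (FC i)" "sets (FC i) = sets borel"
  using FC_law[of i] by (auto simp: claim_law_def claim_law_axioms_def)

lemma pair_law_props: "prob_space (pair_law ij)" "sets (pair_law ij) = sets borel"
  using FCJ_law[of "fst ij" "snd ij"]
  by (auto simp: pair_law_def claim_law_def claim_law_axioms_def intro!: prob_space_return)

lemma sets_stepM[measurable_cong]: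
  "sets stepM = sets ((borel \<Otimes>\<^sub>M (\<Pi>\<^sub>M k\<in>UNIV. borel)) \<Otimes>\<^sub>M
     ((\<Pi>\<^sub>M i\<in>UNIV. borel) \<Otimes>\<^sub>M (\<Pi>\<^sub>M ij\<in>UNIV. borel)))"
  unfolding stepM_eq
  by (intro sets_pair_measure_cong sets_PiM_cong refl) (auto simp: FC_props pair_law_props)

lemma prob_space_clocks: "prob_space (\<Pi>\<^sub>M k\<in>(UNIV :: 'n set). exp1)"
  by (intro prob_space_PiM prob_space_exp1)

lemma prob_space_claims1: "prob_space (\<Pi>\<^sub>M i\<in>UNIV. FC i)"
  by (intro prob_space_PiM FC_props)

lemma prob_space_claims2: "prob_space (\<Pi>\<^sub>M ij\<in>UNIV. pair_law ij)"
  by (intro prob_space_PiM pair_law_props)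

lemma prob_space_clocksM: "prob_space clocksM"
  by (intro prob_space_pair prob_space_exp1 prob_space_clocks)

lemma prob_space_claimsM: "prob_space claimsM"
  by (intro prob_space_pair prob_space_claims1 prob_space_claims2)

lemma prob_space_stepM: "prob_space stepM"
  unfolding stepM_eq by (intro prob_space_pair prob_space_clocksM prob_space_claimsM)

text \<open>Coordinate \<open>j\<close> of the switch clocks is overwritten by the claim clock.
  Claim arrivals thus become the transition from \<open>j\<close> to itself, in agreement with
  \<open>rate\<close>, and one race among the clocks covers both kinds of events.\<close>

definition clock :: "'n \<Rightarrow> 'n \<Rightarrow> 'n step \<Rightarrow> real" where
  "clock j k s = ((snd (fst s))(j := fst (fst s))) k"

definition claim :: "'n \<Rightarrow> 'n \<Rightarrow> 'n step \<Rightarrow> real" where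
  "claim j k s = (if k = j then fst (snd s) j else snd (snd s) (j, k))"

definition active :: "'n \<Rightarrow> 'n set" where
  "active j = {k. 0 < rate j k}"

lemma clock_measurable[measurable]: "clock j k \<in> borel_measurable stepM"
  unfolding clock_def by (cases "k = j") simp_all

lemma claim_measurable[measurable]: "claim j k \<in> borel_measurable stepM"
  unfolding claim_def by (cases "k = j") simp_all

lemma eta_active: "(\<Sum>k\<in>active j. rate j k) = eta j"
  unfolding eta_def active_def
  by (rule sum.mono_neutral_left) (auto simp: rate_nonneg not_less intro: antisym)

lemma active_empty_iff: "active j = {} \<longleftrightarrow> eta j = 0"
proof
  assume "eta j = 0"
  then have "rate j k = 0" for k
    unfolding eta_def by (subst (asm) sum_nonneg_eq_0_iff) (auto simp: rate_nonneg)
  then show "active j = {}" by (simp add: active_def)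
qed (simp add: eta_active[symmetric])

lemma ev_times_eq: "ev_times lam Q j s = (\<lambda>l. clock j l s / rate j l) ` active j"
  by (auto simp: ev_times_def clock_def rate_def active_def image_iff)

text \<open>Strict inequalities leave out ties, where the outcome of \<open>mm_step\<close> would
  depend on an arbitrary choice. \<open>AE_wins\<close> shows that nothing is lost.\<close>

definition wins :: "'n \<Rightarrow> 'n \<Rightarrow> 'n step set" where
  "wins j k = {s \<in> space stepM. \<forall>l\<in>active j - {k}. clock j k s / rate j k < clock j l s / rate j l}"

lemma mm_step_wins:
  assumes k: "k \<in> active j" and s: "s \<in> wins j k"
  shows "mm_step lam Q j s = Some (clock j k s / rate j k, k, claim j k s)"
proof -
  let ?t = "\<lambda>l. clock j l s / rate j l"
  have lt: "?t k < ?t l" if "l \<in> active j" "l \<noteq> k" for l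
    using s that by (auto simp: wins_def)
  have Min: "Min (ev_times lam Q j s) = ?t k"
    unfolding ev_times_eq
  proof (rule Min_eqI)
    show "?t k \<le> y" if "y \<in> ?t ` active j" for y
      using that lt by (auto simp: le_less)
  qed (use k in auto)
  show ?thesis
  proof (cases "k = j")
    case True
    then show ?thesis
      using k Min ev_times_eq[of j s]
      by (auto simp: mm_step_def active_def rate_def clock_def claim_def Let_def)
  next
    case False
    have "\<not> (0 < lam j \<and> fst (fst s) / lam j = ?t k)"
      using lt[of j] False by (auto simp: active_def rate_def clock_def)
    moreover have "(SOME l. l \<noteq> j \<and> 0 < Q$j$l \<and> snd (fst s) l / Q$j$l = ?t k) = k"
    proof (rule some_equality)
      show "k \<noteq> j \<and> 0 < Q$j$k \<and> snd (fst s) k / Q$j$k = ?t k"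
        using k False by (auto simp: active_def rate_def clock_def)
      fix l assume "l \<noteq> j \<and> 0 < Q$j$l \<and> snd (fst s) l / Q$j$l = ?t k"
      then show "l = k"
        using lt[of l] False by (intro ccontr[of "l = k"]) (auto simp: active_def rate_def clock_def)
    qed
    moreover have "ev_times lam Q j s \<noteq> {}" using k by (auto simp: ev_times_eq)
    ultimately show ?thesis
      using False by (simp add: mm_step_def Min Let_def claim_def)
  qed
qed

lemma mm_step_None: "active j = {} \<Longrightarrow> mm_step lam Q j s = None"
  by (simp add: mm_step_def ev_times_eq)

lemma nn_integral_claim:
  assumes [measurable]: "f \<in> borel_measurable borel"
  shows "(\<integral>\<^sup>+b. f (claim j k (a, b)) \<partial>claimsM) = (\<integral>\<^sup>+c. f c \<partial>law j k)"
proof -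
  interpret P1: prob_space "\<Pi>\<^sub>M i\<in>UNIV. FC i" by (rule prob_space_claims1)
  interpret P2: prob_space "\<Pi>\<^sub>M ij\<in>UNIV. pair_law ij" by (rule prob_space_claims2)
  note [measurable_cong] = FC_props(2) pair_law_props(2)
  show ?thesis
  proof (cases "k = j")
    case True
    have "(\<integral>\<^sup>+b. f (claim j k (a, b)) \<partial>claimsM) = (\<integral>\<^sup>+b. f (fst b j) \<partial>claimsM)"
      using True by (simp add: claim_def)
    also have "\<dots> = (\<integral>\<^sup>+x. \<integral>\<^sup>+y. f (fst (x, y) j) \<partial>(\<Pi>\<^sub>M ij\<in>UNIV. pair_law ij) \<partial>(\<Pi>\<^sub>M i\<in>UNIV. FC i))"
      by (rule P2.nn_integral_fst[symmetric]) measurable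
    also have "\<dots> = (\<integral>\<^sup>+x. f (x j) \<partial>(\<Pi>\<^sub>M i\<in>UNIV. FC i))"
      by (simp add: P2.emeasure_space_1)
    also have "\<dots> = (\<integral>\<^sup>+c. f c \<partial>distr (\<Pi>\<^sub>M i\<in>UNIV. FC i) (FC j) (\<lambda>x. x j))"
      by (subst nn_integral_distr) (auto simp: measurable_component_singleton)
    also have "\<dots> = (\<integral>\<^sup>+c. f c \<partial>law j k)"
      using True by (subst distr_PiM_component) (auto simp: FC_props law_def)
    finally show ?thesis .
  next
    case False
    have "(\<integral>\<^sup>+b. f (claim j k (a, b)) \<partial>claimsM) = (\<integral>\<^sup>+b. f (snd b (j, k)) \<partial>claimsM)"
      using False by (simp add: claim_def)
    also have "\<dots> = (\<integral>\<^sup>+x. \<integral>\<^sup>+y. f (snd (x, y) (j, k)) \<partial>(\<Pi>\<^sub>M ij\<in>UNIV. pair_law ij) \<partial>(\<Pi>\<^sub>M i\<in>UNIV. FC i))"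
      by (rule P2.nn_integral_fst[symmetric]) measurable
    also have "\<dots> = (\<integral>\<^sup>+y. f (y (j, k)) \<partial>(\<Pi>\<^sub>M ij\<in>UNIV. pair_law ij))"
      by (simp add: P1.emeasure_space_1)
    also have "\<dots> = (\<integral>\<^sup>+c. f c \<partial>distr (\<Pi>\<^sub>M ij\<in>UNIV. pair_law ij) (pair_law (j, k)) (\<lambda>x. x (j, k)))"
      by (subst nn_integral_distr) (auto simp: measurable_component_singleton)
    also have "\<dots> = (\<integral>\<^sup>+c. f c \<partial>law j k)"
      using False by (subst distr_PiM_component) (auto simp: pair_law_props, simp add: law_def pair_law_def)
    finally show ?thesis .
  qed
qed

text \<open>Replacing one coordinate by an independent copy does not change the product law, so the
  clocks seen from state \<open>j\<close> are again i.i.d. It suffices to compare boxes: the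
  overwritten coordinate is free and contributes the factor 1.\<close>

lemma distr_clocks:
  "distr clocksM (\<Pi>\<^sub>M k\<in>UNIV. exp1) (\<lambda>a. (snd a)(j := fst a)) = (\<Pi>\<^sub>M k\<in>UNIV. exp1)"
proof -
  interpret E: prob_space exp1 by (rule prob_space_exp1)
  interpret product_prob_space "\<lambda>_. exp1" "UNIV :: 'n set" ..
  have meas: "(\<lambda>a. (snd a)(j := fst a)) \<in> measurable clocksM (\<Pi>\<^sub>M k\<in>UNIV. exp1)"
  proof (rule measurable_PiM_single')
    show "(\<lambda>a. ((snd a)(j := fst a)) k) \<in> measurable clocksM exp1" for k
      by (cases "k = j") simp_all
  qed (auto simp: space_pair_measure)
  show ?thesis
  proof (rule PiM_eqI)
    fix X :: "'n \<Rightarrow> real set" assume "\<And>i. i \<in> UNIV \<Longrightarrow> X i \<in> sets exp1"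
    then have X: "X i \<in> sets borel" for i by simp
    have pre: "(\<lambda>a. (snd a)(j := fst a)) -` (Pi\<^sub>E UNIV X) \<inter> space clocksM = X j \<times> Pi\<^sub>E UNIV (X(j := UNIV))"
      by (auto simp: space_pair_measure space_PiM PiE_def Pi_def split: if_splits)
    have "emeasure (distr clocksM (\<Pi>\<^sub>M k\<in>UNIV. exp1) (\<lambda>a. (snd a)(j := fst a))) (Pi\<^sub>E UNIV X) =
        emeasure clocksM (X j \<times> Pi\<^sub>E UNIV (X(j := UNIV)))"
      by (subst emeasure_distr[OF meas]) (use X pre in \<open>auto intro!: sets_PiM_I_finite\<close>)
    also have "\<dots> = emeasure exp1 (X j) * emeasure (\<Pi>\<^sub>M k\<in>UNIV. exp1) (Pi\<^sub>E UNIV (X(j := UNIV)))"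
      by (rule sigma_finite_measure.emeasure_pair_measure_Times[OF prob_space_imp_sigma_finite[OF prob_space_clocks]]) (use X in \<open>auto intro!: sets_PiM_I_finite\<close>)
    also have "emeasure (\<Pi>\<^sub>M k\<in>UNIV. exp1) (Pi\<^sub>E UNIV (X(j := UNIV))) = (\<Prod>k\<in>UNIV. emeasure exp1 ((X(j := UNIV)) k))"
      by (rule emeasure_PiM) (use X in auto)
    also have "\<dots> = emeasure exp1 UNIV * (\<Prod>k\<in>UNIV - {j}. emeasure exp1 (X k))"
      by (subst prod.remove[of _ j]) (auto intro!: prod.cong)
    also have "emeasure exp1 UNIV = 1" using E.emeasure_space_1 by simp
    also have "emeasure exp1 (X j) * (1 * (\<Prod>k\<in>UNIV - {j}. emeasure exp1 (X k))) = (\<Prod>k\<in>UNIV. emeasure exp1 (X k))"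
      by (subst (2) prod.remove[of _ j]) auto
    finally show "emeasure (distr clocksM (\<Pi>\<^sub>M k\<in>UNIV. exp1) (\<lambda>a. (snd a)(j := fst a))) (Pi\<^sub>E UNIV X) =
        (\<Prod>k\<in>UNIV. emeasure exp1 (X k))" .
  qed auto
qed

text \<open>Condition on the winning clock having the value y. The other active clocks exceed their
  thresholds with probability exp (- rate j l * y / rate j k), and together with the density exp (-
  y) the exponents add up to - eta j * y / rate j k. Substituting y = rate j k * h gives the
  claim.\<close>

lemma nn_integral_first_clock:
  assumes k: "k \<in> active j" and H[measurable]: "H \<in> borel_measurable borel"
  shows "(\<integral>\<^sup>+\<omega>. indicator {\<omega>. \<forall>l\<in>active j - {k}. \<omega> k / rate j k < \<omega> l / rate j l} \<omega> * H (\<omega> k / rate j k) \<partial>(\<Pi>\<^sub>M k\<in>UNIV. exp1)) =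
    ennreal (rate j k) * (\<integral>\<^sup>+h. ennreal (exp (- eta j * h)) * indicator {0..} h * H h \<partial>lborel)"
proof -
  interpret E: prob_space exp1 by (rule prob_space_exp1)
  interpret product_sigma_finite "\<lambda>_. exp1" ..
  interpret R: product_prob_space "\<lambda>_. exp1" "UNIV - {k}" ..
  let ?r = "rate j k"
  have r: "0 < ?r" using k by (simp add: active_def)
  let ?f = "\<lambda>\<omega>. indicator {\<omega>. \<forall>l\<in>active j - {k}. \<omega> k / ?r < \<omega> l / rate j l} \<omega> * H (\<omega> k / ?r)"
  have ins: "insert k (UNIV - {k}) = UNIV" by auto
  have f: "?f \<in> borel_measurable (\<Pi>\<^sub>M k\<in>UNIV. exp1)" by measurable
  have "integral\<^sup>N (\<Pi>\<^sub>M k\<in>UNIV. exp1) ?f = (\<integral>\<^sup>+y. (\<integral>\<^sup>+x. ?f (x(k := y)) \<partial>(\<Pi>\<^sub>M k\<in>UNIV - {k}. exp1)) \<partial>exp1)"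
    using product_nn_integral_insert_rev[of "UNIV - {k}" k ?f] f unfolding ins by simp
  also have "\<dots> = (\<integral>\<^sup>+y. ennreal (exp (- y)) * indicator {0..} y *
      (\<integral>\<^sup>+x. ?f (x(k := y)) \<partial>(\<Pi>\<^sub>M k\<in>UNIV - {k}. exp1)) \<partial>lborel)"
    by (rule nn_integral_exp1) measurable
  also have "\<dots> = (\<integral>\<^sup>+y. ennreal (exp (- (eta j / ?r) * y)) * indicator {0..} y * H (y / ?r) \<partial>lborel)"
  proof (rule nn_integral_cong)
    fix y :: real
    show "ennreal (exp (- y)) * indicator {0..} y * (\<integral>\<^sup>+x. ?f (x(k := y)) \<partial>(\<Pi>\<^sub>M k\<in>UNIV - {k}. exp1)) =
        ennreal (exp (- (eta j / ?r) * y)) * indicator {0..} y * H (y / ?r)"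
    proof (cases "0 \<le> y")
      case True
      let ?X = "\<lambda>l. {rate j l * (y / ?r)<..}"
      have "(\<integral>\<^sup>+x. ?f (x(k := y)) \<partial>(\<Pi>\<^sub>M k\<in>UNIV - {k}. exp1)) =
          (\<integral>\<^sup>+x. H (y / ?r) * indicator {x \<in> space (\<Pi>\<^sub>M k\<in>UNIV - {k}. exp1). \<forall>l\<in>active j - {k}. x l \<in> ?X l} x \<partial>(\<Pi>\<^sub>M k\<in>UNIV - {k}. exp1))"
        by (rule nn_integral_cong)
           (auto simp: indicator_def active_def pos_less_divide_eq mult.commute)
      also have "\<dots> = H (y / ?r) * emeasure (\<Pi>\<^sub>M k\<in>UNIV - {k}. exp1) {x \<in> space (\<Pi>\<^sub>M k\<in>UNIV - {k}. exp1). \<forall>l\<in>active j - {k}. x l \<in> ?X l}"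
        by (rule nn_integral_cmult_indicator) measurable
      also have "emeasure (\<Pi>\<^sub>M k\<in>UNIV - {k}. exp1) {x \<in> space (\<Pi>\<^sub>M k\<in>UNIV - {k}. exp1). \<forall>l\<in>active j - {k}. x l \<in> ?X l} =
          (\<Prod>l\<in>active j - {k}. emeasure exp1 (?X l))"
        by (rule R.emeasure_PiM_Collect) auto
      also have "\<dots> = (\<Prod>l\<in>active j - {k}. ennreal (exp (- (rate j l * (y / ?r)))))"
        by (intro prod.cong refl exp1_tail) (use True r rate_nonneg in auto)
      also have "\<dots> = ennreal (exp (- ((eta j - ?r) * (y / ?r))))"
      proof -
        have "(\<Sum>l\<in>active j - {k}. rate j l) = eta j - ?r"
          using k by (simp add: eta_active[symmetric] sum_diff1)
        then show ?thesis
          by (simp add: prod_ennreal exp_sum[symmetric] sum_negf sum_distrib_right[symmetric] sum_divide_distrib[symmetric])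
      qed
      finally have I1: "(\<integral>\<^sup>+x. ?f (x(k := y)) \<partial>(\<Pi>\<^sub>M k\<in>UNIV - {k}. exp1)) = H (y / ?r) * ennreal (exp (- ((eta j - ?r) * (y / ?r))))" .
      have I2: "ennreal (exp (- y)) * ennreal (exp (- ((eta j - ?r) * (y / ?r)))) = ennreal (exp (- (eta j / ?r) * y))"
        using r by (simp add: ennreal_mult[symmetric] exp_add[symmetric] field_simps)
      show ?thesis using True unfolding I1 I2[symmetric] by (simp add: mult_ac)
    qed simp
  qed
  also have "\<dots> = ennreal \<bar>?r\<bar> * (\<integral>\<^sup>+h. ennreal (exp (- (eta j / ?r) * (0 + ?r * h))) * indicator {0..} (0 + ?r * h) * H ((0 + ?r * h) / ?r) \<partial>lborel)"
    by (rule nn_integral_real_affine) (use r in auto)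
  also have "\<dots> = ennreal ?r * (\<integral>\<^sup>+h. ennreal (exp (- eta j * h)) * indicator {0..} h * H h \<partial>lborel)"
    using r by (auto intro!: arg_cong2[where f="(*)"] nn_integral_cong simp: indicator_def zero_le_mult_iff)
  finally show ?thesis .
qed

text \<open>The claim is independent of the clocks, so it is integrated out first; what remains is a
  function of the clocks seen from \<open>j\<close>.\<close>

lemma nn_integral_wins:
  assumes k: "k \<in> active j" and g[measurable]: "(\<lambda>(h, c). g h c) \<in> borel_measurable (borel \<Otimes>\<^sub>M borel)"
  shows "(\<integral>\<^sup>+s. indicator (wins j k) s * g (clock j k s / rate j k) (claim j k s) \<partial>stepM) =
    ennreal (rate j k) * (\<integral>\<^sup>+h. ennreal (exp (- eta j * h)) * indicator {0..} h * (\<integral>\<^sup>+c. g h c \<partial>law j k) \<partial>lborel)"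
proof -
  interpret B: prob_space claimsM by (rule prob_space_claimsM)
  interpret L: claim_law "law j k" by (rule law)
  let ?cl = "\<lambda>a. (snd a)(j := fst a)"
  let ?A = "{\<omega>. \<forall>l\<in>active j - {k}. \<omega> k / rate j k < \<omega> l / rate j l}"
  define H where "H = (\<lambda>h. \<integral>\<^sup>+c. g h c \<partial>law j k)"
  have H[measurable]: "H \<in> borel_measurable borel" unfolding H_def by measurable
  have meas: "?cl \<in> measurable clocksM (\<Pi>\<^sub>M k\<in>UNIV. exp1)"
  proof (rule measurable_PiM_single')
    show "(\<lambda>a. ?cl a k) \<in> measurable clocksM exp1" for k
      by (cases "k = j") simp_all
  qed (auto simp: space_pair_measure)
  have F: "(\<lambda>s. indicator (wins j k) s * g (clock j k s / rate j k) (claim j k s)) \<in> borel_measurable stepM"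
    unfolding wins_def by measurable
  have "(\<integral>\<^sup>+s. indicator (wins j k) s * g (clock j k s / rate j k) (claim j k s) \<partial>stepM) =
      (\<integral>\<^sup>+a. \<integral>\<^sup>+b. indicator (wins j k) (a, b) * g (clock j k (a, b) / rate j k) (claim j k (a, b)) \<partial>claimsM \<partial>clocksM)"
    unfolding stepM_eq by (rule B.nn_integral_fst[symmetric]) (use F in \<open>simp add: stepM_eq\<close>)
  also have "\<dots> = (\<integral>\<^sup>+a. indicator ?A (?cl a) * H (?cl a k / rate j k) \<partial>clocksM)"
  proof (rule nn_integral_cong)
    fix a assume a: "a \<in> space clocksM"
    have "(\<integral>\<^sup>+b. indicator (wins j k) (a, b) * g (clock j k (a, b) / rate j k) (claim j k (a, b)) \<partial>claimsM) =
        (\<integral>\<^sup>+b. indicator ?A (?cl a) * g (?cl a k / rate j k) (claim j k (a, b)) \<partial>claimsM)"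
      by (rule nn_integral_cong) (use a in \<open>auto simp: wins_def clock_def indicator_def stepM_eq space_pair_measure\<close>)
    also have "\<dots> = (\<integral>\<^sup>+c. indicator ?A (?cl a) * g (?cl a k / rate j k) c \<partial>law j k)"
      by (rule nn_integral_claim) measurable
    also have "\<dots> = indicator ?A (?cl a) * H (?cl a k / rate j k)"
      unfolding H_def by (rule nn_integral_cmult) measurable
    finally show "(\<integral>\<^sup>+b. indicator (wins j k) (a, b) * g (clock j k (a, b) / rate j k) (claim j k (a, b)) \<partial>claimsM) =
        indicator ?A (?cl a) * H (?cl a k / rate j k)" .
  qed
  also have "\<dots> = (\<integral>\<^sup>+\<omega>. indicator ?A \<omega> * H (\<omega> k / rate j k) \<partial>distr clocksM (\<Pi>\<^sub>M k\<in>UNIV. exp1) ?cl)"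
    by (rule nn_integral_distr[OF meas, symmetric]) measurable
  also have "\<dots> = ennreal (rate j k) * (\<integral>\<^sup>+h. ennreal (exp (- eta j * h)) * indicator {0..} h * H h \<partial>lborel)"
    unfolding distr_clocks by (rule nn_integral_first_clock[OF k H])
  finally show ?thesis by (simp only: H_def)
qed

lemma wins_sets[measurable]: "wins j k \<in> sets stepM"
  unfolding wins_def by measurable

lemma wins_disjoint:
  assumes "k \<in> active j" "l \<in> active j" "k \<noteq> l"
  shows "wins j k \<inter> wins j l = {}"
proof -
  have False if "s \<in> wins j k" "s \<in> wins j l" for s
  proof -
    have "clock j k s / rate j k < clock j l s / rate j l" "clock j l s / rate j l < clock j k s / rate j k"
      using that assms by (auto simp: wins_def)
    then show False by simp
  qed
  then show ?thesis by blast
qed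

text \<open>Ties need no separate treatment: the disjoint events \<open>wins j k\<close> have
  probabilities rate j k / eta j, and these sum to 1.\<close>

lemma AE_wins:
  assumes "0 < eta j"
  shows "AE s in stepM. s \<in> (\<Union>k\<in>active j. wins j k)"
proof -
  interpret prob_space stepM by (rule prob_space_stepM)
  have "emeasure stepM (wins j k) = ennreal (rate j k / eta j)" if k: "k \<in> active j" for k
  proof -
    interpret L: claim_law "law j k" by (rule law)
    have "emeasure stepM (wins j k) = (\<integral>\<^sup>+s. indicator (wins j k) s * 1 \<partial>stepM)" by simp
    also have "\<dots> = ennreal (rate j k) * (\<integral>\<^sup>+h. ennreal (exp (- eta j * h)) * indicator {0..} h \<partial>lborel)"
      by (subst nn_integral_wins[OF k, where g="\<lambda>_ _. 1"]) (simp_all add: L.emeasure_space_1)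
    also have "(\<integral>\<^sup>+h. ennreal (exp (- eta j * h)) * indicator {0..} h \<partial>lborel) =
        (\<integral>\<^sup>+h. ennreal (1 / eta j) * (ennreal (eta j * exp (- eta j * (h - 0))) * indicator {0..} h) \<partial>lborel)"
      using assms by (intro nn_integral_cong) (simp add: mult.assoc[symmetric] ennreal_mult[symmetric])
    also have "\<dots> = ennreal (1 / eta j) * 1"
      by (subst nn_integral_cmult) (simp_all only: nn_integral_exp_atLeast[OF assms], simp_all)
    finally show ?thesis using assms rate_nonneg[of j k] by (simp add: ennreal_mult[symmetric])
  qed
  then have "emeasure stepM (\<Union>k\<in>active j. wins j k) = (\<Sum>k\<in>active j. ennreal (rate j k / eta j))"
    by (subst sum_emeasure[symmetric]) (auto simp: disjoint_family_on_def wins_disjoint)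
  also have "\<dots> = ennreal ((\<Sum>k\<in>active j. rate j k) / eta j)"
    using assms rate_nonneg by (subst sum_ennreal) (auto simp: sum_divide_distrib)
  also have "\<dots> = 1" using assms by (simp add: eta_active)
  finally show ?thesis by (subst AE_in_set_eq_1) (auto simp: measure_def)
qed

lemma nn_integral_mm_step:
  assumes eta: "0 < eta j" and f: "\<And>k. (\<lambda>(h, c). f h k c) \<in> borel_measurable (borel \<Otimes>\<^sub>M borel)"
  shows "(\<integral>\<^sup>+s. (case mm_step lam Q j s of None \<Rightarrow> u | Some (h, k, c) \<Rightarrow> f h k c) \<partial>stepM) =
    (\<Sum>k\<in>UNIV. ennreal (rate j k) *
      (\<integral>\<^sup>+h. ennreal (exp (- eta j * h)) * indicator {0..} h * (\<integral>\<^sup>+c. f h k c \<partial>law j k) \<partial>lborel))"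
proof -
  have [measurable]: "(\<lambda>s. f (clock j k s / rate j k) k (claim j k s)) \<in> borel_measurable stepM" for k
    using measurable_compose[OF _ f[of k], of "\<lambda>s. (clock j k s / rate j k, claim j k s)" stepM] by simp
  have "(\<integral>\<^sup>+s. (case mm_step lam Q j s of None \<Rightarrow> u | Some (h, k, c) \<Rightarrow> f h k c) \<partial>stepM) =
      (\<integral>\<^sup>+s. (\<Sum>k\<in>active j. indicator (wins j k) s * f (clock j k s / rate j k) k (claim j k s)) \<partial>stepM)"
  proof (rule nn_integral_cong_AE)
    show "AE s in stepM. (case mm_step lam Q j s of None \<Rightarrow> u | Some (h, k, c) \<Rightarrow> f h k c) =
        (\<Sum>k\<in>active j. indicator (wins j k) s * f (clock j k s / rate j k) k (claim j k s))"
      using AE_wins[OF eta]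
    proof eventually_elim
      case (elim s)
      then obtain k where k: "k \<in> active j" "s \<in> wins j k" by auto
      have "(\<Sum>l\<in>active j. indicator (wins j l) s * f (clock j l s / rate j l) l (claim j l s)) =
          (\<Sum>l\<in>{k}. indicator (wins j l) s * f (clock j l s / rate j l) l (claim j l s))"
        using k wins_disjoint by (intro sum.mono_neutral_right) (auto simp: indicator_def)
      then show ?case using k by (simp add: mm_step_wins)
    qed
  qed
  also have "\<dots> = (\<Sum>k\<in>active j. \<integral>\<^sup>+s. indicator (wins j k) s * f (clock j k s / rate j k) k (claim j k s) \<partial>stepM)"
    by (rule nn_integral_sum) measurable
  also have "\<dots> = (\<Sum>k\<in>active j. ennreal (rate j k) *
      (\<integral>\<^sup>+h. ennreal (exp (- eta j * h)) * indicator {0..} h * (\<integral>\<^sup>+c. f h k c \<partial>law j k) \<partial>lborel))"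
    by (intro sum.cong refl nn_integral_wins f)
  also have "\<dots> = (\<Sum>k\<in>UNIV. ennreal (rate j k) *
      (\<integral>\<^sup>+h. ennreal (exp (- eta j * h)) * indicator {0..} h * (\<integral>\<^sup>+c. f h k c \<partial>law j k) \<partial>lborel))"
    by (rule sum.mono_neutral_left) (auto simp: active_def not_less ennreal_neg)
  finally show ?thesis .
qed

end

section \<open>Surviving finitely many events\<close>

context risk_model
begin

abbreviation Om :: "(nat \<Rightarrow> 'n step) measure" where
  "Om \<equiv> Omega FC FCJ"

lemma Om_eq: "Om = (\<Pi>\<^sub>M n\<in>UNIV. stepM)"
  by (simp add: Omega_def)

lemma prob_space_Om: "prob_space Om"
  unfolding Om_eq by (intro prob_space_PiM prob_space_stepM)

lemma Om_component[measurable]: "(\<lambda>\<omega>. \<omega> n) \<in> measurable Om stepM"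
  unfolding Om_eq by measurable

text \<open>Unlike \<open>wins\<close>, the functions \<open>wait\<close>, \<open>stays\<close> and
  \<open>target\<close> describe \<open>mm_step\<close> at every sample point, ties included.
  Measurability of the path on the whole space requires this.\<close>

definition wait :: "'n \<Rightarrow> 'n step \<Rightarrow> real" where
  "wait j s = Min ((\<lambda>l. clock j l s / rate j l) ` active j)"

definition stays :: "'n \<Rightarrow> 'n step \<Rightarrow> bool" where
  "stays j s \<longleftrightarrow> 0 < lam j \<and> clock j j s / lam j = wait j s"

definition target :: "'n \<Rightarrow> 'n step \<Rightarrow> 'n" where
  "target j s = (SOME k. k \<noteq> j \<and> 0 < Q$j$k \<and> clock j k s / Q$j$k = wait j s)"

lemma mm_step_eq:
  "mm_step lam Q j s = (if active j = {} then None else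
     Some (wait j s, if stays j s then j else target j s,
           if stays j s then fst (snd s) j else snd (snd s) (j, target j s)))"
  by (auto simp: mm_step_def ev_times_eq Let_def wait_def stays_def target_def clock_def cong: conj_cong)

lemma step_claim_measurable[measurable]:
  "(\<lambda>s. fst (snd s) j) \<in> borel_measurable stepM" "(\<lambda>s. snd (snd s) ij) \<in> borel_measurable stepM"
  by simp_all

lemma wait_measurable[measurable]: "wait j \<in> borel_measurable stepM"
  unfolding wait_def by (intro borel_measurable_Min borel_measurable_divide) auto

lemma stays_measurable[measurable]: "Measurable.pred stepM (stays j)"
  unfolding stays_def by measurable

lemma target_measurable[measurable]: "target j \<in> measurable stepM (count_space UNIV)"
  unfolding target_def by (rule measurable_finite_SOME) measurable

lemma target_claim_measurable[measurable]: "(\<lambda>s. snd (snd s) (j, target j s)) \<in> borel_measurable stepM"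
  by (rule measurable_compose_countable[where f="\<lambda>k s. snd (snd s) (j, k)" and g="target j"]) measurable

definition advance :: "real \<times> 'n \<times> real \<times> bool \<Rightarrow> 'n step \<Rightarrow> real \<times> 'n \<times> real \<times> bool" where
  "advance = (\<lambda>(t, j, y, a) s.
     if a \<and> active j \<noteq> {} then (t + wait j s, if stays j s then j else target j s,
        y + p j * wait j s - (if stays j s then fst (snd s) j else snd (snd s) (j, target j s)), True)
     else (t, j, y, False))"

lemma skel_Suc: "skel p lam Q x i \<omega> (Suc n) = advance (skel p lam Q x i \<omega> n) (\<omega> n)"
  by (cases "skel p lam Q x i \<omega> n") (simp add: advance_def mm_step_eq)

declare skel.simps(2)[simp del]

abbreviation stateM :: "(real \<times> 'n \<times> real \<times> bool) measure" where
  "stateM \<equiv> borel \<Otimes>\<^sub>M (count_space UNIV \<Otimes>\<^sub>M (borel \<Otimes>\<^sub>M count_space UNIV))"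

lemma advance_measurable: "(\<lambda>z. advance (fst z) (snd z)) \<in> measurable (stateM \<Otimes>\<^sub>M stepM) stateM"
proof -
  \<comment> \<open>For a fixed state \<open>j\<close> the test on \<open>active j\<close> is
    decided and the functions of the step are fixed measurable maps. The actual state has finitely
    many values and is substituted afterwards.\<close>
  let ?f = "\<lambda>j z. if snd (snd (snd (fst z))) \<and> active j \<noteq> {} then
      (fst (fst z) + wait j (snd z), if stays j (snd z) then j else target j (snd z),
        fst (snd (snd (fst z))) + p j * wait j (snd z) -
          (if stays j (snd z) then fst (snd (snd z)) j else snd (snd (snd z)) (j, target j (snd z))), True)
      else (fst (fst z), j, fst (snd (snd (fst z))), False)"
  have [measurable]: "(\<lambda>z. snd (snd (snd z)) (j, target j (snd z))) \<in> borel_measurable (stateM \<Otimes>\<^sub>M stepM)" for j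
    by (rule measurable_compose[OF measurable_snd target_claim_measurable])
  have "?f j \<in> measurable (stateM \<Otimes>\<^sub>M stepM) stateM" for j
    by (cases "active j = {}") measurable
  then have "(\<lambda>z. ?f (fst (snd (fst z))) z) \<in> measurable (stateM \<Otimes>\<^sub>M stepM) stateM"
    by (rule measurable_compose_countable) measurable
  moreover have "(\<lambda>z. ?f (fst (snd (fst z))) z) = (\<lambda>z. advance (fst z) (snd z))"
    by (auto simp: advance_def fun_eq_iff)
  ultimately show ?thesis by simp
qed

text \<open>Joint measurability in the initial surplus and the sample point makes survival
  probabilities measurable in the initial surplus, so that they can be convolved.\<close>

lemma skel_measurable_pair:
  "(\<lambda>z. skel p lam Q (fst z) i (snd z) n) \<in> measurable (borel \<Otimes>\<^sub>M Om) stateM"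
proof (induction n)
  case 0
  show ?case by simp
next
  case (Suc n)
  have "(\<lambda>z. snd z n) \<in> measurable (borel \<Otimes>\<^sub>M Om) stepM"
    by (rule measurable_compose[OF measurable_snd Om_component])
  with Suc have "(\<lambda>z. (skel p lam Q (fst z) i (snd z) n, snd z n)) \<in> measurable (borel \<Otimes>\<^sub>M Om) (stateM \<Otimes>\<^sub>M stepM)"
    by (rule measurable_Pair)
  from measurable_compose[OF this advance_measurable] show ?case by (simp add: skel_Suc)
qed

definition time :: "real \<Rightarrow> 'n \<Rightarrow> (nat \<Rightarrow> 'n step) \<Rightarrow> nat \<Rightarrow> real" where
  "time x i \<omega> n = fst (skel p lam Q x i \<omega> n)"

definition state :: "real \<Rightarrow> 'n \<Rightarrow> (nat \<Rightarrow> 'n step) \<Rightarrow> nat \<Rightarrow> 'n" where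
  "state x i \<omega> n = fst (snd (skel p lam Q x i \<omega> n))"

definition surplus :: "real \<Rightarrow> 'n \<Rightarrow> (nat \<Rightarrow> 'n step) \<Rightarrow> nat \<Rightarrow> real" where
  "surplus x i \<omega> n = fst (snd (snd (skel p lam Q x i \<omega> n)))"

definition occurs :: "real \<Rightarrow> 'n \<Rightarrow> (nat \<Rightarrow> 'n step) \<Rightarrow> nat \<Rightarrow> bool" where
  "occurs x i \<omega> n = snd (snd (snd (skel p lam Q x i \<omega> n)))"

lemma skel_measurable[measurable]: "(\<lambda>\<omega>. skel p lam Q x i \<omega> n) \<in> measurable Om stateM"
  using measurable_compose[OF measurable_Pair1'[of x borel Om] skel_measurable_pair] by simp

lemma skeleton_measurable[measurable]:
  "(\<lambda>\<omega>. time x i \<omega> n) \<in> borel_measurable Om"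
  "(\<lambda>\<omega>. state x i \<omega> n) \<in> measurable Om (count_space UNIV)"
  "(\<lambda>\<omega>. surplus x i \<omega> n) \<in> borel_measurable Om"
  "Measurable.pred Om (\<lambda>\<omega>. occurs x i \<omega> n)"
  unfolding time_def state_def surplus_def occurs_def by measurable

lemma surplus_measurable_pair: "(\<lambda>z. surplus (fst z) i (snd z) n) \<in> borel_measurable (borel \<Otimes>\<^sub>M Om)"
proof -
  have "(\<lambda>q. fst (snd (snd q))) \<in> borel_measurable stateM" by measurable
  from measurable_compose[OF skel_measurable_pair this] show ?thesis by (simp add: surplus_def)
qed

section \<open>Regeneration at the first event\<close>

lemma skel_case_nat_Some:
  assumes "mm_step lam Q i s = Some (h, k, c)"
  shows "skel p lam Q x i (case_nat s \<omega>) (Suc n) =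
    (case skel p lam Q (x + p i * h - c) k \<omega> n of (t, j, y, a) \<Rightarrow> (h + t, j, y, a))"
proof (induction n)
  case 0
  show ?case using assms by (simp add: skel.simps(2))
next
  case (Suc n)
  show ?case
    by (subst skel_Suc, subst Suc) (auto simp: skel_Suc advance_def split: prod.splits)
qed

lemma skel_case_nat_None:
  assumes "mm_step lam Q i s = None"
  shows "skel p lam Q x i (case_nat s \<omega>) (Suc n) = (0, i, x, False)"
proof (induction n)
  case 0
  show ?case using assms by (simp add: skel.simps(2))
next
  case (Suc n)
  show ?case by (subst skel_Suc, subst Suc) (simp add: advance_def)
qed

text \<open>As every premium rate is positive, the surplus increases between events, so ruin can
  only be observed at event epochs. After the last event the skeleton is frozen, and later indices
  add no condition.\<close>

definition surv :: "nat \<Rightarrow> 'n \<Rightarrow> real \<Rightarrow> (nat \<Rightarrow> 'n step) set" where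
  "surv N i x = {\<omega> \<in> space Om. \<forall>n\<le>N. 0 \<le> surplus x i \<omega> n}"

definition phi :: "nat \<Rightarrow> 'n \<Rightarrow> real \<Rightarrow> real" where
  "phi N i x = measure Om (surv N i x)"

lemma surv_sets[measurable]: "surv N i x \<in> sets Om"
  unfolding surv_def by measurable

lemma surv_emeasure_measurable[measurable]: "(\<lambda>x. emeasure Om (surv N i x)) \<in> borel_measurable borel"
proof -
  interpret prob_space Om by (rule prob_space_Om)
  have [measurable]: "(\<lambda>z. surplus (fst z) i (snd z) n) \<in> borel_measurable (borel \<Otimes>\<^sub>M Om)" for n
    by (rule surplus_measurable_pair)
  have "{z \<in> space (borel \<Otimes>\<^sub>M Om). \<forall>n\<le>N. 0 \<le> surplus (fst z) i (snd z) n} \<in> sets (borel \<Otimes>\<^sub>M Om)"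
    by measurable
  from measurable_emeasure_Pair[OF this] show ?thesis
    by (rule back_subst[of "\<lambda>f. f \<in> borel_measurable borel"])
       (auto simp: surv_def space_pair_measure intro!: arg_cong[where f="emeasure Om"])
qed

lemma phi_measurable[measurable]: "phi N i \<in> borel_measurable borel"
  unfolding phi_def[abs_def] measure_def by measurable

lemma phi_nonneg: "0 \<le> phi N i x"
  by (simp add: phi_def)

lemma phi_le_1: "phi N i x \<le> 1"
  unfolding phi_def by (rule prob_space.prob_le_1[OF prob_space_Om])

lemma surplus_0: "surplus x i \<omega> 0 = x"
  by (simp add: surplus_def)

lemma phi_0: "0 \<le> x \<Longrightarrow> phi 0 i x = 1"
  using prob_space.prob_space[OF prob_space_Om] by (simp add: phi_def surv_def surplus_0)

lemma causal_phi: "causal (phi N i)"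
  unfolding causal_def
proof (intro conjI allI impI)
  show "phi N i x = 0" if "x < 0" for x
  proof -
    have "surv N i x = {}" using that by (force simp: surv_def surplus_0)
    then show ?thesis by (simp add: phi_def)
  qed
  show "\<exists>B. \<forall>x\<le>a. \<bar>phi N i x\<bar> \<le> B" for a
    by (intro exI[of _ 1]) (simp add: phi_le_1 phi_nonneg)
qed measurable

lemma ennreal_phi: "ennreal (phi N i x) = emeasure Om (surv N i x)"
proof -
  interpret prob_space Om by (rule prob_space_Om)
  show ?thesis by (simp add: phi_def emeasure_eq_measure)
qed

text \<open>First-step decomposition: prepending an independent step to an i.i.d. sequence
  reproduces its law, and after the first event the remaining path starts afresh from the new state
  and surplus.\<close>

lemma phi_Suc:
  assumes x: "0 \<le> x"
  shows "ennreal (phi (Suc N) i x) =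
    (\<integral>\<^sup>+s. (case mm_step lam Q i s of None \<Rightarrow> 1 | Some (h, k, c) \<Rightarrow> ennreal (phi N k (x + p i * h - c))) \<partial>stepM)"
proof -
  interpret S: prob_space stepM by (rule prob_space_stepM)
  interpret sequence_space stepM ..
  interpret O: prob_space Om by (rule prob_space_Om)
  let ?g = "\<lambda>z. case_nat (fst z) (snd z)"
  have iter: "distr (stepM \<Otimes>\<^sub>M Om) Om ?g = Om"
    using PiM_iter by (simp add: Om_eq case_prod_beta')
  have g[measurable]: "?g \<in> measurable (stepM \<Otimes>\<^sub>M Om) Om"
    unfolding Om_eq by measurable
  have "ennreal (phi (Suc N) i x) = emeasure (distr (stepM \<Otimes>\<^sub>M Om) Om ?g) (surv (Suc N) i x)"
    by (simp only: ennreal_phi iter)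
  also have "\<dots> = emeasure (stepM \<Otimes>\<^sub>M Om) (?g -` surv (Suc N) i x \<inter> space (stepM \<Otimes>\<^sub>M Om))"
    by (rule emeasure_distr) auto
  also have "\<dots> = (\<integral>\<^sup>+s. emeasure Om (Pair s -` (?g -` surv (Suc N) i x \<inter> space (stepM \<Otimes>\<^sub>M Om))) \<partial>stepM)"
    by (rule O.emeasure_pair_measure_alt) measurable
  also have "\<dots> = (\<integral>\<^sup>+s. (case mm_step lam Q i s of None \<Rightarrow> 1 | Some (h, k, c) \<Rightarrow> ennreal (phi N k (x + p i * h - c))) \<partial>stepM)"
  proof (rule nn_integral_cong)
    fix s assume s: "s \<in> space stepM"
    have sp: "case_nat s \<omega> \<in> space Om" if "\<omega> \<in> space Om" for \<omega>
      using measurable_space[OF g, of "(s, \<omega>)"] s that by (simp add: space_pair_measure)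
    have all_Suc: "(\<forall>n\<le>Suc N. P n) \<longleftrightarrow> P 0 \<and> (\<forall>n\<le>N. P (Suc n))" for P
      by (metis Suc_le_mono le0 not0_implies_Suc)
    show "emeasure Om (Pair s -` (?g -` surv (Suc N) i x \<inter> space (stepM \<Otimes>\<^sub>M Om))) =
        (case mm_step lam Q i s of None \<Rightarrow> 1 | Some (h, k, c) \<Rightarrow> ennreal (phi N k (x + p i * h - c)))"
    proof (cases "mm_step lam Q i s")
      case None
      have "Pair s -` (?g -` surv (Suc N) i x \<inter> space (stepM \<Otimes>\<^sub>M Om)) = space Om"
        using s sp x skel_case_nat_None[OF None]
        by (auto simp: surv_def space_pair_measure all_Suc surplus_def)
      then show ?thesis using None O.emeasure_space_1 by simp
    next
      case (Some r)
      obtain h k c where r: "r = (h, k, c)" by (cases r)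
      have "surplus x i (case_nat s \<omega>) (Suc n) = surplus (x + p i * h - c) k \<omega> n" for \<omega> n
        unfolding surplus_def skel_case_nat_Some[OF Some[unfolded r]] by (auto split: prod.splits)
      then have "Pair s -` (?g -` surv (Suc N) i x \<inter> space (stepM \<Otimes>\<^sub>M Om)) = surv N k (x + p i * h - c)"
        using s sp x by (auto simp: surv_def space_pair_measure all_Suc surplus_0)
      then show ?thesis using Some r by (simp add: ennreal_phi)
    qed
  qed
  finally show ?thesis .
qed

lemma phi_absorbing:
  assumes "eta i = 0" "0 \<le> x"
  shows "phi (Suc N) i x = 1"
proof -
  interpret S: prob_space stepM by (rule prob_space_stepM)
  have "ennreal (phi (Suc N) i x) = 1"
    using assms by (simp add: phi_Suc mm_step_None active_empty_iff S.emeasure_space_1)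
  then show ?thesis using phi_nonneg[of "Suc N" i x] by (metis ennreal_eq_1)
qed

lemma conv_phi: "0 \<le> conv (phi N) i s" "conv (phi N) i s \<le> eta i"
proof -
  show "0 \<le> conv (phi N) i s"
    unfolding conv_def by (intro sum_nonneg mult_nonneg_nonneg rate_nonneg Bochner_Integration.integral_nonneg phi_nonneg)
  have "(\<integral>c. phi N k (s - c) \<partial>law i k) \<le> 1" for k
    using claim_law.abs_integral_causal_le[OF law causal_phi, of s N k 1 i k] phi_le_1[of N k] phi_nonneg[of N k]
    by auto
  then show "conv (phi N) i s \<le> eta i"
    unfolding conv_def eta_def by (intro sum_mono) (auto intro: mult_left_le rate_nonneg)
qed

lemma phi_Suc_lborel:
  assumes eta: "0 < eta i" and x: "0 \<le> x"
  shows "ennreal (phi (Suc N) i x) =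
    (\<integral>\<^sup>+s. ennreal (exp (- (eta i / p i) * (s - x)) * (conv (phi N) i s / p i)) * indicator {x..} s \<partial>lborel)"
proof -
  note c = causal_phi
  have conv[measurable]: "conv (phi N) i \<in> borel_measurable borel"
    by (rule causal_measurable[OF causal_conv[OF c]])
  have "ennreal (phi (Suc N) i x) = (\<Sum>k\<in>UNIV. ennreal (rate i k) *
      (\<integral>\<^sup>+h. ennreal (exp (- eta i * h)) * indicator {0..} h * (\<integral>\<^sup>+c. ennreal (phi N k (x + p i * h - c)) \<partial>law i k) \<partial>lborel))"
    unfolding phi_Suc[OF x] by (rule nn_integral_mm_step[OF eta]) measurable
  also have "\<dots> = (\<Sum>k\<in>UNIV. \<integral>\<^sup>+h. ennreal (exp (- eta i * h)) * indicator {0..} h *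
      ennreal (rate i k * (\<integral>c. phi N k (x + p i * h - c) \<partial>law i k)) \<partial>lborel)"
  proof (rule sum.cong[OF refl])
    fix k
    interpret claim_law "law i k" by (rule law)
    have "(\<integral>\<^sup>+c. ennreal (phi N k (y - c)) \<partial>law i k) = ennreal (\<integral>c. phi N k (y - c) \<partial>law i k)" for y
      by (rule nn_integral_eq_integral[OF integrable_causal[OF c]]) (simp add: phi_nonneg)
    then show "ennreal (rate i k) * (\<integral>\<^sup>+h. ennreal (exp (- eta i * h)) * indicator {0..} h * (\<integral>\<^sup>+c. ennreal (phi N k (x + p i * h - c)) \<partial>law i k) \<partial>lborel) =
      (\<integral>\<^sup>+h. ennreal (exp (- eta i * h)) * indicator {0..} h * ennreal (rate i k * (\<integral>c. phi N k (x + p i * h - c) \<partial>law i k)) \<partial>lborel)"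
      by (subst nn_integral_cmult[symmetric], measurable)
         (auto intro!: nn_integral_cong simp: ennreal_mult rate_nonneg phi_nonneg mult_ac)
  qed
  also have "\<dots> = (\<integral>\<^sup>+h. (\<Sum>k\<in>UNIV. ennreal (exp (- eta i * h)) * indicator {0..} h *
      ennreal (rate i k * (\<integral>c. phi N k (x + p i * h - c) \<partial>law i k))) \<partial>lborel)"
  proof (rule nn_integral_sum[symmetric])
    fix k
    interpret claim_law "law i k" by (rule law)
    show "(\<lambda>h. ennreal (exp (- eta i * h)) * indicator {0..} h *
      ennreal (rate i k * (\<integral>c. phi N k (x + p i * h - c) \<partial>law i k))) \<in> borel_measurable lborel"
      by measurable
  qed
  also have "\<dots> = (\<integral>\<^sup>+h. ennreal (exp (- eta i * h)) * indicator {0..} h * ennreal (conv (phi N) i (x + p i * h)) \<partial>lborel)"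
    by (intro nn_integral_cong)
       (simp add: conv_def sum_distrib_left[symmetric] rate_nonneg phi_nonneg)
  \<comment> \<open>Passing from the waiting time \<open>h\<close> to the level s = x + p i * h just
    before the claim; \<open>p i\<close> is the Jacobian, balanced by the division by
    \<open>p i\<close>.\<close>
  also have "\<dots> = (\<integral>\<^sup>+h. ennreal (p i) * (ennreal (exp (- (eta i / p i) * ((x + p i * h) - x)) *
      (conv (phi N) i (x + p i * h) / p i)) * indicator {x..} (x + p i * h)) \<partial>lborel)"
    using p_pos[of i] conv_phi(1)[of N i]
    by (intro nn_integral_cong)
       (auto simp: indicator_def zero_le_mult_iff mult.assoc[symmetric] ennreal_mult[symmetric])
  also have "\<dots> = ennreal \<bar>p i\<bar> * (\<integral>\<^sup>+h. ennreal (exp (- (eta i / p i) * ((x + p i * h) - x)) *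
      (conv (phi N) i (x + p i * h) / p i)) * indicator {x..} (x + p i * h) \<partial>lborel)"
    using p_pos[of i] by (subst nn_integral_cmult) (auto simp: abs_of_pos)
  also have "\<dots> = (\<integral>\<^sup>+s. ennreal (exp (- (eta i / p i) * (s - x)) * (conv (phi N) i s / p i)) * indicator {x..} s \<partial>lborel)"
    by (rule nn_integral_real_affine[symmetric]) (use p_pos[of i] in auto)
  finally show ?thesis .
qed

text \<open>Cut the integral of \<open>phi_Suc_lborel\<close> at \<open>y\<close>. The part beyond
  is nonnegative, and since the convolution is at most \<open>eta i\<close> it is at most the
  probability of no event before level \<open>y\<close>.\<close>

lemma phi_bounds:
  fixes x y :: real and i :: 'n and N :: nat
  assumes x: "0 \<le> x" and xy: "x \<le> y"
  defines "I \<equiv> integral {x..y} (\<lambda>s. exp (- (eta i / p i) * (s - x)) * ((conv (phi N) i s + 0) / p i))"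
  shows "phi (Suc N) i x \<le> exp (- (eta i / p i) * (y - x)) + I" and "I \<le> phi (Suc N) i x"
proof -
  let ?F = "\<lambda>s. exp (- (eta i / p i) * (s - x)) * (conv (phi N) i s / p i)"
  have F0: "0 \<le> ?F s" for s using conv_phi(1)[of N i s] p_pos[of i] by simp
  have "I = integral {x..y} ?F" by (simp add: I_def)
  have "causal (\<lambda>s. conv (phi N) i s / p i)"
    using causal_cmult[OF causal_conv[OF causal_phi], of "1 / p i"] by simp
  then have int: "set_integrable lborel {x..y} ?F"
    by (rule causal_set_integrable) (intro continuous_intros)
  have I: "(\<integral>\<^sup>+s. ennreal (?F s) * indicator {x..y} s \<partial>lborel) = ennreal I"
  proof -
    have "(\<integral>\<^sup>+s. ennreal (?F s) * indicator {x..y} s \<partial>lborel) = (\<integral>\<^sup>+s. ennreal (indicator {x..y} s *\<^sub>R ?F s) \<partial>lborel)"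
      by (intro nn_integral_cong) (auto simp: indicator_def)
    also have "\<dots> = ennreal (\<integral>s. indicator {x..y} s *\<^sub>R ?F s \<partial>lborel)"
      using int F0 unfolding set_integrable_def by (intro nn_integral_eq_integral) (auto simp: indicator_def)
    also have "(\<integral>s. indicator {x..y} s *\<^sub>R ?F s \<partial>lborel) = I"
      using set_borel_integral_eq_integral(2)[OF int] \<open>I = integral {x..y} ?F\<close> by (simp add: set_lebesgue_integral_def)
    finally show ?thesis .
  qed
  have I0: "0 \<le> I"
    using set_borel_integral_eq_integral(1)[OF int] F0 unfolding \<open>I = integral {x..y} ?F\<close>
    by (intro integral_nonneg) auto
  show "phi (Suc N) i x \<le> exp (- (eta i / p i) * (y - x)) + I"
  proof (cases "eta i = 0")
    case True
    then show ?thesis using I0 phi_le_1[of "Suc N" i x] by simp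
  next
    case False
    then have eta: "0 < eta i" using eta_nonneg[of i] by simp
    then have b: "0 < eta i / p i" using p_pos[of i] by simp
    have conv[measurable]: "conv (phi N) i \<in> borel_measurable borel"
      by (rule causal_measurable[OF causal_conv[OF causal_phi]])
    have "ennreal (phi (Suc N) i x) \<le> (\<integral>\<^sup>+s. ennreal (?F s) * indicator {x..y} s +
        ennreal (eta i / p i * exp (- (eta i / p i) * (s - x))) * indicator {y..} s \<partial>lborel)"
      unfolding phi_Suc_lborel[OF eta x]
    proof (rule nn_integral_mono)
      fix s :: real
      have "?F s \<le> exp (- (eta i / p i) * (s - x)) * (eta i / p i)"
        using conv_phi(2)[of N i s] p_pos[of i] by (intro mult_left_mono divide_right_mono) auto
      then show "ennreal (?F s) * indicator {x..} s \<le> ennreal (?F s) * indicator {x..y} s +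
          ennreal (eta i / p i * exp (- (eta i / p i) * (s - x))) * indicator {y..} s"
        using xy by (auto simp: indicator_def mult.commute intro!: ennreal_leI)
    qed
    also have "\<dots> = ennreal I + ennreal (exp (- (eta i / p i) * (y - x)))"
      by (subst nn_integral_add) (simp_all only: I nn_integral_exp_atLeast[OF b], measurable)
    also have "\<dots> = ennreal (I + exp (- (eta i / p i) * (y - x)))"
      using I0 by (simp add: ennreal_plus[symmetric] del: ennreal_plus)
    finally show ?thesis
      using I0 by (subst (asm) ennreal_le_iff) (auto simp: add.commute)
  qed
  show "I \<le> phi (Suc N) i x"
  proof (cases "eta i = 0")
    case True
    then have "conv (phi N) i s = 0" for s using conv_phi[of N i s] by simp
    then show ?thesis by (simp add: \<open>I = integral {x..y} ?F\<close> phi_nonneg)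
  next
    case False
    then have eta: "0 < eta i" using eta_nonneg[of i] by simp
    have "ennreal I \<le> ennreal (phi (Suc N) i x)"
      unfolding I[symmetric] phi_Suc_lborel[OF eta x]
      by (intro nn_integral_mono mult_left_mono) (auto simp: indicator_def)
    then show ?thesis by (simp add: ennreal_le_iff phi_nonneg)
  qed
qed

end

section \<open>The ruin event\<close>

context risk_model
begin

lemma tau0_infinite_iff: "tau0 p lam Q x i \<omega> = \<infinity> \<longleftrightarrow> \<not> (\<exists>t\<ge>0. Xpath p lam Q x i \<omega> t < 0)"
proof
  assume inf: "tau0 p lam Q x i \<omega> = \<infinity>"
  show "\<not> (\<exists>t\<ge>0. Xpath p lam Q x i \<omega> t < 0)"
  proof
    assume "\<exists>t\<ge>0. Xpath p lam Q x i \<omega> t < 0"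
    then obtain t where "0 \<le> t" "Xpath p lam Q x i \<omega> t < 0" by blast
    then have "tau0 p lam Q x i \<omega> \<le> ereal t" unfolding tau0_def by (intro Inf_lower) auto
    with inf show False by simp
  qed
next
  assume "\<not> (\<exists>t\<ge>0. Xpath p lam Q x i \<omega> t < 0)"
  then have "{t. 0 \<le> t \<and> Xpath p lam Q x i \<omega> t < 0} = {}" by auto
  then show "tau0 p lam Q x i \<omega> = \<infinity>" by (simp only: tau0_def image_empty Inf_empty top_ereal_def)
qed

lemma Xpath_eq:
  assumes "last_ev p lam Q x i \<omega> t = n"
  shows "Xpath p lam Q x i \<omega> t = surplus x i \<omega> n + p (state x i \<omega> n) * (t - time x i \<omega> n)"
  using assms by (simp add: Xpath_def surplus_def state_def time_def split: prod.splits)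

lemma last_ev_eq: "last_ev p lam Q x i \<omega> t = (GREATEST n. occurs x i \<omega> n \<and> time x i \<omega> n \<le> t)"
  by (simp add: last_ev_def occurs_def time_def)

text \<open>If infinitely many events happen before \<open>t\<close>, then \<^const>\<open>Greatest\<close> returns a constant junk index.
  This concerns a null set only, but the ruin event has to be measurable on all of the sample space.\<close>

definition junk :: nat where
  "junk = (THE n. False)"

lemma Greatest_infinite:
  assumes "\<forall>k. \<exists>n\<ge>k. P n"
  shows "(GREATEST n::nat. P n) = junk"
proof -
  have "(\<lambda>x. P x \<and> (\<forall>y. P y \<longrightarrow> y \<le> x)) = (\<lambda>x. False)"
    using assms by (auto simp: fun_eq_iff) (metis not_less_eq_eq)
  then show ?thesis by (simp only: Greatest_def junk_def)
qed

text \<open>Ruin at some real time is reduced to countably many conditions that hold at every sample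
  point. If \<open>n\<close> is the last event before ruin, the increasing path is already negative
  at the first admissible time of that stretch; the maximum with 0 is there because sample points
  may carry negative clocks. The second alternative is explosion before ruin, where the path is read
  off from the fixed index \<open>junk\<close>.\<close>

lemma ruin_iff:
  fixes x :: real and i :: 'n and \<omega> :: "nat \<Rightarrow> 'n step"
  defines "T \<equiv> time x i \<omega>" and "Y \<equiv> surplus x i \<omega>" and "A \<equiv> occurs x i \<omega>" and "r \<equiv> \<lambda>n. p (state x i \<omega> n)"
  shows "(\<exists>t\<ge>0. Xpath p lam Q x i \<omega> t < 0) \<longleftrightarrow>
    (\<exists>n. A n \<and> Y n + r n * (max (T n) 0 - T n) < 0 \<and> (\<forall>m>n. A m \<longrightarrow> max (T n) 0 < T m)) \<or>
    (\<exists>q::rat. 0 \<le> real_of_rat q \<and> (\<forall>k. \<exists>n\<ge>k. A n \<and> T n \<le> real_of_rat q) \<and>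
       Y junk + r junk * (real_of_rat q - T junk) < 0)"
    (is "_ \<longleftrightarrow> ?L \<or> ?R")
proof
  have r: "0 < r n" for n by (simp add: r_def p_pos)
  have X: "Xpath p lam Q x i \<omega> t = Y n + r n * (t - T n)" if "last_ev p lam Q x i \<omega> t = n" for t n
    using Xpath_eq[OF that] by (simp add: Y_def r_def T_def)
  have L: "last_ev p lam Q x i \<omega> t = (GREATEST n. A n \<and> T n \<le> t)" for t
    by (simp add: last_ev_eq A_def T_def)
  {
    assume "\<exists>t\<ge>0. Xpath p lam Q x i \<omega> t < 0"
    then obtain t where t: "0 \<le> t" "Xpath p lam Q x i \<omega> t < 0" by blast
    let ?P = "\<lambda>n. A n \<and> T n \<le> t"
    have P0: "?P 0" using t by (simp add: A_def T_def occurs_def time_def)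
    show "?L \<or> ?R"
    proof (cases "\<forall>k. \<exists>n\<ge>k. ?P n")
      case True
      have "last_ev p lam Q x i \<omega> t = junk"
        unfolding L by (rule Greatest_infinite[OF True])
      then have neg: "Y junk + r junk * (t - T junk) < 0"
        using t(2) X by simp
      \<comment> \<open>The right-hand side is the time at which the line through the junk index
        reaches 0; a rational time before it still sees a negative value.\<close>
      have "t < t - (Y junk + r junk * (t - T junk)) / r junk"
        using neg r[of junk] by (simp add: divide_neg_pos)
      then obtain q where q: "t < real_of_rat q" "real_of_rat q < t - (Y junk + r junk * (t - T junk)) / r junk"
        using of_rat_dense by blast
      have "Y junk + r junk * (real_of_rat q - T junk) < 0"
        using q(2) r[of junk] by (simp add: field_simps)
      moreover have "\<forall>k. \<exists>n\<ge>k. A n \<and> T n \<le> real_of_rat q"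
        using True q(1) by (meson less_imp_le order_trans)
      moreover have "0 \<le> real_of_rat q" using q(1) t(1) by linarith
      ultimately show ?thesis by blast
    next
      case False
      then obtain k where k: "\<And>n. ?P n \<Longrightarrow> n \<le> k" by (metis nle_le)
      define n where "n = (GREATEST n. ?P n)"
      have n: "?P n" unfolding n_def by (rule GreatestI_nat[of ?P 0 k]) (use P0 k in auto)
      have m: "t < T m" if "n < m" "A m" for m
      proof (rule ccontr)
        assume "\<not> t < T m"
        then have "m \<le> n" unfolding n_def using that by (intro Greatest_le_nat[of ?P m k]) (use k in auto)
        with that show False by simp
      qed
      have "last_ev p lam Q x i \<omega> t = n" unfolding L n_def ..
      then have "Y n + r n * (t - T n) < 0" using t(2) X by simp
      moreover have "r n * (max (T n) 0 - T n) \<le> r n * (t - T n)"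
        using n t(1) r[of n] by (intro mult_left_mono) auto
      ultimately have "Y n + r n * (max (T n) 0 - T n) < 0" by linarith
      then have ?L using n m t(1) by (intro exI[of _ n]) force
      then show ?thesis ..
    qed
  next
    assume "?L \<or> ?R"
    then show "\<exists>t\<ge>0. Xpath p lam Q x i \<omega> t < 0"
    proof
      assume ?L
      then obtain n where n: "A n" "Y n + r n * (max (T n) 0 - T n) < 0"
        and m: "\<And>m. m > n \<Longrightarrow> A m \<Longrightarrow> max (T n) 0 < T m" by blast
      have "last_ev p lam Q x i \<omega> (max (T n) 0) = n"
        unfolding L
      proof (rule Greatest_equality)
        show "A n \<and> T n \<le> max (T n) 0" using n by simp
        fix l assume l: "A l \<and> T l \<le> max (T n) 0"
        show "l \<le> n"
        proof (rule ccontr)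
          assume "\<not> l \<le> n"
          then show False using m[of l] l by (simp add: le_max_iff_disj)
        qed
      qed
      then have "Xpath p lam Q x i \<omega> (max (T n) 0) < 0"
        using n(2) X by simp
      then show ?thesis by (intro exI[of _ "max (T n) 0"]) simp
    next
      assume ?R
      then obtain q where q: "0 \<le> real_of_rat q" "\<forall>k. \<exists>n\<ge>k. A n \<and> T n \<le> real_of_rat q"
        "Y junk + r junk * (real_of_rat q - T junk) < 0" by blast
      have "last_ev p lam Q x i \<omega> (real_of_rat q) = junk"
        unfolding L by (rule Greatest_infinite[OF q(2)])
      then have "Xpath p lam Q x i \<omega> (real_of_rat q) < 0"
        using q(3) X by simp
      then show ?thesis using q(1) by blast
    qed
  }
qed

text \<open>Almost sure agreement with survival of the skeleton would not suffice alone, since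
  \<open>measure\<close> is 0 on non-measurable sets.\<close>

lemma ruin_measurable: "{\<omega> \<in> space Om. tau0 p lam Q x i \<omega> = \<infinity>} \<in> sets Om"
proof -
  have [measurable]: "(\<lambda>\<omega>. p (state x i \<omega> n)) \<in> borel_measurable Om" for n
    by (rule measurable_compose[OF skeleton_measurable(2)]) simp
  show ?thesis unfolding tau0_infinite_iff ruin_iff by measurable
qed

section \<open>Almost sure behaviour of the event times\<close>

lemma occurs_Suc: "occurs x i \<omega> (Suc n) \<longleftrightarrow> occurs x i \<omega> n \<and> active (state x i \<omega> n) \<noteq> {}"
  by (cases "skel p lam Q x i \<omega> n") (simp add: occurs_def state_def skel_Suc advance_def)

lemma time_Suc: "occurs x i \<omega> (Suc n) \<Longrightarrow> time x i \<omega> (Suc n) = time x i \<omega> n + wait (state x i \<omega> n) (\<omega> n)"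
  by (cases "skel p lam Q x i \<omega> n") (auto simp: occurs_def state_def time_def skel_Suc advance_def split: if_splits)

lemma surplus_Suc: "\<not> occurs x i \<omega> (Suc n) \<Longrightarrow> surplus x i \<omega> (Suc n) = surplus x i \<omega> n"
  by (cases "skel p lam Q x i \<omega> n") (auto simp: occurs_def surplus_def skel_Suc advance_def split: if_splits)

lemma occurs_mono: "m \<le> n \<Longrightarrow> occurs x i \<omega> n \<Longrightarrow> occurs x i \<omega> m"
  by (induction rule: dec_induct) (auto simp: occurs_Suc)

text \<open>All clocks are constrained at once, so the event does not depend on the current state.
  Level 0 makes waiting times positive, level 1 makes them at least 1 / max_rate.\<close>

definition clocks_gt :: "real \<Rightarrow> 'n step set" where
  "clocks_gt t = ({t<..} \<times> (\<Pi>\<^sub>E k\<in>UNIV. {t<..})) \<times> space claimsM"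

lemma clock_gt: "s \<in> clocks_gt t \<Longrightarrow> t < clock j k s"
  by (auto simp: clocks_gt_def clock_def PiE_iff)

lemma clocks_gt_sets[measurable]: "clocks_gt t \<in> sets stepM"
  unfolding clocks_gt_def stepM_eq by (intro pair_measureI sets_PiM_I_finite) auto

text \<open>Independence of one claim clock and CARD('n) switch clocks; hence the successor in the
  exponent.\<close>

lemma emeasure_clocks_gt:
  assumes "0 \<le> t"
  shows "emeasure stepM (clocks_gt t) = ennreal (exp (- t) ^ Suc CARD('n))"
proof -
  interpret E: prob_space exp1 by (rule prob_space_exp1)
  interpret product_prob_space "\<lambda>_. exp1" "UNIV :: 'n set" ..
  interpret B: prob_space claimsM by (rule prob_space_claimsM)
  have "emeasure stepM (clocks_gt t) = emeasure clocksM ({t<..} \<times> (\<Pi>\<^sub>E k\<in>UNIV. {t<..}))"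
    unfolding clocks_gt_def stepM_eq
    by (subst B.emeasure_pair_measure_Times) (auto intro!: pair_measureI sets_PiM_I_finite simp: B.emeasure_space_1)
  also have "\<dots> = emeasure exp1 {t<..} * emeasure (\<Pi>\<^sub>M k\<in>UNIV. exp1) (\<Pi>\<^sub>E k\<in>(UNIV :: 'n set). {t<..})"
    by (rule sigma_finite_measure.emeasure_pair_measure_Times[OF prob_space_imp_sigma_finite[OF prob_space_clocks]])
       (auto intro!: sets_PiM_I_finite)
  also have "emeasure (\<Pi>\<^sub>M k\<in>UNIV. exp1) (\<Pi>\<^sub>E k\<in>(UNIV :: 'n set). {t<..}) = (\<Prod>k\<in>(UNIV :: 'n set). emeasure exp1 {t<..})"
    by (rule emeasure_PiM) auto
  finally show ?thesis
    using assms by (simp add: exp1_tail ennreal_power ennreal_mult[symmetric])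
qed

lemma wait_pos: "s \<in> clocks_gt 0 \<Longrightarrow> active j \<noteq> {} \<Longrightarrow> 0 < wait j s"
  unfolding wait_def by (subst Min_gr_iff) (auto simp: active_def clock_gt)

definition max_rate :: real where
  "max_rate = Max (range (\<lambda>(j, k). rate j k))"

lemma rate_le_max: "rate j k \<le> max_rate"
  unfolding max_rate_def by (intro Max_ge) (auto intro!: image_eqI[of _ _ "(j, k)"])

lemma wait_ge: "s \<in> clocks_gt 1 \<Longrightarrow> active j \<noteq> {} \<Longrightarrow> 1 / max_rate \<le> wait j s"
proof -
  assume s: "s \<in> clocks_gt 1" and ne: "active j \<noteq> {}"
  have "1 / max_rate \<le> clock j k s / rate j k" if "k \<in> active j" for k
    using that rate_le_max[of j k] clock_gt[OF s, of j k] by (intro frac_le) (auto simp: active_def)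
  then show ?thesis unfolding wait_def using ne by (subst Min_ge_iff) auto
qed

definition regular :: "(nat \<Rightarrow> 'n step) \<Rightarrow> bool" where
  "regular \<omega> \<longleftrightarrow> (\<forall>n. \<omega> n \<in> clocks_gt 0) \<and> (\<forall>k. \<exists>n\<ge>k. \<omega> n \<in> clocks_gt 1)"

text \<open>If long waits stopped at index \<open>k\<close>, then for every \<open>m\<close> the
  \<open>m\<close> independent steps from \<open>k\<close> on would all miss an event of positive
  probability; this has probability S.prob B ^ m, which tends to 0.\<close>

lemma AE_regular: "AE \<omega> in Om. regular \<omega>"
proof -
  interpret S: prob_space stepM by (rule prob_space_stepM)
  interpret sequence_space stepM ..
  have "S.prob (clocks_gt 0) = 1"
    using emeasure_clocks_gt[of 0] by (simp add: measure_def)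
  then have "AE s in stepM. s \<in> clocks_gt 0" by (simp add: S.AE_in_set_eq_1)
  then have "AE \<omega> in Om. \<omega> n \<in> clocks_gt 0" for n
    unfolding Om_eq by (intro AE_PiM_component prob_space_stepM) auto
  then have 1: "AE \<omega> in Om. \<forall>n. \<omega> n \<in> clocks_gt 0" by (simp add: AE_all_countable)
  have "AE \<omega> in Om. \<exists>n\<ge>k. \<omega> n \<in> clocks_gt 1" for k
  proof -
    define B where "B = space stepM - clocks_gt 1"
    have B[measurable]: "B \<in> sets stepM" by (simp add: B_def)
    define N where "N = {\<omega> \<in> space Om. \<forall>n\<ge>k. \<omega> n \<in> B}"
    have N[measurable]: "N \<in> sets Om" unfolding N_def by measurable
    have "S.prob B = 1 - exp (- 1) ^ Suc CARD('n)"
      using emeasure_clocks_gt[of 1] unfolding B_def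
      by (subst S.prob_compl) (auto simp: measure_def)
    moreover have "(0::real) < exp (- 1) ^ Suc CARD('n)" by simp
    ultimately have "S.prob B < 1" by linarith
    then have r: "0 \<le> S.prob B" "S.prob B < 1" by auto
    interpret O: prob_space Om by (rule prob_space_Om)
    have "O.prob N \<le> S.prob B ^ m" for m
    proof -
      have "O.prob N \<le> O.prob {\<omega> \<in> space Om. \<forall>n\<in>{k..<k+m}. \<omega> n \<in> B}"
        by (rule O.finite_measure_mono) (auto simp: N_def)
      also have "\<dots> = S.prob B ^ m"
      proof -
        have "emeasure Om {\<omega> \<in> space Om. \<forall>n\<in>{k..<k+m}. \<omega> n \<in> B} = (\<Prod>n\<in>{k..<k+m}. emeasure stepM B)"
          unfolding Om_eq by (rule emeasure_PiM_Collect) auto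
        then show ?thesis
          by (simp add: S.emeasure_eq_measure O.emeasure_eq_measure ennreal_power)
      qed
      finally show ?thesis .
    qed
    moreover have "(\<lambda>m. S.prob B ^ m) \<longlonglongrightarrow> 0" using r by (intro LIMSEQ_power_zero) auto
    ultimately have "O.prob N \<le> 0" by (intro LIMSEQ_le_const) auto
    then have "O.prob N = 0" using measure_nonneg[of Om N] by linarith
    then have "AE \<omega> in Om. \<omega> \<notin> N" by (subst O.prob_eq_0[symmetric]) auto
    moreover have "AE \<omega> in Om. \<forall>n. \<omega> n \<in> space stepM"
      by (rule AE_I2) (auto simp: Om_eq space_PiM PiE_iff)
    ultimately show ?thesis
      using AE_space
    proof eventually_elim
      case (elim \<omega>)
      then show ?case by (auto simp: N_def B_def)
    qed
  qed
  then have "AE \<omega> in Om. \<forall>k. \<exists>n\<ge>k. \<omega> n \<in> clocks_gt 1" by (simp add: AE_all_countable)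
  with 1 show ?thesis by eventually_elim (simp add: regular_def)
qed

lemma time_less:
  assumes reg: "regular \<omega>" and "n < m" "occurs x i \<omega> m"
  shows "time x i \<omega> n < time x i \<omega> m"
proof -
  have step: "time x i \<omega> l < time x i \<omega> (Suc l)" if "occurs x i \<omega> (Suc l)" for l
    using time_Suc[OF that] wait_pos[of "\<omega> l" "state x i \<omega> l"] that reg by (auto simp: regular_def occurs_Suc)
  show ?thesis
    using assms(2,3)
  proof (induction m rule: less_Suc_induct)
    case (1 l)
    then show ?case by (rule step)
  next
    case (2 a b c)
    then show ?case using occurs_mono[of b c x i \<omega>] by (meson less_imp_le less_trans)
  qed
qed

lemma time_nonneg: "regular \<omega> \<Longrightarrow> occurs x i \<omega> n \<Longrightarrow> 0 \<le> time x i \<omega> n"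
  using time_less[of \<omega> 0 n x i] by (cases n) (auto simp: time_def)

text \<open>Each of the infinitely many steps in \<open>clocks_gt 1\<close> advances time by at
  least 1 / max_rate, and event times increase, so they exceed every bound.\<close>

lemma no_explosion:
  assumes reg: "regular \<omega>"
  shows "\<not> (\<forall>k. \<exists>n\<ge>k. occurs x i \<omega> n \<and> time x i \<omega> n \<le> q)"
proof
  assume inf: "\<forall>k. \<exists>n\<ge>k. occurs x i \<omega> n \<and> time x i \<omega> n \<le> q"
  then have occ: "occurs x i \<omega> n" for n using occurs_mono by blast
  have mono: "time x i \<omega> n \<le> time x i \<omega> m" if "n \<le> m" for n m
    using time_less[OF reg, of n m x i] that occ by (cases "n = m") (auto simp: less_le)
  have le: "time x i \<omega> n \<le> q" for n using inf mono by (meson order_trans)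
  have ne: "active (state x i \<omega> n) \<noteq> {}" for n using occ[of "Suc n"] by (simp add: occurs_Suc)
  have R: "0 < max_rate"
    using ne[of 0] rate_le_max by (auto simp: active_def) (meson less_le_trans)
  have "\<exists>n. real N / max_rate \<le> time x i \<omega> n" for N
  proof (induction N)
    case 0
    then show ?case by (intro exI[of _ 0]) (simp add: time_def)
  next
    case (Suc N)
    then obtain n where n: "real N / max_rate \<le> time x i \<omega> n" by blast
    obtain m where m: "m \<ge> n" "\<omega> m \<in> clocks_gt 1" using reg by (auto simp: regular_def)
    have "real (Suc N) / max_rate \<le> time x i \<omega> m + 1 / max_rate"
      using n mono[OF m(1)] by (simp add: add_divide_distrib)
    also have "\<dots> \<le> time x i \<omega> (Suc m)"
      using wait_ge[OF m(2) ne[of m]] time_Suc[OF occ[of "Suc m"]] by simp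
    finally show ?case by blast
  qed
  then have "real N / max_rate \<le> q" for N using le by (meson order_trans)
  then have "real N \<le> q * max_rate" for N using R by (simp add: field_simps)
  moreover obtain N where "q * max_rate < real N" using reals_Archimedean2 by blast
  ultimately show False by (meson not_le)
qed

lemma surplus_eq_occurs: "\<exists>m\<le>n. occurs x i \<omega> m \<and> surplus x i \<omega> m = surplus x i \<omega> n"
proof (induction n)
  case 0
  show ?case by (simp add: occurs_def)
next
  case (Suc n)
  then show ?case using surplus_Suc[of x i \<omega> n] by (metis le_Suc_eq)
qed

text \<open>On regular points event times are nonnegative and strictly increasing, so in
  \<open>ruin_iff\<close> the first alternative reduces to a negative surplus at an event, and the
  explosion alternative is impossible.\<close>

lemma survival_iff:
  assumes reg: "regular \<omega>"
  shows "tau0 p lam Q x i \<omega> = \<infinity> \<longleftrightarrow> (\<forall>n. 0 \<le> surplus x i \<omega> n)"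
proof -
  have "(\<exists>t\<ge>0. Xpath p lam Q x i \<omega> t < 0) \<longleftrightarrow> (\<exists>n. occurs x i \<omega> n \<and> surplus x i \<omega> n < 0)"
  proof -
    have "(occurs x i \<omega> n \<and> surplus x i \<omega> n + p (state x i \<omega> n) * (max (time x i \<omega> n) 0 - time x i \<omega> n) < 0 \<and>
        (\<forall>m>n. occurs x i \<omega> m \<longrightarrow> max (time x i \<omega> n) 0 < time x i \<omega> m)) \<longleftrightarrow>
        occurs x i \<omega> n \<and> surplus x i \<omega> n < 0" for n
    proof (cases "occurs x i \<omega> n")
      case True
      then have "max (time x i \<omega> n) 0 = time x i \<omega> n" using time_nonneg[OF reg] by simp
      then show ?thesis using time_less[OF reg] by auto
    qed simp
    then show ?thesis unfolding ruin_iff using no_explosion[OF reg, of x i] by blast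
  qed
  also have "\<dots> \<longleftrightarrow> (\<exists>n. surplus x i \<omega> n < 0)"
    using surplus_eq_occurs[of _ x i \<omega>] by metis
  finally show ?thesis unfolding tau0_infinite_iff by (simp add: not_less)
qed

text \<open>Continuity from above along the decreasing events \<open>surv N i x\<close>, whose
  intersection agrees almost surely with survival.\<close>

lemma phi_tendsto: "(\<lambda>N. phi N i x) \<longlonglongrightarrow> phibar p lam Q FC FCJ i x"
proof -
  interpret O: prob_space Om by (rule prob_space_Om)
  have "(\<lambda>N. measure Om (surv N i x)) \<longlonglongrightarrow> measure Om (\<Inter>N. surv N i x)"
    by (rule O.finite_Lim_measure_decseq) (auto simp: decseq_def surv_def)
  moreover have "measure Om (\<Inter>N. surv N i x) = phibar p lam Q FC FCJ i x"
    unfolding phibar_def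
  proof (rule O.finite_measure_eq_AE)
    show "AE \<omega> in Om. \<omega> \<in> (\<Inter>N. surv N i x) \<longleftrightarrow> \<omega> \<in> {\<omega> \<in> space Om. tau0 p lam Q x i \<omega> = \<infinity>}"
      using AE_regular AE_space by eventually_elim (auto simp: surv_def survival_iff)
  qed (auto intro: ruin_measurable)
  ultimately show ?thesis by (simp add: phi_def)
qed

end

context scale_matrix
begin

lemma phibar_eq:
  assumes "0 \<le> x"
  shows "phibar p lam Q FC FCJ i x = ((W x ** C_infinity) *v (\<chi> k. 1)) $ i"
  using survival_limit[of phi, OF causal_phi phi_0 phi_absorbing phi_bounds phi_tendsto assms] psi_eq[OF assms]
  by simp

end

theorem theorem4:
  fixes Q :: "real^'n::finite^'n"
    and p lam :: "'n \<Rightarrow> real"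
    and FC :: "'n \<Rightarrow> real measure"
    and FCJ :: "'n \<Rightarrow> 'n \<Rightarrow> real measure"
    and W :: "real \<Rightarrow> real^'n^'n"
  assumes Q_offdiag: "\<forall>i j. i \<noteq> j \<longrightarrow> 0 \<le> Q$i$j"
    and Q_rows: "\<forall>i. (\<Sum>j\<in>UNIV. Q$i$j) = 0"
    and p_pos: "\<forall>i. 0 < p i"
    and lam_nonneg: "\<forall>i. 0 \<le> lam i"
    and FC_dist: "\<forall>i. prob_space (FC i) \<and> sets (FC i) = sets borel \<and> (AE c in FC i. 0 \<le> c)"
    and FCJ_dist: "\<forall>i j. i \<noteq> j \<longrightarrow>
                     prob_space (FCJ i j) \<and> sets (FCJ i j) = sets borel \<and> (AE c in FCJ i j. 0 \<le> c)"
    and net_profit: "\<forall>i. integrable (Omega FC FCJ) (\<lambda>\<omega>. Xpath p lam Q 0 i \<omega> 1) \<and>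
                         0 < (\<integral>\<omega>. Xpath p lam Q 0 i \<omega> 1 \<partial>Omega FC FCJ)"
    and W_scale: "is_scale_W p lam Q FC FCJ W"
  shows "\<exists>C. ((\<lambda>a. matrix_inv (W a) ** Zmat W Q a) \<longlongrightarrow> C) at_top \<and>
             (\<forall>x\<ge>0. \<forall>i. phibar p lam Q FC FCJ i x = ((W x ** C) *v (\<chi> k. 1)) $ i)"
proof -
  interpret risk_model p lam Q FC FCJ
  proof (rule risk_model.intro)
    show "claim_law (FC i)" for i
      using FC_dist by (simp add: claim_law_def claim_law_axioms_def)
    show "claim_law (FCJ i j)" if "i \<noteq> j" for i j
      using FCJ_dist that by (simp add: claim_law_def claim_law_axioms_def)
  qed (use Q_offdiag Q_rows p_pos lam_nonneg in blast)+
  interpret scale_matrix p lam Q FC FCJ W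
    by unfold_locales (rule W_scale)
  show ?thesis
    using C_tendsto phibar_eq by blast
qed

end
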